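(* Let $\mathcal G$ be a metric graph whose completion $\overline{\mathcal G}$ is compact and weakly connected. Let $\mathcal E=\{E(n),\ n=1,\dots,N\}$ be a finite partition of $\partial\overline{\mathcal G}$ by (nonempty) clopen sets, and let $\mu$ be a finite positive Borel measure on $\partial\overline{\mathcal G}$ with $\mu(E(n))>0$ for each $n$. Then, as linear maps on the finite dimensional space $\mathbb V_{\mathcal E}$, $$\lim_{\epsilon\to0^+}\Lambda_{\mathcal E(\epsilon),\mu}=\Lambda_{\mathcal E,\mu}.$$ Consequently, $\Lambda_{\mathcal E,\mu}:\mathbb V_{\mathcal E}\to\mathbb V_{\mathcal E}$ is self-adjoint and nonnegative.
   Context: A metric graph $\mathcal G$ is a connected, locally finite (every vertex has finite degree) graph with countable vertex set and edge set, in which each edge $e$ is assigned a length $l_e$ with $0<l_e<\infty$ and is identified with a real interval $[a_e,b_e]$ of length $l_e$. The distance $d(x_1,x_2)$ between points of $\mathcal G$ is the infimum of the lengths of paths joining them. $\overline{\mathcal G}$ denotes the completion of $(\mathcal G,d)$. $\partial\mathcal G$ is the set of vertices of degree $1$ (leaves); $\mathcal G_{int}=\mathcal G\setminus\partial\mathcal G$; and $\partial\overline{\mathcal G}=\overline{\mathcal G}\setminus\mathcal G_{int}$. Clopen means open and closed in $\partial\overline{\mathcal G}$. $\overline{\mathcal G}$ is weakly connected if for every pair of distinct points $x,y\in\overline{\mathcal G}$ there is a finite set $W$ of points of $\mathcal G$ and disjoint open sets $U,V\subset\overline{\mathcal G}$ with $x\in U$, $y\in V$ and $\overline{\mathcal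 G}\setminus W=U\cup V$. For an edge $e$ incident on a vertex $v$ ($e\sim v$), $\partial_\nu f_e(v)$ denotes the derivative of $f$ at $v$ along $e$ when $v$ is identified with $b_e$ (derivative pointing out of the edge at $v$; a loop contributes a term for each end). A continuous $f:\overline{\mathcal G}\to\mathbb R$ is harmonic on $\mathcal G_{int}$ if it is linear on each edge and $\sum_{e\sim v}\partial_\nu f_e(v)=0$ at each vertex $v\in\mathcal G_{int}$. Every continuous $F:\partial\overline{\mathcal G}\to\mathbb R$ has a unique continuous extension $f:\overline{\mathcal G}\to\mathbb R$ harmonic on $\mathcal G_{int}$ (known result), the harmonic extension. $\mathcal A$ is the algebra of functions $\phi:\overline{\mathcal G}\to\mathbb R$ that are continuous, infinitely differentiable on the open edges of $\mathcal G$, with $\phi'=0$ in the complement of a finite collection of edges and in an open neighborhood of each vertex $v\in\mathcal G$. $\mathbb V_{\mathcal E}$ is the real vector space spanned by the characteristic functions of the sets $E(n)$; $F\in\mathbb V_{\mathcal E}$ is viewed as a function on $\mathcal E$ with values $F(E(n))$. Its inner product is $$\langle F,G\rangle_{\mathcal E,\mu}=\frac1{\mu(\partial\overline{\mathcal G})}\sum_nF(E(n))G(E(n))\mu(E(n)).$$ The compressed Dirichlet to Neumann map on $\partial\overline{\mathcal G}$: for $F\in\mathbb V_{\mathcal E}$ with harmonic extension $f$, $$\Lambda_{\mathcal E,\mu}F(E(n))=-\mu(E(n))^{-1}\int_{\mathcal G}f\phi_n'',$$ where $\phi_n\in\mathcal A$ is any function with $\phi_n=1$ on $E(n)$ and $\phi_n=0$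 on $\partial\overline{\mathcal G}\setminus E(n)$ (such functions exist, and the value is independent of the choice). The approximating maps: for $\epsilon>0$, $\mathcal G_\epsilon$ is the finite subgraph of $\mathcal G$ whose (closed) edges are those edges of $\mathcal G$ containing a point whose distance from $\partial\overline{\mathcal G}$ is at least $\epsilon$, with vertices the endpoints of these edges. Its boundary $\partial\mathcal G_\epsilon$ is its relative boundary in $\mathcal G$: the set of vertices $v$ of $\mathcal G_\epsilon$ such that either $v$ is a leaf of $\mathcal G$ or $v$ has an incident edge of $\mathcal G$ that is not in $\mathcal G_\epsilon$. Let $N_\epsilon(E)$ be the set of points of $\overline{\mathcal G}$ at distance less than $\epsilon$ from some point of $E$. For $\epsilon>0$ sufficiently small the sets $N_\epsilon(E(n))$ are pairwise disjoint and each $v\in\partial\mathcal G_\epsilon$ lies in exactly one of them; let $\widetilde{E(n)}=\partial\mathcal G_\epsilon\cap N_\epsilon(E(n))$, and let $\mathcal E(\epsilon)=\{\widetilde{E(n)},\ n=1,\dots,N\}$ be the resulting partition of $\partial\mathcal G_\epsilon$. It inherits $\mu$ by $\mu(\widetilde{E(n)})=\mu(E(n))$, and identifying $\widetilde{E(n)}$ with $E(n)$ identifies functions on $\partial\mathcal G_\epsilon$ that are constant on each $\widetilde{E(n)}$ with elements of $\mathbb V_{\mathcal E}$. For $F\in\mathbb V_{\mathcal E}$, let $f_\epsilon$ be the harmonic extension to $\mathcal G_\epsilon$ of the function equal to $F(E(n))$ on $\widetilde{E(n)}$ (continuous on $\mathcal G_\epsilon$, linear on edges, with outward derivatives along the edges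 of $\mathcal G_\epsilon$ summing to $0$ at vertices of $\mathcal G_\epsilon$ not in $\partial\mathcal G_\epsilon$). Then $\Lambda_{\mathcal E(\epsilon),\mu}:\mathbb V_{\mathcal E}\to\mathbb V_{\mathcal E}$ is $$\Lambda_{\mathcal E(\epsilon),\mu}F(E(n))=\mu(E(n))^{-1}\sum_{v\in\widetilde{E(n)}}\ \sum_{e\sim v,\ e\subset\mathcal G_\epsilon}\partial_\nu (f_\epsilon)_e(v).$$ *)

theory Defs
  imports "Graph_Theory.Digraph_Component" "HOL-Analysis.Analysis"
begin

section \<open>Metric graphs and their completions\<close>

text \<open>
  The underlying graph is a multigraph (loops and parallel edges allowed), given as a
  \<^typ>\<open>('v, 'e) pre_digraph\<close>. The direction of an arc \<open>e\<close> only records its identification with a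
  real interval of length \<open>len e\<close>, which is taken to be \<open>[0, len e]\<close>, with \<open>0\<close> at the tail and
  \<open>len e\<close> at the head; connectedness is that of the underlying undirected graph.
\<close>

datatype ('v, 'e) gpoint = Vertex 'v | Inner 'e real

definition points :: "('v, 'e) pre_digraph \<Rightarrow> ('e \<Rightarrow> real) \<Rightarrow> ('v, 'e) gpoint set" where
  "points G len =
     Vertex ` verts G \<union> {Inner e t | e t. e \<in> arcs G \<and> 0 < t \<and> t < len e}"

definition edge_pt ::
  "('v, 'e) pre_digraph \<Rightarrow> ('e \<Rightarrow> real) \<Rightarrow> 'e \<Rightarrow> real \<Rightarrow> ('v, 'e) gpoint" where
  "edge_pt G len e t =
     (if t \<le> 0 then Vertex (tail G e) else if len e \<le> t then Vertex (head G e) else Inner e t)"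

text \<open>
  A path is a finite chain of segments; \<open>(e, s, t)\<close> is the segment of the edge \<open>e\<close> running from
  the parameter \<open>s\<close> to the parameter \<open>t\<close>.
\<close>

fun joins :: "('v, 'e) pre_digraph \<Rightarrow> ('e \<Rightarrow> real) \<Rightarrow> ('v, 'e) gpoint \<Rightarrow>
    ('e \<times> real \<times> real) list \<Rightarrow> ('v, 'e) gpoint \<Rightarrow> bool" where
  "joins G len x [] y \<longleftrightarrow> x = y"
| "joins G len x ((e, s, t) # p) y \<longleftrightarrow>
     e \<in> arcs G \<and> s \<in> {0..len e} \<and> t \<in> {0..len e} \<and> x = edge_pt G len e s \<and>
     joins G len (edge_pt G len e t) p y"

definition path_len :: "('e \<times> real \<times> real) list \<Rightarrow> real" where
  "path_len p = (\<Sum>(e, s, t)\<leftarrow>p. \<bar>t - s\<bar>)"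

definition gdist ::
  "('v, 'e) pre_digraph \<Rightarrow> ('e \<Rightarrow> real) \<Rightarrow> ('v, 'e) gpoint \<Rightarrow> ('v, 'e) gpoint \<Rightarrow> real" where
  "gdist G len x y = Inf {path_len p | p. joins G len x p y}"

locale metric_graph = wf_digraph G for G :: "('v, 'e) pre_digraph" +
  fixes len :: "'e \<Rightarrow> real"
  assumes countable_verts: "countable (verts G)"
    and countable_arcs: "countable (arcs G)"
    and graph_connected: "Digraph_Component.connected G"
    and locally_finite: "v \<in> verts G \<Longrightarrow> finite (in_arcs G v) \<and> finite (out_arcs G v)"
    and len_pos: "e \<in> arcs G \<Longrightarrow> 0 < len e"

text \<open>
  The completion is specified up to isometry: a complete set \<open>X\<close> in some metric space together
  with an isometric embedding \<open>\<iota>\<close> of the metric graph onto a dense subset of \<open>X\<close>.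
\<close>

locale metric_graph_completion = metric_graph G len
  for G :: "('v, 'e) pre_digraph" and len :: "'e \<Rightarrow> real" +
  fixes X :: "'c::metric_space set" and \<iota> :: "('v, 'e) gpoint \<Rightarrow> 'c"
  assumes completion_complete: "complete X"
    and embedding_into: "\<iota> ` points G len \<subseteq> X"
    and embedding_isometry:
      "x \<in> points G len \<Longrightarrow> y \<in> points G len \<Longrightarrow> dist (\<iota> x) (\<iota> y) = gdist G len x y"
    and embedding_dense: "X \<subseteq> closure (\<iota> ` points G len)"

text \<open>A loop contributes twice to the degree of its vertex.\<close>

definition leaves :: "('v, 'e) pre_digraph \<Rightarrow> 'v set" where
  "leaves G = {v \<in> verts G. in_degree G v + out_degree G v = 1}"

definition boundary :: "('v, 'e) pre_digraph \<Rightarrow> ('e \<Rightarrow> real) \<Rightarrow> 'c set \<Rightarrow>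
    (('v, 'e) gpoint \<Rightarrow> 'c) \<Rightarrow> 'c set" where
  "boundary G len X \<iota> = X - \<iota> ` (points G len - Vertex ` leaves G)"

definition weakly_connected :: "('v, 'e) pre_digraph \<Rightarrow> ('e \<Rightarrow> real) \<Rightarrow>
    'c::metric_space set \<Rightarrow> (('v, 'e) gpoint \<Rightarrow> 'c) \<Rightarrow> bool" where
  "weakly_connected G len X \<iota> \<longleftrightarrow>
     (\<forall>x\<in>X. \<forall>y\<in>X. x \<noteq> y \<longrightarrow>
       (\<exists>W U V. finite W \<and> W \<subseteq> \<iota> ` points G len \<and>
          openin (top_of_set X) U \<and> openin (top_of_set X) V \<and> disjnt U V \<and>
          x \<in> U \<and> y \<in> V \<and> X - W = U \<union> V))"


section \<open>Harmonic functions and test functions\<close>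

definition edge_fun :: "('v, 'e) pre_digraph \<Rightarrow> ('e \<Rightarrow> real) \<Rightarrow> (('v, 'e) gpoint \<Rightarrow> 'c) \<Rightarrow>
    ('c \<Rightarrow> real) \<Rightarrow> 'e \<Rightarrow> real \<Rightarrow> real" where
  "edge_fun G len \<iota> f e t = f (\<iota> (edge_pt G len e t))"

text \<open>
  The sum of \<open>\<partial>\<^sub>\<nu> f\<^sub>e(v)\<close> over the edge ends at \<open>v\<close>: the sign changes at a tail, where the
  identification of the edge has to be reversed for \<open>v\<close> to become the right end point.
\<close>

definition outward_flux :: "('v, 'e) pre_digraph \<Rightarrow> ('e \<Rightarrow> real) \<Rightarrow> (('v, 'e) gpoint \<Rightarrow> 'c) \<Rightarrow>
    ('c \<Rightarrow> real) \<Rightarrow> 'v \<Rightarrow> real" where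
  "outward_flux G len \<iota> f v =
     (\<Sum>e\<in>in_arcs G v.
        vector_derivative (edge_fun G len \<iota> f e) (at (len e) within {0..len e})) +
     (\<Sum>e\<in>out_arcs G v.
        - vector_derivative (edge_fun G len \<iota> f e) (at 0 within {0..len e}))"

definition harmonic_at :: "('v, 'e) pre_digraph \<Rightarrow> ('e \<Rightarrow> real) \<Rightarrow> (('v, 'e) gpoint \<Rightarrow> 'c) \<Rightarrow>
    'v set \<Rightarrow> ('c \<Rightarrow> real) \<Rightarrow> bool" where
  "harmonic_at G len \<iota> W f \<longleftrightarrow>
     (\<forall>e\<in>arcs G. \<exists>a b. \<forall>t\<in>{0..len e}. edge_fun G len \<iota> f e t = a + b * t) \<and>
     (\<forall>v\<in>W. outward_flux G len \<iota> f v = 0)"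

definition harmonic_extension :: "('v, 'e) pre_digraph \<Rightarrow> ('e \<Rightarrow> real) \<Rightarrow>
    'c::metric_space set \<Rightarrow> (('v, 'e) gpoint \<Rightarrow> 'c) \<Rightarrow> ('c \<Rightarrow> real) \<Rightarrow> ('c \<Rightarrow> real) \<Rightarrow> bool" where
  "harmonic_extension G len X \<iota> F f \<longleftrightarrow>
     continuous_on X f \<and> (\<forall>x\<in>boundary G len X \<iota>. f x = F x) \<and>
     harmonic_at G len \<iota> (verts G - leaves G) f"

text \<open>The algebra \<open>\<A>\<close>; derivatives are taken at interior points of edges.\<close>

definition test_algebra :: "('v, 'e) pre_digraph \<Rightarrow> ('e \<Rightarrow> real) \<Rightarrow>
    'c::metric_space set \<Rightarrow> (('v, 'e) gpoint \<Rightarrow> 'c) \<Rightarrow> ('c \<Rightarrow> real) set" where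
  "test_algebra G len X \<iota> = {\<phi>.
     continuous_on X \<phi> \<and>
     (\<forall>e\<in>arcs G. \<forall>t\<in>{0<..<len e}. \<forall>k.
        (deriv ^^ k) (edge_fun G len \<iota> \<phi> e) field_differentiable (at t)) \<and>
     (\<exists>S. finite S \<and> S \<subseteq> arcs G \<and>
        (\<forall>e\<in>arcs G - S. \<forall>t\<in>{0<..<len e}. deriv (edge_fun G len \<iota> \<phi> e) t = 0)) \<and>
     (\<forall>v\<in>verts G. \<exists>U. openin (top_of_set X) U \<and> \<iota> (Vertex v) \<in> U \<and>
        (\<forall>e\<in>arcs G. \<forall>t\<in>{0<..<len e}.
           \<iota> (Inner e t) \<in> U \<longrightarrow> deriv (edge_fun G len \<iota> \<phi> e) t = 0))}"

definition graph_integral ::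
  "('v, 'e) pre_digraph \<Rightarrow> ('e \<Rightarrow> real) \<Rightarrow> ('e \<Rightarrow> real \<Rightarrow> real) \<Rightarrow> real" where
  "graph_integral G len h = (\<Sum>\<^sub>\<infinity>e\<in>arcs G. integral {0..len e} (h e))"


section \<open>Compressed Dirichlet to Neumann maps\<close>

text \<open>
  The members \<open>E n\<close> of the partition are indexed by a finite type \<open>'n\<close> with \<open>N\<close> elements, so
  \<open>F\<close> in the span of their characteristic functions is given by its coordinates
  \<open>F $ n = F(E(n))\<close>; \<open>step_fun E F\<close> is the corresponding function on the boundary.
\<close>

definition step_fun :: "('n::finite \<Rightarrow> 'c set) \<Rightarrow> real ^ 'n \<Rightarrow> 'c \<Rightarrow> real" where
  "step_fun E F x = (\<Sum>n\<in>UNIV. F $ n * indicator (E n) x)"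

definition inner_E :: "'c measure \<Rightarrow> ('n::finite \<Rightarrow> 'c set) \<Rightarrow> real ^ 'n \<Rightarrow> real ^ 'n \<Rightarrow> real" where
  "inner_E \<mu> E F H =
     1 / measure \<mu> (space \<mu>) * (\<Sum>n\<in>UNIV. F $ n * H $ n * measure \<mu> (E n))"

definition cutoff :: "('v, 'e) pre_digraph \<Rightarrow> ('e \<Rightarrow> real) \<Rightarrow> 'c::metric_space set \<Rightarrow>
    (('v, 'e) gpoint \<Rightarrow> 'c) \<Rightarrow> 'c set \<Rightarrow> ('c \<Rightarrow> real) \<Rightarrow> bool" where
  "cutoff G len X \<iota> A \<phi> \<longleftrightarrow>
     \<phi> \<in> test_algebra G len X \<iota> \<and> (\<forall>x\<in>A. \<phi> x = 1) \<and> (\<forall>x\<in>boundary G len X \<iota> - A. \<phi> x = 0)"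

text \<open>
  The value does not depend on the cutoff function chosen; the harmonic extension is unique up to
  its irrelevant values outside \<open>X\<close>.
\<close>

definition dn_map :: "('v, 'e) pre_digraph \<Rightarrow> ('e \<Rightarrow> real) \<Rightarrow> 'c::metric_space set \<Rightarrow>
    (('v, 'e) gpoint \<Rightarrow> 'c) \<Rightarrow> 'c measure \<Rightarrow> ('n::finite \<Rightarrow> 'c set) \<Rightarrow> real ^ 'n \<Rightarrow> real ^ 'n" where
  "dn_map G len X \<iota> \<mu> E F =
     (let f = (SOME f. harmonic_extension G len X \<iota> (step_fun E F) f)
      in \<chi> n. let \<phi> = (SOME \<phi>. cutoff G len X \<iota> (E n) \<phi>)
              in - inverse (measure \<mu> (E n)) *
                 graph_integral G len
                   (\<lambda>e t. edge_fun G len \<iota> f e t * (deriv ^^ 2) (edge_fun G len \<iota> \<phi> e) t))"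


section \<open>The approximating maps\<close>

definition eps_graph :: "('v, 'e) pre_digraph \<Rightarrow> ('e \<Rightarrow> real) \<Rightarrow> 'c::metric_space set \<Rightarrow>
    (('v, 'e) gpoint \<Rightarrow> 'c) \<Rightarrow> real \<Rightarrow> ('v, 'e) pre_digraph" where
  "eps_graph G len X \<iota> \<epsilon> =
     (let A = {e \<in> arcs G. \<exists>t\<in>{0..len e}.
                 \<epsilon> \<le> infdist (\<iota> (edge_pt G len e t)) (boundary G len X \<iota>)}
      in \<lparr>verts = tail G ` A \<union> head G ` A, arcs = A, tail = tail G, head = head G\<rparr>)"

definition eps_boundary :: "('v, 'e) pre_digraph \<Rightarrow> ('e \<Rightarrow> real) \<Rightarrow> 'c::metric_space set \<Rightarrow>
    (('v, 'e) gpoint \<Rightarrow> 'c) \<Rightarrow> real \<Rightarrow> 'v set" where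
  "eps_boundary G len X \<iota> \<epsilon> =
     {v \<in> verts (eps_graph G len X \<iota> \<epsilon>).
        v \<in> leaves G \<or> \<not> in_arcs G v \<union> out_arcs G v \<subseteq> arcs (eps_graph G len X \<iota> \<epsilon>)}"

text \<open>For \<open>A = E n\<close> this is the set of vertices \<open>v\<close> of the boundary of the subgraph lying in the
  \<open>\<epsilon>\<close>-neighbourhood of \<open>E n\<close>.\<close>

definition eps_cell :: "('v, 'e) pre_digraph \<Rightarrow> ('e \<Rightarrow> real) \<Rightarrow> 'c::metric_space set \<Rightarrow>
    (('v, 'e) gpoint \<Rightarrow> 'c) \<Rightarrow> real \<Rightarrow> 'c set \<Rightarrow> 'v set" where
  "eps_cell G len X \<iota> \<epsilon> A =
     {v \<in> eps_boundary G len X \<iota> \<epsilon>. \<exists>y\<in>A. dist (\<iota> (Vertex v)) y < \<epsilon>}"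

definition eps_harmonic_extension :: "('v, 'e) pre_digraph \<Rightarrow> ('e \<Rightarrow> real) \<Rightarrow>
    'c::metric_space set \<Rightarrow> (('v, 'e) gpoint \<Rightarrow> 'c) \<Rightarrow> ('n::finite \<Rightarrow> 'c set) \<Rightarrow> real \<Rightarrow>
    real ^ 'n \<Rightarrow> ('c \<Rightarrow> real) \<Rightarrow> bool" where
  "eps_harmonic_extension G len X \<iota> E \<epsilon> F f \<longleftrightarrow>
     continuous_on (\<iota> ` points (eps_graph G len X \<iota> \<epsilon>) len) f \<and>
     (\<forall>n. \<forall>v\<in>eps_cell G len X \<iota> \<epsilon> (E n). f (\<iota> (Vertex v)) = F $ n) \<and>
     harmonic_at (eps_graph G len X \<iota> \<epsilon>) len \<iota>
       (verts (eps_graph G len X \<iota> \<epsilon>) - eps_boundary G len X \<iota> \<epsilon>) f"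

text \<open>
  Only meaningful for small \<open>\<epsilon>\<close>, when the sets \<open>eps_cell G len X \<iota> \<epsilon> (E n)\<close> partition
  \<open>eps_boundary G len X \<iota> \<epsilon>\<close>; the function chosen is then unique on the subgraph.
\<close>

definition eps_dn_map :: "('v, 'e) pre_digraph \<Rightarrow> ('e \<Rightarrow> real) \<Rightarrow> 'c::metric_space set \<Rightarrow>
    (('v, 'e) gpoint \<Rightarrow> 'c) \<Rightarrow> 'c measure \<Rightarrow> ('n::finite \<Rightarrow> 'c set) \<Rightarrow> real \<Rightarrow>
    real ^ 'n \<Rightarrow> real ^ 'n" where
  "eps_dn_map G len X \<iota> \<mu> E \<epsilon> F =
     (let f = (SOME f. eps_harmonic_extension G len X \<iota> E \<epsilon> F f)
      in \<chi> n. inverse (measure \<mu> (E n)) *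
           (\<Sum>v\<in>eps_cell G len X \<iota> \<epsilon> (E n).
              outward_flux (eps_graph G len X \<iota> \<epsilon>) len \<iota> f v))"

end

theory Submission
  imports Defs "HOL-Computational_Algebra.Polynomial"
begin

text \<open>
  Functions on the vertices carry the Dirichlet form
  \<open>\<Sum>\<^sub>e (\<Delta>\<^sub>e f) (\<Delta>\<^sub>e g) / l\<^sub>e\<close>. By Cauchy-Schwarz along a short set of edges linking two
  vertices, a function of small energy that vanishes at some vertex is uniformly small.
  Hence a sequence minimising the energy among the finite perturbations of given boundary data
  converges uniformly, which yields harmonic extensions on the whole graph and on the subgraphs alike.
  Integrating by parts, \<open>\<mu>(E(n)) \<Lambda>F(E(n))\<close> is the Dirichlet form of the harmonic extension and a
  cutoff function; since the cutoff function may be replaced by the indicator of the vertices close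
  to \<open>E(n)\<close>, whose differences vanish off a fixed finite set of edges, so is
  \<open>\<mu>(E(n)) \<Lambda>\<^sub>\<epsilon>F(E(n))\<close>, with the same indicator. Convergence follows since the harmonic
  extensions on the subgraphs converge at each vertex, by the maximum principle and the uniform
  continuity of the limit. On the subgraphs, symmetry and positivity are Green's identity.
\<close>

section \<open>Smooth step functions\<close>

text \<open>A harmonic extension may have nonzero differences along infinitely many edges, so its
  own energy is never formed: it is only paired with functions whose differences vanish off a finite
  set of edges, and every pairing is a finite sum. Boundary data that are constant near each E(n)
  belong to this class, finite perturbations of them stay in it, and their interpolations extend
  continuously to the completion; uniform limits keep that continuity, and with it the boundary
  values. One radius \<open>r0\<close>, half of a lower bound for the distances between the E(n),
  serves throughout. An edge all of whose points are closer than \<open>r0\<close> to the boundary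
  is connected, so it cannot pass from the neighbourhood of one E(n) to that of another. The
  indicators are therefore independent of \<epsilon>, and convergence only concerns the ends of the
  finitely many remaining edges. Extensions and cutoff functions enter the definitions through
  choice operators, so nothing can be said about the maps before existence is proved; what the
  chosen functions are is then settled by expressing each map as a form.\<close>

definition bump :: "real \<Rightarrow> real \<Rightarrow> real poly \<Rightarrow> nat \<Rightarrow> real \<Rightarrow> real" where
  "bump a b p m t =
     (if a < t \<and> t < b
      then poly p t / ((t - a) * (b - t)) ^ m * exp (- 1 / ((t - a) * (b - t))) else 0)"

lemma power_le_fact_times_exp:
  assumes "0 \<le> (x :: real)"
  shows "x ^ n \<le> fact n * exp x"
proof -
  have "x ^ n /\<^sub>R fact n \<le> (\<Sum>k<Suc n. x ^ k /\<^sub>R fact k)"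
    using assms by (simp add: sum_nonneg)
  also have "\<dots> \<le> exp x"
    unfolding exp_def using assms by (intro sum_le_suminf summable_exp_generic) auto
  finally show ?thesis by (simp add: field_simps)
qed

text \<open>With \<open>q = (t - a) * (b - t)\<close>, the inequality
  \<open>x ^ (m + 2) \<le> fact (m + 2) * exp x\<close> at \<open>x = 1 / q\<close> bounds
  \<open>exp (- 1 / q)\<close> by a multiple of \<open>q ^ (m + 2)\<close>. The power
  \<open>m\<close> cancels the denominator; the remaining square gives derivative 0 at
  \<open>a\<close> and \<open>b\<close>.\<close>

lemma bump_quadratic_bound:
  assumes "a < b"
  obtains C where "\<And>t. \<bar>bump a b p m t\<bar> \<le> C * (t - a)\<^sup>2" "\<And>t. \<bar>bump a b p m t\<bar> \<le> C * (t - b)\<^sup>2"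
proof -
  have "compact (poly p ` {a..b})"
    by (intro compact_continuous_image continuous_intros compact_Icc)
  then obtain K where K: "\<And>t. t \<in> {a..b} \<Longrightarrow> \<bar>poly p t\<bar> \<le> K"
    using compact_imp_bounded by (force simp: bounded_iff)
  have K0: "0 \<le> K" using K[of a] assms by auto
  define C where "C = K * fact (m + 2) * (b - a)\<^sup>2"
  have C0: "0 \<le> C" using K0 by (simp add: C_def)
  have main: "\<bar>bump a b p m t\<bar> \<le> K * fact (m + 2) * ((t - a) * (b - t))\<^sup>2" if t: "a < t" "t < b" for t
  proof -
    define q where "q = (t - a) * (b - t)"
    have q: "0 < q" using t by (simp add: q_def)
    have "(1 / q) ^ (m + 2) \<le> fact (m + 2) * exp (1 / q)"
      using q by (intro power_le_fact_times_exp) simp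
    then have "exp (- 1 / q) \<le> fact (m + 2) * q ^ (m + 2)"
      using q by (simp add: exp_minus field_simps)
    then have "\<bar>poly p t\<bar> / q ^ m * exp (- 1 / q) \<le> K / q ^ m * (fact (m + 2) * q ^ (m + 2))"
      using K[of t] t q K0 by (intro mult_mono divide_right_mono) auto
    also have "\<dots> = K * fact (m + 2) * q\<^sup>2" using q by (simp add: power_add field_simps power2_eq_square)
    finally show ?thesis using t q by (simp add: bump_def q_def[symmetric] abs_mult)
  qed
  have "\<bar>bump a b p m t\<bar> \<le> C * (t - a)\<^sup>2" for t
  proof (cases "a < t \<and> t < b")
    case True
    have "((t - a) * (b - t))\<^sup>2 \<le> ((t - a) * (b - a))\<^sup>2"
      using True by (intro power_mono mult_left_mono) auto
    then have "K * fact (m + 2) * ((t - a) * (b - t))\<^sup>2 \<le> C * (t - a)\<^sup>2"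
      unfolding C_def using mult_left_mono[of _ _ "K * fact (m + 2)"] K0
      by (fastforce simp: power_mult_distrib mult_ac)
    with main[of t] True show ?thesis by linarith
  qed (use C0 in \<open>auto simp: bump_def\<close>)
  moreover have "\<bar>bump a b p m t\<bar> \<le> C * (t - b)\<^sup>2" for t
  proof (cases "a < t \<and> t < b")
    case True
    have "((t - a) * (b - t))\<^sup>2 \<le> ((b - a) * (b - t))\<^sup>2"
      using True by (intro power_mono mult_right_mono) auto
    then have "K * fact (m + 2) * ((t - a) * (b - t))\<^sup>2 \<le> C * (t - b)\<^sup>2"
      unfolding C_def using mult_left_mono[of _ _ "K * fact (m + 2)"] K0
      by (fastforce simp: power_mult_distrib mult_ac power2_commute[of t b])
    with main[of t] True show ?thesis by linarith
  qed (use C0 in \<open>auto simp: bump_def\<close>)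
  ultimately show thesis using that by blast
qed

lemma has_derivative_zero_quadratic:
  fixes f :: "real \<Rightarrow> real"
  assumes "\<And>t. \<bar>f t\<bar> \<le> C * (t - a)\<^sup>2"
  shows "(f has_real_derivative 0) (at a)"
proof -
  have f0: "f a = 0" using assms[of a] by simp
  have "\<forall>\<^sub>F h in at 0. norm ((f (a + h) - f a) / h) \<le> C * \<bar>h\<bar>"
  proof (rule eventually_at_filter[THEN iffD2, OF always_eventually], intro allI impI)
    fix h :: real assume "h \<noteq> 0"
    then show "norm ((f (a + h) - f a) / h) \<le> C * \<bar>h\<bar>"
      using assms[of "a + h"] f0 by (simp add: field_simps power2_eq_square abs_mult flip: power2_abs)
  qed
  moreover have "((\<lambda>h :: real. C * \<bar>h\<bar>) \<longlongrightarrow> 0) (at 0)"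
    by (rule tendsto_eq_intros | simp)+
  ultimately have "((\<lambda>h. (f (a + h) - f a) / h) \<longlongrightarrow> 0) (at 0)"
    by (rule Lim_null_comparison)
  then show ?thesis by (simp add: DERIV_def)
qed

text \<open>The polynomial and the exponent are parameters of \<open>bump\<close> precisely so that
  the family is closed under differentiation; smoothness is then an induction on the order of the
  derivative.\<close>

lemma bump_derivative:
  assumes "a < b"
  shows "\<exists>p' m'. \<forall>t. (bump a b p m has_real_derivative bump a b p' m' t) (at t)"
proof -
  define q where "q = [:- a * b, a + b, - 1:]"
  have q: "poly q t = (t - a) * (b - t)" for t by (simp add: q_def algebra_simps)
  \<comment> \<open>The numerator of the derivative of \<open>p / q ^ m * exp (- 1 / q)\<close> over
    the common denominator \<open>q ^ (m + 2)\<close>.\<close>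
  define p' where "p' = pderiv p * q\<^sup>2 - smult (of_nat m) (p * pderiv q * q) + p * pderiv q"
  have "(bump a b p m has_real_derivative bump a b p' (m + 2) t) (at t)" for t
  proof -
    consider "a < t \<and> t < b" | "t < a \<or> b < t" | "t = a" | "t = b" by linarith
    then show ?thesis
    proof cases
      case 1
      define Q where "Q = poly q t"
      have q0: "Q \<noteq> 0" using 1 by (simp add: q Q_def)
      have "((\<lambda>t. poly p t / poly q t ^ m * exp (- 1 / poly q t)) has_real_derivative
          poly p' t / poly q t ^ (m + 2) * exp (- 1 / poly q t)) (at t)"
        by (rule derivative_eq_intros poly_DERIV refl | (use q0 in \<open>simp add: Q_def\<close>; fail))+
          (use q0 in \<open>cases m; simp add: p'_def Q_def[symmetric] field_simps power2_eq_square power_add\<close>)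
      moreover have "\<forall>\<^sub>F x in nhds t. poly p x / poly q x ^ m * exp (- 1 / poly q x) = bump a b p m x"
        using eventually_nhds_in_open[of "{a<..<b}" t] 1
        by (auto simp: bump_def q elim!: eventually_mono)
      ultimately show ?thesis
        using 1 by (subst DERIV_cong_ev[symmetric, OF refl _ refl]) (auto simp: bump_def q)
    next
      case 2
      have "\<forall>\<^sub>F x in nhds t. 0 = bump a b p m x"
        using 2 by (intro eventually_mono[OF eventually_nhds_in_open[of "{..<a} \<union> {b<..}" t]])
          (auto simp: bump_def)
      then have "(bump a b p m has_real_derivative 0) (at t)"
        using DERIV_cong_ev[of t t "\<lambda>_. 0" "bump a b p m" 0 0] by auto
      then show ?thesis using 2 by (auto simp: bump_def)
    next
      case 3
      then show ?thesis using bump_quadratic_bound[OF assms, of p m]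
        by (metis bump_def has_derivative_zero_quadratic less_irrefl)
    next
      case 4
      then show ?thesis using bump_quadratic_bound[OF assms, of p m]
        by (metis bump_def has_derivative_zero_quadratic less_irrefl)
    qed
  qed
  then show ?thesis by blast
qed

lemma deriv_bump:
  assumes "a < b"
  shows "\<exists>p' m'. deriv (bump a b p m) = bump a b p' m'"
  using bump_derivative[OF assms, of p m] by (metis DERIV_imp_deriv ext)

lemma bump_smooth:
  assumes "a < b"
  shows "(deriv ^^ k) (bump a b p m) field_differentiable at t"
proof -
  have "\<exists>p' m'. (deriv ^^ k) (bump a b p m) = bump a b p' m'"
  proof (induction k)
    case (Suc k)
    then obtain p' m' where "(deriv ^^ k) (bump a b p m) = bump a b p' m'" by blast
    with deriv_bump[OF assms, of p' m'] show ?case by auto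
  qed auto
  then show ?thesis
    using bump_derivative[OF assms] unfolding field_differentiable_def by metis
qed

text \<open>A normalised integral of a bump supported in the middle third. The two outer thirds are
  left flat because test functions have to be locally constant near the vertices.\<close>

lemma smooth_step:
  assumes "0 < (l :: real)"
  obtains s where "\<And>t. t \<le> l / 3 \<Longrightarrow> s t = 0" "\<And>t. 2 * l / 3 \<le> t \<Longrightarrow> s t = 1"
    "\<And>k t. (deriv ^^ k) s field_differentiable at t"
proof -
  define a b where "a = l / 3" and "b = 2 * l / 3"
  have ab: "a < b" "0 < a" using assms by (auto simp: a_def b_def)
  define B where "B = bump a b 1 0"
  have B0: "B t \<ge> 0" for t by (simp add: B_def bump_def)
  have Bz: "B t = 0" if "t \<le> a \<or> b \<le> t" for t using that by (auto simp: B_def bump_def)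
  have "B differentiable_on UNIV" using bump_derivative[OF ab(1), of 1 0]
    unfolding B_def differentiable_on_def real_differentiable_def
    by (metis has_field_derivative_at_within)
  then have contB: "continuous_on A B" for A
    using differentiable_imp_continuous_on continuous_on_subset by blast
  \<comment> \<open>Integration starts at \<open>a - 1\<close>, to the left of the support, so that
    the fundamental theorem gives a two-sided derivative at \<open>a\<close> as well; further left
    \<open>S\<close> is locally zero.\<close>
  define S where "S t = integral {a - 1..t} B" for t
  have S0: "S t = 0" if "t \<le> a" for t
    unfolding S_def using that Bz by (intro integral_unique has_integral_is_0) auto
  have dS: "(S has_real_derivative B t) (at t)" for t
  proof (cases "t > a - 1")
    case True
    have "((\<lambda>u. integral {a - 1..u} B) has_real_derivative B t) (at t within {a - 1..t + 1})"
      by (rule integral_has_real_derivative[OF contB]) (use True in auto)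
    moreover have "at t within {a - 1..t + 1} = at t"
      using True by (intro at_within_interior) auto
    ultimately show ?thesis by (simp add: S_def[abs_def])
  next
    case False
    then have "\<forall>\<^sub>F x in nhds t. 0 = S x"
      using S0 by (intro eventually_mono[OF eventually_nhds_in_open[of "{..<a}" t]]) auto
    then have "(S has_real_derivative 0) (at t)"
      using DERIV_cong_ev[of t t "\<lambda>_. 0" S 0 0] by auto
    then show ?thesis using Bz[of t] False by auto
  qed
  have Sb: "S t = S b" if "b \<le> t" for t
  proof (rule DERIV_isconst2[of b "t + 1" S])
    show "continuous_on {b..t + 1} S"
      by (meson DERIV_continuous_on dS has_field_derivative_at_within)
    show "(S has_real_derivative 0) (at x)" if "b < x" "x < t + 1" for x
      using dS[of x] Bz[of x] that by simp
  qed (use that in auto)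
  have "S a < S b"
  proof (rule DERIV_pos_imp_increasing_open[OF ab(1)])
    show "\<exists>y. (S has_real_derivative y) (at x) \<and> 0 < y" if "a < x" "x < b" for x
      using dS[of x] that by (intro exI[of _ "B x"]) (auto simp: B_def bump_def)
    show "continuous_on {a..b} S"
      by (meson DERIV_continuous_on dS has_field_derivative_at_within)
  qed
  then have Sb0: "S b > 0" using S0[of a] by simp
  define s where "s t = S t / S b" for t
  have ds: "deriv s = bump a b [:1 / S b:] 0"
  proof
    fix t
    have "(s has_real_derivative B t / S b) (at t)"
      unfolding s_def by (intro DERIV_cdivide dS)
    then show "deriv s t = bump a b [:1 / S b:] 0 t"
      by (simp add: DERIV_imp_deriv B_def bump_def)
  qed
  have "(deriv ^^ k) s field_differentiable at t" for k t
  proof (cases k)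
    case 0
    then show ?thesis unfolding field_differentiable_def s_def
      using DERIV_cdivide[OF dS] by auto
  next
    case (Suc j)
    then show ?thesis using bump_smooth[OF ab(1)] by (simp add: funpow_swap1 ds)
  qed
  moreover have "s t = 0" if "t \<le> l / 3" for t using S0 that by (simp add: s_def a_def)
  moreover have "s t = 1" if "2 * l / 3 \<le> t" for t
    using Sb[of t] Sb0 that by (simp add: s_def b_def)
  ultimately show thesis using that by blast
qed

section \<open>Distances on a metric graph\<close>

context metric_graph
begin

abbreviation "ep \<equiv> edge_pt G len"

lemma edge_pt_0 [simp]: "ep e 0 = Vertex (tail G e)"
  by (simp add: edge_pt_def)

lemma edge_pt_len [simp]: "e \<in> arcs G \<Longrightarrow> ep e (len e) = Vertex (head G e)"
  using len_pos[of e] by (simp add: edge_pt_def)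

lemma edge_pt_Inner: "0 < t \<Longrightarrow> t < len e \<Longrightarrow> ep e t = Inner e t"
  by (simp add: edge_pt_def)

lemma edge_pt_in_points: "e \<in> arcs G \<Longrightarrow> ep e t \<in> points G len"
  by (auto simp: edge_pt_def points_def)

lemma points_cases:
  assumes "x \<in> points G len"
  obtains (Vertex) v where "v \<in> verts G" "x = Vertex v"
  | (Inner) e t where "e \<in> arcs G" "0 < t" "t < len e" "x = Inner e t" "x = ep e t"
  using assms by (auto simp: points_def edge_pt_def)

text \<open>\<open>(v, w) \<in> (link T)\<^sup>*\<close> expresses that the edges in
  \<open>T\<close>, in either direction, connect \<open>v\<close> to \<open>w\<close>. Sets of edges
  replace lists here because lengths and energies must count each edge once.\<close>

definition link :: "'e set \<Rightarrow> ('v \<times> 'v) set" where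
  "link T = (\<lambda>e. (tail G e, head G e)) ` T \<union> (\<lambda>e. (head G e, tail G e)) ` T"

lemma link_insert:
  "link (insert e T) = insert (tail G e, head G e) (insert (head G e, tail G e) (link T))"
  by (auto simp: link_def)

lemma link_arcs_connected:
  assumes "v \<in> verts G" "w \<in> verts G"
  shows "(v, w) \<in> (link (arcs G))\<^sup>*"
proof -
  have "(v, w) \<in> ((arcs_ends G)\<^sup>s)\<^sup>*"
    using graph_connected assms by (auto simp: connected_conv dest: rtrancl_on_rtranclI)
  moreover have "(arcs_ends G)\<^sup>s = link (arcs G)"
    by (auto simp: arcs_ends_def arc_to_ends_def link_def symcl_def)
  ultimately show ?thesis by simp
qed

lemma joins_append: "joins G len x p y \<Longrightarrow> joins G len y q z \<Longrightarrow> joins G len x (p @ q) z"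
  by (induction p arbitrary: x) auto

lemma joins_segment:
  "e \<in> arcs G \<Longrightarrow> s \<in> {0..len e} \<Longrightarrow> t \<in> {0..len e} \<Longrightarrow> joins G len (ep e s) [(e, s, t)] (ep e t)"
  by simp

lemma joins_vertices:
  assumes "v \<in> verts G" "w \<in> verts G"
  shows "\<exists>p. joins G len (Vertex v) p (Vertex w)"
  using link_arcs_connected[OF assms]
proof (induction rule: rtrancl_induct)
  case base
  show ?case using joins.simps(1) by blast
next
  case (step y z)
  then obtain e where e: "e \<in> arcs G"
    and yz: "y = tail G e \<and> z = head G e \<or> y = head G e \<and> z = tail G e"
    by (auto simp: link_def)
  have l: "0 \<in> {0..len e}" "len e \<in> {0..len e}" using len_pos[OF e] by auto
  have "\<exists>q. joins G len (Vertex y) q (Vertex z)"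
    using yz joins_segment[OF e l] joins_segment[OF e l(2,1)] e by (metis edge_pt_0 edge_pt_len)
  with step.IH show ?case using joins_append by blast
qed

text \<open>Makes the set of lengths in \<open>gdist\<close> nonempty, so that a lower bound for all
  paths is a lower bound for its infimum.\<close>

lemma joins_exists:
  assumes "x \<in> points G len" "y \<in> points G len"
  shows "\<exists>p. joins G len x p y"
proof -
  have "\<exists>v\<in>verts G. \<exists>p q. joins G len x p (Vertex v) \<and> joins G len (Vertex v) q x"
    if "x \<in> points G len" for x
    using that
  proof (cases rule: points_cases)
    case (Vertex v)
    then show ?thesis using joins.simps(1) by blast
  next
    case (Inner e t)
    then have "joins G len x [(e, t, 0)] (Vertex (tail G e))" "joins G len (Vertex (tail G e)) [(e, 0, t)] x"
      using joins_segment[of e t 0] joins_segment[of e 0 t] by auto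
    then show ?thesis using Inner tail_in_verts by blast
  qed
  then obtain v w p q where "v \<in> verts G" "w \<in> verts G"
    "joins G len x p (Vertex v)" "joins G len (Vertex w) q y" using assms by metis
  then show ?thesis using joins_vertices joins_append by metis
qed

lemma path_len_nonneg: "0 \<le> path_len p"
  unfolding path_len_def by (intro sum_list_nonneg) auto

lemma gdist_le_path_len: "joins G len x p y \<Longrightarrow> gdist G len x y \<le> path_len p"
  unfolding gdist_def by (intro cInf_lower) (auto intro!: bdd_belowI[of _ 0] path_len_nonneg)

lemma gdist_edge_le:
  "e \<in> arcs G \<Longrightarrow> s \<in> {0..len e} \<Longrightarrow> t \<in> {0..len e} \<Longrightarrow> gdist G len (ep e s) (ep e t) \<le> \<bar>t - s\<bar>"
  using gdist_le_path_len[OF joins_segment] by (simp add: path_len_def)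

text \<open>All lower bounds on distances below come from functions that are 1-Lipschitz along edges.\<close>

definition edge_lipschitz :: "(('v, 'e) gpoint \<Rightarrow> real) \<Rightarrow> bool" where
  "edge_lipschitz h \<longleftrightarrow>
     (\<forall>e\<in>arcs G. \<forall>s\<in>{0..len e}. \<forall>t\<in>{0..len e}. \<bar>h (ep e s) - h (ep e t)\<bar> \<le> \<bar>s - t\<bar>)"

lemma edge_lipschitz_path:
  assumes "edge_lipschitz h"
  shows "joins G len x p y \<Longrightarrow> \<bar>h x - h y\<bar> \<le> path_len p"
proof (induction p arbitrary: x)
  case (Cons a p)
  obtain e s t where a: "a = (e, s, t)" by (cases a)
  with Cons.prems have *: "e \<in> arcs G" "s \<in> {0..len e}" "t \<in> {0..len e}" "x = ep e s"
    "joins G len (ep e t) p y" by auto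
  have "\<bar>h (ep e t) - h y\<bar> \<le> path_len p" using Cons.IH * by blast
  moreover have "\<bar>h x - h (ep e t)\<bar> \<le> \<bar>s - t\<bar>"
    using assms * by (auto simp: edge_lipschitz_def)
  ultimately show ?case by (simp add: a path_len_def)
qed (simp add: path_len_def)

lemma edge_lipschitz_le_gdist:
  assumes "edge_lipschitz h" "x \<in> points G len" "y \<in> points G len"
  shows "\<bar>h x - h y\<bar> \<le> gdist G len x y"
  unfolding gdist_def
  using joins_exists[OF assms(2,3)] edge_lipschitz_path[OF assms(1)]
  by (intro cInf_greatest) auto

text \<open>The distance to \<open>Inner e s\<close> along \<open>e\<close>, truncated at
  \<open>r\<close>. If \<open>r\<close> is at most the distance from \<open>s\<close> to either end
  of \<open>e\<close>, the truncation is reached at both ends, so the constant \<open>r\<close>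
  continues it to the rest of the graph.\<close>

definition inner_gauge :: "'e \<Rightarrow> real \<Rightarrow> real \<Rightarrow> ('v, 'e) gpoint \<Rightarrow> real" where
  "inner_gauge e s r x = (case x of Vertex v \<Rightarrow> r | Inner e' t \<Rightarrow> if e' = e then min r \<bar>t - s\<bar> else r)"

lemma inner_gauge_lipschitz:
  assumes "e \<in> arcs G" "0 < r" "r \<le> s" "r \<le> len e - s"
  shows "edge_lipschitz (inner_gauge e s r)"
proof -
  have *: "inner_gauge e s r (ep e' t) = (if e' = e then min r \<bar>t - s\<bar> else r)"
    if "e' \<in> arcs G" "t \<in> {0..len e'}" for e' t
    using that assms by (auto simp: inner_gauge_def edge_pt_def)
  show ?thesis unfolding edge_lipschitz_def by (auto simp: * min_def)
qed

lemma gdist_Inner_less: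
  assumes "e \<in> arcs G" "0 < r" "r \<le> s" "r \<le> len e - s" "y \<in> points G len"
    "gdist G len (Inner e s) y < r"
  obtains t where "y = Inner e t" "\<bar>t - s\<bar> < r"
proof -
  have "Inner e s \<in> points G len" using assms by (auto simp: points_def)
  then have "\<bar>inner_gauge e s r (Inner e s) - inner_gauge e s r y\<bar> < r"
    using edge_lipschitz_le_gdist[OF inner_gauge_lipschitz[OF assms(1-4)], of "Inner e s" y] assms
    by linarith
  then show thesis using that assms by (auto simp: inner_gauge_def split: gpoint.splits if_splits)
qed

text \<open>The distance to \<open>v\<close> along its incident edges, truncated at
  \<open>r\<close>. On a loop both minima are active and the nearer end counts; on the other edges
  the value is \<open>r\<close>.\<close>

definition star_gauge :: "'v \<Rightarrow> real \<Rightarrow> ('v, 'e) gpoint \<Rightarrow> real" where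
  "star_gauge v r x = (case x of Vertex w \<Rightarrow> if w = v then 0 else r
     | Inner e t \<Rightarrow> min r (min (if tail G e = v then t else r) (if head G e = v then len e - t else r)))"

lemma star_gauge_lipschitz:
  assumes "0 < r" "\<And>e. e \<in> in_arcs G v \<union> out_arcs G v \<Longrightarrow> r \<le> len e"
  shows "edge_lipschitz (star_gauge v r)"
proof -
  have *: "star_gauge v r (ep e t) =
      min r (min (if tail G e = v then t else r) (if head G e = v then len e - t else r))"
    if "e \<in> arcs G" "t \<in> {0..len e}" for e t
    using that assms(1) assms(2)[of e] len_pos[of e] by (auto simp: star_gauge_def edge_pt_def)
  show ?thesis unfolding edge_lipschitz_def by (auto simp: * min_def)
qed

lemma gdist_Vertex_less:
  assumes "v \<in> verts G" "0 < r" "\<And>e. e \<in> in_arcs G v \<union> out_arcs G v \<Longrightarrow> r \<le> len e"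
    "y \<in> points G len" "gdist G len (Vertex v) y < r"
  shows "y = Vertex v \<or>
    (\<exists>e t. y = Inner e t \<and> (tail G e = v \<and> t < r \<or> head G e = v \<and> len e - t < r))"
proof -
  have "Vertex v \<in> points G len" using assms by (auto simp: points_def)
  moreover have "edge_lipschitz (star_gauge v r)"
    using assms by (intro star_gauge_lipschitz) auto
  ultimately have "\<bar>star_gauge v r (Vertex v) - star_gauge v r y\<bar> < r"
    using edge_lipschitz_le_gdist[of "star_gauge v r" "Vertex v" y] assms by linarith
  then show ?thesis using assms by (auto simp: star_gauge_def split: gpoint.splits if_splits)
qed

text \<open>Local finiteness gives a positive lower bound for the lengths at \<open>v\<close>. The
  factor 3 keeps the ball of radius \<open>r\<close> around \<open>v\<close> inside the outer thirds
  of the incident edges, where smooth steps are constant.\<close>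

lemma star_radius:
  assumes "v \<in> verts G"
  obtains r where "0 < r" "\<And>e. e \<in> in_arcs G v \<union> out_arcs G v \<Longrightarrow> 3 * r \<le> len e"
proof -
  \<comment> \<open>The element 1 keeps the minimum meaningful when no edge meets
    \<open>v\<close>.\<close>
  define A where "A = insert 1 (len ` (in_arcs G v \<union> out_arcs G v))"
  have fin: "finite A" using locally_finite[OF assms] by (simp add: A_def)
  have "Min A > 0" using fin len_pos by (subst Min_gr_iff) (auto simp: A_def)
  moreover have "Min A \<le> len e" if "e \<in> in_arcs G v \<union> out_arcs G v" for e
    using fin that by (intro Min_le) (auto simp: A_def)
  ultimately show thesis using that[of "Min A / 3"] by auto
qed

text \<open>An infimum over infinitely many paths could be zero; a gauge centred at \<open>x\<close>
  vanishes there and is positive at every other point, which excludes this. Injectivity of the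
  embedding rests on it.\<close>

lemma gdist_pos:
  assumes "x \<in> points G len" "y \<in> points G len" "x \<noteq> y"
  shows "gdist G len x y > 0"
  using assms(1)
proof (cases rule: points_cases)
  case (Vertex v)
  obtain r where r: "0 < r" "\<And>e. e \<in> in_arcs G v \<union> out_arcs G v \<Longrightarrow> 3 * r \<le> len e"
    using star_radius[OF Vertex(1)] by blast
  have L: "edge_lipschitz (star_gauge v r)"
    by (rule star_gauge_lipschitz[OF r(1)]) (use r in force)
  have "star_gauge v r x = 0" by (simp add: Vertex star_gauge_def)
  moreover have "star_gauge v r y > 0"
    using assms(2,3) r(1) Vertex by (auto simp: star_gauge_def points_def split: if_splits)
  ultimately show ?thesis using edge_lipschitz_le_gdist[OF L assms(1,2)] by linarith
next
  case (Inner e t)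
  define r where "r = min t (len e - t)"
  have L: "edge_lipschitz (inner_gauge e t r)"
    using Inner by (intro inner_gauge_lipschitz) (auto simp: r_def)
  have "inner_gauge e t r x = 0" using Inner by (simp add: inner_gauge_def r_def)
  moreover have "inner_gauge e t r y > 0"
    using assms(2,3) Inner by (auto simp: inner_gauge_def r_def points_def split: if_splits)
  ultimately show ?thesis using edge_lipschitz_le_gdist[OF L assms(1,2)] by linarith
qed

text \<open>Each edge of \<open>T\<close> is counted only once, although no simple path is extracted: the part of \<open>T\<close>
  linked to \<open>v\<close> and the rest are treated by separate applications of the induction hypothesis.\<close>

lemma linked_sum_bound:
  fixes u :: "'v \<Rightarrow> real"
  assumes "finite T" "(v, w) \<in> (link T)\<^sup>*"
  shows "\<bar>u v - u w\<bar> \<le> (\<Sum>e\<in>T. \<bar>u (head G e) - u (tail G e)\<bar>)"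
  using assms
proof (induction T arbitrary: u v w rule: finite_induct)
  case empty
  then show ?case by (simp add: link_def)
next
  case (insert e T)
  let ?S = "\<lambda>u. \<Sum>e\<in>T. \<bar>u (head G e) - u (tail G e)\<bar>"
  have ins: "(\<Sum>e\<in>insert e T. \<bar>u (head G e) - u (tail G e)\<bar>) = \<bar>u (head G e) - u (tail G e)\<bar> + ?S u"
    using insert.hyps by simp
  define K where "K = {x. (v, x) \<in> (link T)\<^sup>*}"
  show ?case
  proof (cases "w \<in> K")
    case True
    then have "\<bar>u v - u w\<bar> \<le> ?S u" using insert.IH by (simp add: K_def)
    with ins show ?thesis by simp
  next
    case False
    \<comment> \<open>As \<open>T\<close> alone does not link \<open>v\<close> to \<open>w\<close>,
      the inserted edge must be crossed: \<open>p\<close> is the end at which it is entered from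
      \<open>v\<close>, and \<open>q\<close> the end from which \<open>w\<close> is reached.\<close>
    have "\<exists>p q. (v, p) \<in> (link T)\<^sup>* \<and> (q, w) \<in> (link T)\<^sup>* \<and>
        {p, q} \<subseteq> {head G e, tail G e}"
      using insert.prems False unfolding link_insert rtrancl_insert K_def by blast
    then obtain p q where pq: "(v, p) \<in> (link T)\<^sup>*" "(q, w) \<in> (link T)\<^sup>*"
      "{p, q} \<subseteq> {head G e, tail G e}" by blast
    have K: "v \<in> K" "p \<in> K" "q \<notin> K" using pq False by (auto simp: K_def dest: rtrancl_trans)
    define u1 u2 where "u1 x = (if x \<in> K then u x else 0)" and "u2 x = (if x \<in> K then 0 else u x)" for x
    have T: "head G e \<in> K \<longleftrightarrow> tail G e \<in> K" if "e \<in> T" for e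
      using that unfolding K_def link_def by (auto intro: rtrancl_into_rtrancl)
    have "\<bar>u v - u p\<bar> \<le> ?S u1" using insert.IH[OF pq(1), of u1] K by (simp add: u1_def)
    moreover have "\<bar>u q - u w\<bar> \<le> ?S u2" using insert.IH[OF pq(2), of u2] K False by (simp add: u2_def)
    moreover have "?S u1 + ?S u2 = ?S u"
      unfolding sum.distrib[symmetric] by (rule sum.cong) (auto simp: u1_def u2_def T)
    moreover have "\<bar>u p - u q\<bar> = \<bar>u (head G e) - u (tail G e)\<bar>" using pq(3) K by auto
    ultimately show ?thesis using ins by linarith
  qed
qed

text \<open>Paths may turn inside an edge and repeat edges, while Cauchy-Schwarz needs a set of
  whole edges. The infimum \<open>\<rho> x\<close> of the total lengths of edge sets linking
  \<open>x\<close> to \<open>w\<close> changes by at most \<open>len e\<close> across an edge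
  \<open>e\<close>, so the general lower bound for distances applies to it; no path is ever
  converted into an edge set.\<close>

lemma linking_arcs_short:
  assumes "v \<in> verts G" "w \<in> verts G" "gdist G len (Vertex v) (Vertex w) < R"
  obtains T where "finite T" "T \<subseteq> arcs G" "(v, w) \<in> (link T)\<^sup>*" "(\<Sum>e\<in>T. len e) < R"
proof -
  define L where "L x = {\<Sum>e\<in>T. len e | T. finite T \<and> T \<subseteq> arcs G \<and> (x, w) \<in> (link T)\<^sup>*}" for x
  define \<rho> where "\<rho> x = Inf (L x)" for x
  have bdd: "bdd_below (L x)" for x
    unfolding L_def using len_pos by (intro bdd_belowI[of _ 0]) (auto intro!: sum_nonneg simp: less_imp_le subset_iff)
  have ne: "L x \<noteq> {}" if "x \<in> verts G" for x
    using link_arcs_connected[OF that assms(2)]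
  proof (induction rule: converse_rtrancl_induct)
    case base
    have "(\<Sum>e\<in>{}. len e) \<in> L w" unfolding L_def by blast
    then show ?case by blast
  next
    case (step x y)
    then obtain e where e: "e \<in> arcs G" "(x, y) \<in> link {e}" by (auto simp: link_def)
    from step.IH obtain T where T: "finite T" "T \<subseteq> arcs G" "(y, w) \<in> (link T)\<^sup>*" by (auto simp: L_def)
    have "(x, w) \<in> (link (insert e T))\<^sup>*"
      using e(2) rtrancl_mono[of "link T" "link (insert e T)"] T(3)
      by (auto simp: link_def intro: converse_rtrancl_into_rtrancl)
    then have "(\<Sum>e\<in>insert e T. len e) \<in> L x" unfolding L_def using e T by blast
    then show ?case by blast
  qed
  have step: "\<rho> x \<le> \<rho> y + len e" if e: "e \<in> arcs G" "(x, y) \<in> link {e}" for x y e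
  proof -
    have "\<rho> x - len e \<le> l" if "l \<in> L y" for l
    proof -
      from that obtain T where T: "finite T" "T \<subseteq> arcs G" "(y, w) \<in> (link T)\<^sup>*" "l = (\<Sum>e\<in>T. len e)"
        by (auto simp: L_def)
      have "(x, w) \<in> (link (insert e T))\<^sup>*"
        using e(2) rtrancl_mono[of "link T" "link (insert e T)"] T(3)
        by (auto simp: link_def intro: converse_rtrancl_into_rtrancl)
      then have "\<rho> x \<le> (\<Sum>e\<in>insert e T. len e)"
        unfolding \<rho>_def by (intro cInf_lower bdd) (use e T in \<open>auto simp: L_def\<close>)
      also have "\<dots> \<le> l + len e"
        using T len_pos[OF e(1)] by (simp add: sum.insert_if)
      finally show ?thesis by simp
    qed
    moreover have "y \<in> verts G" using e by (auto simp: link_def)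
    ultimately have "\<rho> x - len e \<le> \<rho> y" unfolding \<rho>_def[of y] using ne by (intro cInf_greatest) auto
    then show ?thesis by simp
  qed
  \<comment> \<open>\<open>h\<close> extends \<open>\<rho>\<close> to a function that is 1-Lipschitz along edges, so \<open>\<rho> v \<le> gdist v w\<close>.\<close>
  define h where "h x = (case x of Vertex v \<Rightarrow> \<rho> v
    | Inner e t \<Rightarrow> min (\<rho> (tail G e) + t) (\<rho> (head G e) + (len e - t)))" for x
  have "h (ep e t) = min (\<rho> (tail G e) + t) (\<rho> (head G e) + (len e - t))"
    if "e \<in> arcs G" "t \<in> {0..len e}" for e t
    using step[OF that(1), of "tail G e" "head G e"] step[OF that(1), of "head G e" "tail G e"] that
    by (auto simp: h_def edge_pt_def link_def)
  then have "edge_lipschitz h" unfolding edge_lipschitz_def by (auto simp: min_def)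
  then have "\<bar>h (Vertex v) - h (Vertex w)\<bar> \<le> gdist G len (Vertex v) (Vertex w)"
    using assms by (intro edge_lipschitz_le_gdist) (auto simp: points_def)
  moreover have "\<rho> w \<le> 0"
  proof -
    have "(\<Sum>e\<in>{}. len e) \<in> L w" unfolding L_def by blast
    then show ?thesis unfolding \<rho>_def using bdd by (metis cInf_lower sum.empty)
  qed
  ultimately have "\<rho> v < R" using assms by (auto simp: h_def)
  then obtain l where "l \<in> L v" "l < R" unfolding \<rho>_def using cInf_lessD ne assms by meson
  then show thesis using that by (auto simp: L_def)
qed

end

section \<open>The Dirichlet form on vertex functions\<close>

context metric_graph
begin

definition grad :: "('v \<Rightarrow> real) \<Rightarrow> 'e \<Rightarrow> real" where
  "grad u e = u (head G e) - u (tail G e)"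

definition fin_grad :: "('v \<Rightarrow> real) \<Rightarrow> bool" where
  "fin_grad u \<longleftrightarrow> finite {e \<in> arcs G. grad u e \<noteq> 0}"

text \<open>Summation runs over the support of the second gradient only: with
  \<open>fin_grad g\<close> the sum is finite even when \<open>f\<close> is a harmonic function
  varying along infinitely many edges.\<close>

definition dform :: "('v \<Rightarrow> real) \<Rightarrow> ('v \<Rightarrow> real) \<Rightarrow> real" where
  "dform f g = (\<Sum>e | e \<in> arcs G \<and> grad g e \<noteq> 0. grad f e * grad g e / len e)"

definition \<delta> :: "'v \<Rightarrow> 'v \<Rightarrow> real" where
  "\<delta> v = indicator {v}"

lemma dform_eq_sum:
  assumes "finite S" "S \<subseteq> arcs G" "\<And>e. e \<in> arcs G \<Longrightarrow> e \<notin> S \<Longrightarrow> grad g e = 0"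
  shows "dform f g = (\<Sum>e\<in>S. grad f e * grad g e / len e)"
  unfolding dform_def using assms by (intro sum.mono_neutral_left) auto

lemma fin_grad_lincomb:
  assumes "fin_grad a" "fin_grad b"
  shows "fin_grad (\<lambda>v. s * a v + t * b v)"
proof -
  have "{e \<in> arcs G. grad (\<lambda>v. s * a v + t * b v) e \<noteq> 0}
      \<subseteq> {e \<in> arcs G. grad a e \<noteq> 0} \<union> {e \<in> arcs G. grad b e \<noteq> 0}"
    by (auto simp: grad_def)
  then show ?thesis using assms unfolding fin_grad_def by (meson finite_Un finite_subset)
qed

lemma grad_lincomb: "grad (\<lambda>v. s * a v + t * b v) e = s * grad a e + t * grad b e"
  by (simp add: grad_def algebra_simps)

lemma dform_lincomb_left:
  "dform (\<lambda>v. s * a v + t * b v) g = s * dform a g + t * dform b g"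
  unfolding dform_def grad_lincomb
  by (simp add: sum_distrib_left sum.distrib[symmetric] algebra_simps add_divide_distrib)

lemma dform_lincomb_right:
  assumes "fin_grad a" "fin_grad b"
  shows "dform f (\<lambda>v. s * a v + t * b v) = s * dform f a + t * dform f b"
proof -
  define S where "S = {e \<in> arcs G. grad a e \<noteq> 0} \<union> {e \<in> arcs G. grad b e \<noteq> 0}"
  have S: "finite S" "S \<subseteq> arcs G" using assms by (auto simp: S_def fin_grad_def)
  have "dform f (\<lambda>v. s * a v + t * b v) = (\<Sum>e\<in>S. grad f e * (s * grad a e + t * grad b e) / len e)"
    using S by (subst dform_eq_sum[of S]) (auto simp: grad_lincomb S_def)
  moreover have "dform f a = (\<Sum>e\<in>S. grad f e * grad a e / len e)"
      "dform f b = (\<Sum>e\<in>S. grad f e * grad b e / len e)"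
    by (intro dform_eq_sum S; auto simp: S_def)+
  ultimately show ?thesis
    by (simp add: sum_distrib_left sum.distrib[symmetric] algebra_simps add_divide_distrib)
qed

lemma dform_commute:
  assumes "fin_grad a" "fin_grad b"
  shows "dform a b = dform b a"
proof -
  define S where "S = {e \<in> arcs G. grad a e \<noteq> 0} \<union> {e \<in> arcs G. grad b e \<noteq> 0}"
  have S: "finite S" "S \<subseteq> arcs G" using assms by (auto simp: S_def fin_grad_def)
  have "dform a b = (\<Sum>e\<in>S. grad a e * grad b e / len e)"
      "dform b a = (\<Sum>e\<in>S. grad b e * grad a e / len e)"
    by (intro dform_eq_sum S; auto simp: S_def)+
  then show ?thesis by (simp add: mult.commute)
qed

lemma dform_self_nonneg: "0 \<le> dform a a"
  unfolding dform_def using len_pos by (intro sum_nonneg) (auto simp: less_imp_le)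

lemma dform_quadratic:
  assumes "fin_grad a" "fin_grad b"
  shows "dform (\<lambda>v. s * a v + t * b v) (\<lambda>v. s * a v + t * b v) =
    s\<^sup>2 * dform a a + 2 * s * t * dform a b + t\<^sup>2 * dform b b"
  unfolding dform_lincomb_left dform_lincomb_right[OF assms]
  using dform_commute[OF assms] by (simp add: algebra_simps power2_eq_square)

lemma fin_grad_finite_support:
  assumes "finite {v \<in> verts G. u v \<noteq> 0}"
  shows "fin_grad u"
proof -
  have "{e \<in> arcs G. grad u e \<noteq> 0} \<subseteq> (\<Union>v\<in>{v \<in> verts G. u v \<noteq> 0}. in_arcs G v \<union> out_arcs G v)"
    by (auto simp: grad_def) (metis head_in_verts tail_in_verts)
  then show ?thesis
    unfolding fin_grad_def using assms locally_finite by (auto elim!: finite_subset)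
qed

lemma fin_grad_delta [simp]: "fin_grad (\<delta> v)"
  by (rule fin_grad_finite_support) (auto simp: \<delta>_def indicator_def)

text \<open>Pairing with \<open>\<delta> v\<close> gives the Kirchhoff sum at \<open>v\<close>, so
  harmonicity at \<open>v\<close> becomes \<open>dform f (\<delta> v) = 0\<close>. A loop at
  \<open>v\<close> occurs in both sums and cancels.\<close>

lemma dform_delta:
  assumes "v \<in> verts G"
  shows "dform f (\<delta> v) = (\<Sum>e\<in>in_arcs G v. grad f e / len e) - (\<Sum>e\<in>out_arcs G v. grad f e / len e)"
proof -
  define S where "S = in_arcs G v \<union> out_arcs G v"
  have S: "finite S" "S \<subseteq> arcs G" using locally_finite[OF assms] by (auto simp: S_def)
  have "dform f (\<delta> v) = (\<Sum>e\<in>S. grad f e * grad (\<delta> v) e / len e)"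
    using S by (rule dform_eq_sum) (auto simp: S_def grad_def \<delta>_def)
  also have "\<dots> = (\<Sum>e\<in>S. (if head G e = v then grad f e / len e else 0))
      - (\<Sum>e\<in>S. (if tail G e = v then grad f e / len e else 0))"
    unfolding sum_subtractf[symmetric] by (rule sum.cong) (auto simp: grad_def \<delta>_def diff_divide_distrib)
  also have "\<dots> = (\<Sum>e\<in>in_arcs G v. grad f e / len e) - (\<Sum>e\<in>out_arcs G v. grad f e / len e)"
    using S by (intro arg_cong2[of _ _ _ _ minus] sum.mono_neutral_cong_right) (auto simp: S_def)
  finally show ?thesis .
qed

text \<open>On the vertices, \<open>u\<close> is the finite combination of the
  \<open>\<delta> v\<close> with coefficients \<open>u v\<close>; local finiteness makes the edges
  involved a finite set.\<close>

lemma dform_green: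
  assumes "finite I" "I \<subseteq> verts G" "\<And>v. v \<in> verts G \<Longrightarrow> v \<notin> I \<Longrightarrow> u v = 0"
  shows "dform f u = (\<Sum>v\<in>I. u v * dform f (\<delta> v))"
proof -
  define S where "S = (\<Union>v\<in>I. in_arcs G v \<union> out_arcs G v)"
  have S: "finite S" "S \<subseteq> arcs G" using locally_finite assms by (auto simp: S_def)
  have u: "u w = (\<Sum>v\<in>I. u v * \<delta> v w)" if "w \<in> verts G" for w
  proof (cases "w \<in> I")
    case True
    then have "(\<Sum>v\<in>I. u v * \<delta> v w) = (\<Sum>v\<in>{w}. u v * \<delta> v w)"
      using assms by (intro sum.mono_neutral_right) (auto simp: \<delta>_def)
    then show ?thesis by (simp add: \<delta>_def)
  next
    case False
    then have "(\<Sum>v\<in>I. u v * \<delta> v w) = 0"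
      by (intro sum.neutral) (auto simp: \<delta>_def indicator_def)
    then show ?thesis using assms that False by simp
  qed
  have g: "grad u e = (\<Sum>v\<in>I. u v * grad (\<delta> v) e)" if "e \<in> S" for e
    using u[of "head G e"] u[of "tail G e"] that S
    by (simp add: grad_def sum_subtractf right_diff_distrib subset_iff)
  have "dform f u = (\<Sum>e\<in>S. grad f e * grad u e / len e)"
  proof (rule dform_eq_sum[OF S])
    fix e assume "e \<in> arcs G" "e \<notin> S"
    then have "u (head G e) = 0" "u (tail G e) = 0" by (intro assms(3); auto simp: S_def)+
    then show "grad u e = 0" by (simp add: grad_def)
  qed
  also have "\<dots> = (\<Sum>e\<in>S. \<Sum>v\<in>I. u v * (grad f e * grad (\<delta> v) e / len e))"
    by (intro sum.cong refl) (simp add: g sum_distrib_left sum_divide_distrib algebra_simps)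
  also have "\<dots> = (\<Sum>v\<in>I. u v * (\<Sum>e\<in>S. grad f e * grad (\<delta> v) e / len e))"
    by (subst sum.swap) (simp add: sum_distrib_left)
  also have "\<dots> = (\<Sum>v\<in>I. u v * dform f (\<delta> v))"
  proof (intro sum.cong refl arg_cong2[of _ _ _ _ times])
    fix v assume "v \<in> I"
    then show "(\<Sum>e\<in>S. grad f e * grad (\<delta> v) e / len e) = dform f (\<delta> v)"
      by (intro dform_eq_sum[symmetric] S) (auto simp: S_def grad_def \<delta>_def)
  qed
  finally show ?thesis .
qed

section \<open>Maximum principle and energy estimate\<close>

lemma grad_zero_constant:
  assumes "\<And>e. e \<in> arcs G \<Longrightarrow> grad u e = 0" "v \<in> verts G" "w \<in> verts G"
  shows "u v = u w"
  using link_arcs_connected[OF assms(2,3)]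
proof (induction rule: rtrancl_induct)
  case (step y z)
  then show ?case using assms(1) by (auto simp: link_def grad_def)
qed simp

text \<open>The equation is tested with \<open>u\<close>, the positive part of \<open>g - k\<close>
  on \<open>I\<close> and zero elsewhere. Truncation gives
  \<open>grad u e * grad u e \<le> grad g e * grad u e\<close>, so the energy of \<open>u\<close> is
  at most \<open>dform g u = 0\<close>. Thus \<open>u\<close> is constant, and it is zero at some
  vertex outside \<open>I\<close>.\<close>

lemma maximum_principle:
  assumes "finite I" "I \<subset> verts G" "\<And>v. v \<in> I \<Longrightarrow> dform g (\<delta> v) = 0"
    and "\<And>e. e \<in> arcs G \<Longrightarrow> head G e \<in> I \<Longrightarrow> tail G e \<notin> I \<Longrightarrow> g (tail G e) \<le> k"
    and "\<And>e. e \<in> arcs G \<Longrightarrow> tail G e \<in> I \<Longrightarrow> head G e \<notin> I \<Longrightarrow> g (head G e) \<le> k"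
    and "v \<in> I"
  shows "g v \<le> k"
proof -
  define u where "u v = (if v \<in> I then max (g v - k) 0 else 0)" for v
  have fin: "fin_grad u"
  proof (rule fin_grad_finite_support)
    show "finite {v \<in> verts G. u v \<noteq> 0}"
      by (rule finite_subset[OF _ assms(1)]) (auto simp: u_def)
  qed
  have clip: "(max x 0 - max y 0) * (max x 0 - max y 0) \<le> (x - y) * (max x 0 - max y 0)" for x y :: real
    using mult_right_mono[of x "x - y" x] mult_right_mono[of y "y - x" y]
    by (cases "0 \<le> x"; cases "0 \<le> y") (simp_all add: max_def minus_mult_commute left_diff_distrib)
  have sq: "grad u e * grad u e \<le> grad g e * grad u e" if e: "e \<in> arcs G" for e
  proof -
    \<comment> \<open>For an edge touching \<open>I\<close>, the bounds on the values next to
      \<open>I\<close> make \<open>u\<close> the positive part of \<open>g - k\<close> at both ends;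
      \<open>c = 0\<close> covers the edges away from \<open>I\<close>, where \<open>u\<close>
      vanishes.\<close>
    define c :: real where "c = (if head G e \<in> I \<or> tail G e \<in> I then 1 else 0)"
    have "u (head G e) = c * max (g (head G e) - k) 0" "u (tail G e) = c * max (g (tail G e) - k) 0"
      using assms(4,5)[OF e] by (simp_all add: u_def c_def)
    moreover have "c = 0 \<or> c = 1" by (simp add: c_def)
    ultimately show ?thesis
      using clip[of "g (head G e) - k" "g (tail G e) - k"] by (elim disjE) (simp_all add: grad_def)
  qed
  have "dform g u = 0"
    using assms(1-3) by (subst dform_green[of I]) (auto simp: u_def)
  moreover have "dform u u \<le> dform g u"
    unfolding dform_def using sq len_pos by (intro sum_mono divide_right_mono) (auto simp: less_imp_le)
  ultimately have "dform u u = 0" using dform_self_nonneg[of u] by simp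
  then have "\<forall>e\<in>{e \<in> arcs G. grad u e \<noteq> 0}. grad u e * grad u e / len e = 0"
    unfolding dform_def using fin len_pos
    by (subst (asm) sum_nonneg_eq_0_iff) (auto simp: fin_grad_def less_imp_le)
  then have "grad u e = 0" if "e \<in> arcs G" for e using that len_pos[OF that] by fastforce
  moreover obtain w where "w \<in> verts G" "w \<notin> I" using assms(2) by blast
  ultimately have "u v = u w" using grad_zero_constant assms(2,6) by blast
  then show ?thesis using \<open>w \<notin> I\<close> assms(6) by (auto simp: u_def)
qed

lemma energy_bound:
  assumes "fin_grad u" "v \<in> verts G" "w \<in> verts G" "gdist G len (Vertex v) (Vertex w) < R"
  shows "(u v - u w)\<^sup>2 \<le> R * dform u u"
proof -
  obtain T where T: "finite T" "T \<subseteq> arcs G" "(v, w) \<in> (link T)\<^sup>*" "(\<Sum>e\<in>T. len e) < R"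
    using linking_arcs_short[OF assms(2-4)] .
  have pos: "0 < len e" if "e \<in> T" for e using that T len_pos by auto
  have "(u v - u w)\<^sup>2 \<le> (\<Sum>e\<in>T. \<bar>grad u e\<bar>)\<^sup>2"
    using linked_sum_bound[OF T(1,3), of u] unfolding grad_def
    by (intro power2_le_iff_abs_le[THEN iffD2]) (auto intro: sum_nonneg)
  also have "(\<Sum>e\<in>T. \<bar>grad u e\<bar>) = (\<Sum>e\<in>T. sqrt (len e) * (\<bar>grad u e\<bar> / sqrt (len e)))"
    by (intro sum.cong refl) (use pos in fastforce)
  also have "(\<dots>)\<^sup>2 \<le> (\<Sum>e\<in>T. (sqrt (len e))\<^sup>2) * (\<Sum>e\<in>T. (\<bar>grad u e\<bar> / sqrt (len e))\<^sup>2)"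
    by (rule Cauchy_Schwarz_ineq_sum)
  also have "(\<Sum>e\<in>T. (sqrt (len e))\<^sup>2) = (\<Sum>e\<in>T. len e)"
    using pos by (intro sum.cong) (auto simp: less_imp_le)
  also have "(\<Sum>e\<in>T. (\<bar>grad u e\<bar> / sqrt (len e))\<^sup>2) = (\<Sum>e\<in>T. grad u e * grad u e / len e)"
    using pos by (intro sum.cong) (auto simp: power_divide less_imp_le power2_eq_square[of "grad _ _"])
  also have "(\<Sum>e\<in>T. len e) * (\<Sum>e\<in>T. grad u e * grad u e / len e) \<le> R * dform u u"
  proof (rule mult_mono)
    define S where "S = T \<union> {e \<in> arcs G. grad u e \<noteq> 0}"
    have S: "finite S" "S \<subseteq> arcs G" using T assms(1) by (auto simp: S_def fin_grad_def)
    have "(\<Sum>e\<in>T. grad u e * grad u e / len e) \<le> (\<Sum>e\<in>S. grad u e * grad u e / len e)"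
      using S len_pos by (intro sum_mono2) (auto simp: S_def less_imp_le)
    also have "\<dots> = dform u u"
      using S by (intro dform_eq_sum[symmetric]) (auto simp: S_def)
    finally show "(\<Sum>e\<in>T. grad u e * grad u e / len e) \<le> dform u u" .
    show "0 \<le> (\<Sum>e\<in>T. grad u e * grad u e / len e)"
      using pos by (intro sum_nonneg) (auto simp: less_imp_le)
    have "0 \<le> (\<Sum>e\<in>T. len e)" using pos by (intro sum_nonneg) (auto simp: less_imp_le)
    then show "0 \<le> R" using T by simp
  qed (use T in auto)
  finally show ?thesis .
qed

lemma dform_tendsto:
  assumes "\<And>v. (\<lambda>k. f k v) \<longlonglongrightarrow> h v"
  shows "(\<lambda>k. dform (f k) g) \<longlonglongrightarrow> dform h g"
  unfolding dform_def grad_def divide_inverse by (intro tendsto_intros assms)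

text \<open>Two competitors always agree at some vertex: at one outside \<open>I\<close>, or, if
  \<open>I\<close> is the whole of an infinite vertex set, at one where neither differs from
  \<open>\<psi>\<close>. The energy bound then controls their difference everywhere. The
  approximants \<open>g\<close> are part of the conclusion because their finite perturbations of
  \<open>\<psi>\<close> are what will give continuity on the completion.\<close>

lemma dirichlet_problem:
  assumes \<psi>: "fin_grad \<psi>" and I: "I \<subseteq> verts G" "\<not> (I = verts G \<and> finite (verts G))"
    and R: "\<And>v w. v \<in> verts G \<Longrightarrow> w \<in> verts G \<Longrightarrow> gdist G len (Vertex v) (Vertex w) < R"
  obtains f g where "\<And>k. finite {v. g k v \<noteq> \<psi> v}" "\<And>k v. v \<notin> I \<Longrightarrow> g k v = \<psi> v"
    "\<And>v. v \<notin> I \<Longrightarrow> f v = \<psi> v" "uniform_limit UNIV g f sequentially"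
    "\<And>v. v \<in> I \<Longrightarrow> dform f (\<delta> v) = 0"
proof -
  define \<F> where "\<F> = {g. finite {v. g v \<noteq> \<psi> v} \<and> (\<forall>v. v \<notin> I \<longrightarrow> g v = \<psi> v)}"
  have comb: "(\<lambda>v. s * a v + (1 - s) * b v) \<in> \<F>" if "a \<in> \<F>" "b \<in> \<F>" for a b s
  proof -
    have "{v. s * a v + (1 - s) * b v \<noteq> \<psi> v} \<subseteq> {v. a v \<noteq> \<psi> v} \<union> {v. b v \<noteq> \<psi> v}"
      by (auto simp: algebra_simps)
    then show ?thesis using that unfolding \<F>_def
      by (auto elim!: finite_subset simp: algebra_simps)
  qed
  have fg: "fin_grad a" if "a \<in> \<F>" for a
  proof -
    have "fin_grad (\<lambda>v. a v - \<psi> v)"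
      using that by (intro fin_grad_finite_support) (auto simp: \<F>_def elim!: finite_subset[rotated])
    from fin_grad_lincomb[OF this \<psi>, of 1 1] show ?thesis by simp
  qed
  define D where "D a = dform a a" for a
  define m where "m = Inf (D ` \<F>)"
  have m: "m \<le> D a" if "a \<in> \<F>" for a
    unfolding m_def using that dform_self_nonneg
    by (intro cInf_lower) (auto intro!: bdd_belowI[of _ 0] simp: D_def)
  have "\<psi> \<in> \<F>" by (simp add: \<F>_def)
  then have "\<exists>a\<in>\<F>. D a < m + inverse (real (Suc k))" for k
    using cInf_lessD[of "D ` \<F>" "m + inverse (real (Suc k))"] by (fastforce simp: m_def)
  then obtain g where g: "\<And>k. g k \<in> \<F>" "\<And>k. D (g k) < m + inverse (real (Suc k))" by metis
  have R0: "0 < R"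
  proof -
    obtain v where "v \<in> verts G" using graph_connected by (auto simp: connected_conv)
    moreover have "0 \<le> gdist G len (Vertex v) (Vertex v)"
      using edge_lipschitz_le_gdist[of "\<lambda>_. 0" "Vertex v" "Vertex v"] calculation
      by (auto simp: edge_lipschitz_def points_def)
    ultimately show ?thesis using R[of v v] by linarith
  qed
  have close: "(g j v - g k v)\<^sup>2 \<le> R * (2 * (inverse (real (Suc j)) + inverse (real (Suc k))))" for j k v
  proof -
    define d where "d v = 1 * g j v + (- 1) * g k v" for v
    \<comment> \<open>Parallelogram argument: the midpoint of two competitors is a competitor, so
      its energy is at least \<open>m\<close>, which bounds the energy of the difference
      \<open>d\<close> by the two defects.\<close>
    have "m \<le> D (\<lambda>v. 1 / 2 * g j v + (1 - 1 / 2) * g k v)" by (intro m comb g)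
    also have "\<dots> = (1 / 2)\<^sup>2 * D (g j) + 2 * (1 / 2) * (1 - 1 / 2) * dform (g j) (g k) + (1 - 1 / 2)\<^sup>2 * D (g k)"
      unfolding D_def by (intro dform_quadratic fg g)
    finally have 1: "4 * m \<le> D (g j) + 2 * dform (g j) (g k) + D (g k)" by (simp add: power2_eq_square)
    have "D d = D (g j) - 2 * dform (g j) (g k) + D (g k)"
      unfolding d_def D_def by (subst dform_quadratic) (auto intro: fg g)
    with 1 g(2)[of j] g(2)[of k]
    have Dd: "D d \<le> 2 * (inverse (real (Suc j)) + inverse (real (Suc k)))" by argo
    have "(d v)\<^sup>2 \<le> R * D d"
    proof (cases "v \<in> verts G")
      case True
      have "\<exists>w\<in>verts G. d w = 0"
      proof (cases "I = verts G")
        case True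
        have "finite ({v. g j v \<noteq> \<psi> v} \<union> {v. g k v \<noteq> \<psi> v})" using g(1) by (simp add: \<F>_def)
        then have "\<exists>w\<in>verts G. w \<notin> {v. g j v \<noteq> \<psi> v} \<union> {v. g k v \<noteq> \<psi> v}"
          using I True by (meson finite_subset subsetI)
        then show ?thesis by (force simp: d_def)
      next
        case False
        then obtain w where "w \<in> verts G" "w \<notin> I" using I by blast
        moreover from this have "d w = 0" using g(1) by (simp add: d_def \<F>_def)
        ultimately show ?thesis by blast
      qed
      then obtain w where w: "w \<in> verts G" "d w = 0" by blast
      have "fin_grad d" unfolding d_def by (intro fin_grad_lincomb fg g)
      from energy_bound[OF this True w(1) R[OF True w(1)]] w(2) show ?thesis by (simp add: D_def)
    next
      case False
      then have "v \<notin> I" using I by blast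
      then have "d v = 0" using g(1) by (simp add: d_def \<F>_def)
      then show ?thesis using R0 dform_self_nonneg by (simp add: D_def)
    qed
    also have "\<dots> \<le> R * (2 * (inverse (real (Suc j)) + inverse (real (Suc k))))"
      using Dd R0 by (intro mult_left_mono) auto
    finally show ?thesis by (simp add: d_def)
  qed
  have "uniformly_Cauchy_on UNIV g"
    unfolding uniformly_Cauchy_on_def
  proof (intro allI impI)
    fix e :: real assume e: "e > 0"
    obtain M where M: "inverse (real (Suc M)) < e\<^sup>2 / R / 4"
      using reals_Archimedean[of "e\<^sup>2 / R / 4"] e R0 by auto
    have half: "a \<le> c \<Longrightarrow> b \<le> c \<Longrightarrow> c < q / 4 \<Longrightarrow> 2 * (a + b) < q" for a b c q :: real by simp
    have "dist (g j v) (g k v) < e" if "j \<ge> M" "k \<ge> M" for j k v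
    proof -
      have "inverse (real (Suc j)) \<le> inverse (real (Suc M))" "inverse (real (Suc k)) \<le> inverse (real (Suc M))"
        using that by (auto intro!: le_imp_inverse_le)
      then have "2 * (inverse (real (Suc j)) + inverse (real (Suc k))) < e\<^sup>2 / R" by (rule half[OF _ _ M])
      then have "R * (2 * (inverse (real (Suc j)) + inverse (real (Suc k)))) < R * (e\<^sup>2 / R)"
        using R0 by (intro mult_strict_left_mono)
      then have "(g j v - g k v)\<^sup>2 < e\<^sup>2" using close[of j v k] R0 by simp
      then show ?thesis using e power2_less_imp_less[of "\<bar>g j v - g k v\<bar>" e] by (simp add: dist_real_def)
    qed
    then show "\<exists>M. \<forall>x\<in>UNIV. \<forall>m\<ge>M. \<forall>n\<ge>M. dist (g m x) (g n x) < e" by blast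
  qed
  then obtain f where f: "uniform_limit UNIV g f sequentially"
    using uniformly_convergent_eq_Cauchy uniformly_convergent_on_def by metis
  have lim: "(\<lambda>k. g k v) \<longlonglongrightarrow> f v" for v using tendsto_uniform_limitI[OF f] by simp
  have "f v = \<psi> v" if "v \<notin> I" for v
    using lim[of v] g(1) that by (simp add: \<F>_def LIMSEQ_const_iff)
  moreover have "dform f (\<delta> v) = 0" if v: "v \<in> I" for v
  proof -
    define A B where "A = dform f (\<delta> v)" and "B = D (\<delta> v)"
    have B0: "0 \<le> B" using dform_self_nonneg by (simp add: B_def D_def)
    have ineq: "0 \<le> 2 * t * A + t\<^sup>2 * B" for t
    proof (rule LIMSEQ_le_const)
      have "(\<lambda>k. inverse (real (Suc k)) + 2 * t * dform (g k) (\<delta> v) + t\<^sup>2 * B) \<longlonglongrightarrow> 0 + 2 * t * A + t\<^sup>2 * B"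
        unfolding A_def
        by (intro tendsto_add tendsto_mult tendsto_const LIMSEQ_inverse_real_of_nat dform_tendsto lim)
      then show "(\<lambda>k. inverse (real (Suc k)) + 2 * t * dform (g k) (\<delta> v) + t\<^sup>2 * B) \<longlonglongrightarrow> 2 * t * A + t\<^sup>2 * B"
        by simp
      have "0 \<le> inverse (real (Suc k)) + 2 * t * dform (g k) (\<delta> v) + t\<^sup>2 * B" for k
      proof -
        have "{w. 1 * g k w + t * \<delta> v w \<noteq> \<psi> w} \<subseteq> insert v {w. g k w \<noteq> \<psi> w}"
          by (auto simp: \<delta>_def)
        moreover have "finite (insert v {w. g k w \<noteq> \<psi> w})" using g(1)[of k] by (simp add: \<F>_def)
        ultimately have "finite {w. 1 * g k w + t * \<delta> v w \<noteq> \<psi> w}" by (rule finite_subset)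
        moreover have "1 * g k w + t * \<delta> v w = \<psi> w" if "w \<notin> I" for w
          using g(1)[of k] v that by (auto simp: \<F>_def \<delta>_def indicator_def)
        ultimately have "(\<lambda>w. 1 * g k w + t * \<delta> v w) \<in> \<F>" unfolding \<F>_def by blast
        from m[OF this] have "m \<le> D (g k) + 2 * t * dform (g k) (\<delta> v) + t\<^sup>2 * B"
          unfolding D_def B_def using dform_quadratic[OF fg[OF g(1), of k] fin_grad_delta[of v], of 1 t] by simp
        with g(2)[of k] show ?thesis by linarith
      qed
      then show "\<exists>N. \<forall>n\<ge>N. 0 \<le> inverse (real (Suc n)) + 2 * t * dform (g n) (\<delta> v) + t\<^sup>2 * B" by blast
    qed
    \<comment> \<open>The value \<open>t = - A / (B + 1)\<close> makes the quadratic negative unless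
      \<open>A = 0\<close>; the added 1 covers \<open>B = 0\<close>.\<close>
    have "2 * (- A / (B + 1)) * A + (- A / (B + 1))\<^sup>2 * B = - (A\<^sup>2 * (B + 2)) / (B + 1)\<^sup>2"
      using B0 by (simp add: power2_eq_square divide_simps) (simp add: algebra_simps)
    with ineq[of "- A / (B + 1)"] have "0 \<le> - (A\<^sup>2 * (B + 2)) / (B + 1)\<^sup>2" by simp
    moreover have "0 < (B + 1)\<^sup>2" using B0 by simp
    ultimately have "A\<^sup>2 * (B + 2) \<le> 0" by (simp add: divide_le_0_iff)
    then have "A\<^sup>2 \<le> 0" using B0 by (simp add: mult_le_0_iff)
    then show ?thesis by (simp add: A_def)
  qed
  moreover have "finite {v. g k v \<noteq> \<psi> v}" "v \<notin> I \<Longrightarrow> g k v = \<psi> v" for k v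
    using g(1)[of k] by (simp_all add: \<F>_def)
  ultimately show thesis using that f by blast
qed

end

section \<open>Topology of the completion\<close>

lemma infdist_less_iff:
  assumes "A \<noteq> {}"
  shows "infdist x A < r \<longleftrightarrow> (\<exists>a\<in>A. dist x a < r)"
  unfolding infdist_notempty[OF assms]
  using assms by (subst cINF_less_iff) (auto intro!: bdd_belowI[of _ 0])

context metric_graph_completion
begin

abbreviation "bd \<equiv> boundary G len X \<iota>"

lemma inj_embedding: "inj_on \<iota> (points G len)"
proof (rule inj_onI, rule ccontr)
  fix x y assume "x \<in> points G len" "y \<in> points G len" "\<iota> x = \<iota> y" "x \<noteq> y"
  then show False using gdist_pos[of x y] embedding_isometry[of x y] by simp
qed

lemma vertex_in_points [simp]: "v \<in> verts G \<Longrightarrow> Vertex v \<in> points G len"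
  by (simp add: points_def)

lemma embedding_edge_continuous:
  assumes "e \<in> arcs G"
  shows "continuous_on {0..len e} (\<lambda>t. \<iota> (ep e t))"
  unfolding continuous_on_iff
proof (intro ballI allI impI)
  fix s \<eta> :: real assume "s \<in> {0..len e}" "0 < \<eta>"
  have "dist (\<iota> (ep e t)) (\<iota> (ep e s)) \<le> dist t s" if "t \<in> {0..len e}" for t
    using gdist_edge_le[OF assms that \<open>s \<in> {0..len e}\<close>]
      embedding_isometry[of "ep e t" "ep e s"] edge_pt_in_points[OF assms]
    by (simp add: dist_real_def)
  then have "\<forall>t\<in>{0..len e}. dist t s < \<eta> \<longrightarrow> dist (\<iota> (ep e t)) (\<iota> (ep e s)) < \<eta>"
    using order.strict_trans1 by blast
  then show "\<exists>d>0. \<forall>t\<in>{0..len e}. dist t s < d \<longrightarrow> dist (\<iota> (ep e t)) (\<iota> (ep e s)) < \<eta>"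
    using \<open>0 < \<eta>\<close> by blast
qed

definition edge_set :: "'e \<Rightarrow> 'c set" where
  "edge_set e = (\<lambda>t. \<iota> (ep e t)) ` {0..len e}"

lemma compact_edge_set: "e \<in> arcs G \<Longrightarrow> compact (edge_set e)"
  unfolding edge_set_def by (intro compact_continuous_image embedding_edge_continuous compact_Icc)

lemma connected_edge_set: "e \<in> arcs G \<Longrightarrow> topological_space_class.connected (edge_set e)"
  unfolding edge_set_def by (intro connected_continuous_image embedding_edge_continuous connected_Icc)

lemma edge_set_subset: "e \<in> arcs G \<Longrightarrow> edge_set e \<subseteq> X"
  using embedding_into edge_pt_in_points unfolding edge_set_def by blast

text \<open>The completion adds no point close to a point of the graph. Near \<open>x\<close> the
  graph lies in finitely many closed edges, whose union is compact and hence closed, so density puts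
  all nearby points of \<open>X\<close> into this union too.\<close>

lemma embedding_ball:
  assumes x: "x \<in> points G len"
  shows "\<exists>r>0. finite {e \<in> arcs G. edge_set e \<inter> ball (\<iota> x) r \<noteq> {}} \<and>
    (\<forall>y\<in>X. dist (\<iota> x) y < r \<longrightarrow>
      y = \<iota> x \<or> (\<exists>e t. e \<in> arcs G \<and> 0 < t \<and> t < len e \<and> y = \<iota> (Inner e t)))"
proof -
  have "\<exists>r S. 0 < r \<and> finite S \<and> S \<subseteq> arcs G \<and>
      (\<forall>e t. Vertex (head G e) = x \<or> Vertex (tail G e) = x \<or> x = Inner e t \<longrightarrow> e \<in> arcs G \<longrightarrow> e \<in> S) \<and>
      (\<forall>y\<in>points G len. gdist G len x y < r \<longrightarrow> y = x \<or> (\<exists>e\<in>S. \<exists>t. y = Inner e t))"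
    using x
  proof (cases rule: points_cases)
    case (Vertex v)
    obtain r where r: "0 < r" "\<And>e. e \<in> in_arcs G v \<union> out_arcs G v \<Longrightarrow> 3 * r \<le> len e"
      using star_radius[OF Vertex(1)] by blast
    define S where "S = in_arcs G v \<union> out_arcs G v"
    have "r \<le> len e" if "e \<in> in_arcs G v \<union> out_arcs G v" for e using r(2)[OF that] r(1) by simp
    then have "y = x \<or> (\<exists>e\<in>S. \<exists>t. y = Inner e t)" if "y \<in> points G len" "gdist G len x y < r" for y
      using gdist_Vertex_less[OF Vertex(1) r(1), of y] that Vertex
      by (auto simp: S_def points_def)
    moreover have "finite S" "S \<subseteq> arcs G" using locally_finite[OF Vertex(1)] by (auto simp: S_def)
    ultimately show ?thesis using r(1) Vertex by (intro exI[of _ r] exI[of _ S]) (auto simp: S_def)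
  next
    case (Inner e t)
    define r where "r = min t (len e - t)"
    have r: "0 < r" "r \<le> t" "r \<le> len e - t" using Inner by (auto simp: r_def)
    have "y = x \<or> (\<exists>e\<in>{e}. \<exists>t. y = Inner e t)" if "y \<in> points G len" "gdist G len x y < r" for y
      using gdist_Inner_less[OF Inner(1) r that(1)] that(2) Inner by auto
    then show ?thesis using r(1) Inner by (intro exI[of _ r] exI[of _ "{e}"]) auto
  qed
  then obtain r S where r: "0 < r" and S: "finite S" "S \<subseteq> arcs G"
    "\<forall>e t. Vertex (head G e) = x \<or> Vertex (tail G e) = x \<or> x = Inner e t \<longrightarrow> e \<in> arcs G \<longrightarrow> e \<in> S"
    and near: "\<forall>y\<in>points G len. gdist G len x y < r \<longrightarrow> y = x \<or> (\<exists>e\<in>S. \<exists>t. y = Inner e t)"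
    by (elim exE conjE) (rule that)
  define K where "K = insert (\<iota> x) (\<Union>e\<in>S. edge_set e)"
  have "closed K"
    unfolding K_def using S by (intro compact_imp_closed compact_insert compact_UN compact_edge_set) auto
  have "ball (\<iota> x) r \<inter> \<iota> ` points G len \<subseteq> K"
  proof
    fix z assume "z \<in> ball (\<iota> x) r \<inter> \<iota> ` points G len"
    then obtain y where y: "y \<in> points G len" "z = \<iota> y" "gdist G len x y < r"
      using embedding_isometry[OF x] by auto
    from near y(1,3) have "y = x \<or> (\<exists>e\<in>S. \<exists>t. y = Inner e t)" by blast
    then show "z \<in> K"
    proof (elim disjE bexE exE)
      fix e t assume "e \<in> S" "y = Inner e t"
      moreover from this have "y = ep e t" "t \<in> {0..len e}" using y(1) by (auto simp: points_def edge_pt_def)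
      then have "z \<in> edge_set e" using y(2) unfolding edge_set_def by blast
      ultimately show ?thesis by (auto simp: K_def)
    qed (simp add: K_def y)
  qed
  \<comment> \<open>A point of \<open>X\<close> in the open ball is a limit of graph points in that
    ball, and \<open>K\<close> is closed.\<close>
  then have K: "X \<inter> ball (\<iota> x) r \<subseteq> K"
    using open_Int_closure_subset[OF open_ball, of "\<iota> x" r "\<iota> ` points G len"] embedding_dense
      closure_minimal[OF _ \<open>closed K\<close>] by blast
  have "K \<subseteq> \<iota> ` points G len"
    unfolding K_def edge_set_def using x S edge_pt_in_points by auto
  then have pt: "\<exists>p\<in>points G len. y = \<iota> p \<and> gdist G len x p < r" if "y \<in> X" "dist (\<iota> x) y < r" for y
    using K that embedding_isometry[OF x] by fastforce
  show ?thesis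
  proof (intro exI[of _ r] conjI ballI impI r)
    show "y = \<iota> x \<or> (\<exists>e t. e \<in> arcs G \<and> 0 < t \<and> t < len e \<and> y = \<iota> (Inner e t))"
      if y: "y \<in> X" "dist (\<iota> x) y < r" for y
    proof -
      from pt[OF y] obtain p where p: "p \<in> points G len" "y = \<iota> p" "gdist G len x p < r" by blast
      from near p(1,3) have "p = x \<or> (\<exists>e\<in>S. \<exists>t. p = Inner e t)" by blast
      with p(1,2) show ?thesis by (auto simp: points_def)
    qed
    have "e \<in> S" if e: "e \<in> arcs G" "edge_set e \<inter> ball (\<iota> x) r \<noteq> {}" for e
    proof -
      from e(2) obtain z where "z \<in> edge_set e" "dist (\<iota> x) z < r" by auto
      then obtain t where t: "t \<in> {0..len e}" "dist (\<iota> x) (\<iota> (ep e t)) < r" unfolding edge_set_def by blast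
      then have "gdist G len x (ep e t) < r"
        using embedding_isometry[OF x edge_pt_in_points[OF e(1)]] by metis
      with near edge_pt_in_points[OF e(1)] have "ep e t = x \<or> (\<exists>e'\<in>S. \<exists>t'. ep e t = Inner e' t')" by blast
      then show "e \<in> S" using S(3) e(1) by (auto simp: edge_pt_def split: if_splits)
    qed
    then show "finite {e \<in> arcs G. edge_set e \<inter> ball (\<iota> x) r \<noteq> {}}"
      by (intro finite_subset[OF _ S(1)]) blast
  qed
qed

text \<open>Finitely many of the balls around graph points cover \<open>K\<close>; each meets
  finitely many edges and contains no vertex except possibly its centre. Applied to the points at
  distance at least \<epsilon> from the boundary, this makes the subgraphs finite.\<close>

lemma compact_meets_finitely_many:
  assumes "compact K" "K \<subseteq> \<iota> ` points G len"
  shows "finite {e \<in> arcs G. edge_set e \<inter> K \<noteq> {}}" "finite {v \<in> verts G. \<iota> (Vertex v) \<in> K}"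
proof -
  have "\<exists>r>0. finite {e \<in> arcs G. edge_set e \<inter> ball x r \<noteq> {}} \<and> finite {v \<in> verts G. \<iota> (Vertex v) \<in> ball x r}"
    if "x \<in> K" for x
  proof -
    from that assms obtain p where p: "p \<in> points G len" "x = \<iota> p" by blast
    obtain r where r: "0 < r" "finite {e \<in> arcs G. edge_set e \<inter> ball (\<iota> p) r \<noteq> {}}"
      "\<forall>y\<in>X. dist (\<iota> p) y < r \<longrightarrow>
        y = \<iota> p \<or> (\<exists>e t. e \<in> arcs G \<and> 0 < t \<and> t < len e \<and> y = \<iota> (Inner e t))"
      using embedding_ball[OF p(1)] by (elim exE conjE) (rule that)
    have "p = Vertex v" if v: "v \<in> verts G" "\<iota> (Vertex v) \<in> ball x r" for v
    proof -
      have "\<iota> (Vertex v) \<in> X" using vertex_in_points[OF v(1)] embedding_into by blast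
      then have "\<iota> (Vertex v) = \<iota> p \<or> (\<exists>e t. e \<in> arcs G \<and> 0 < t \<and> t < len e \<and> \<iota> (Vertex v) = \<iota> (Inner e t))"
        using r(3)[rule_format, of "\<iota> (Vertex v)"] v(2) p(2) by simp
      then show ?thesis
      proof (elim disjE exE conjE)
        assume "\<iota> (Vertex v) = \<iota> p"
        then show ?thesis using inj_embedding p v by (auto dest: inj_onD)
      next
        fix e t assume e: "e \<in> arcs G" "0 < t" "t < len e" "\<iota> (Vertex v) = \<iota> (Inner e t)"
        then have "Inner e t \<in> points G len" by (auto simp: points_def)
        then show ?thesis using inj_onD[OF inj_embedding e(4)] v by simp
      qed
    qed
    \<comment> \<open>If \<open>p\<close> is not a vertex, the left side is empty and the arbitrary
      value of \<open>SOME\<close> is harmless.\<close>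
    then have "{v \<in> verts G. \<iota> (Vertex v) \<in> ball x r} \<subseteq> {SOME v. p = Vertex v}"
      by auto
    then show ?thesis using r p by (meson finite.emptyI finite.insertI finite_subset)
  qed
  then have "\<forall>x\<in>K. \<exists>r. 0 < r \<and> finite {e \<in> arcs G. edge_set e \<inter> ball x r \<noteq> {}} \<and>
      finite {v \<in> verts G. \<iota> (Vertex v) \<in> ball x r}" by simp
  from bchoice[OF this] obtain r where "\<forall>x\<in>K. 0 < r x \<and> finite {e \<in> arcs G. edge_set e \<inter> ball x (r x) \<noteq> {}} \<and>
      finite {v \<in> verts G. \<iota> (Vertex v) \<in> ball x (r x)}" by (elim exE) (rule that)
  then have r: "0 < r x" "finite {e \<in> arcs G. edge_set e \<inter> ball x (r x) \<noteq> {}}"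
    "finite {v \<in> verts G. \<iota> (Vertex v) \<in> ball x (r x)}" if "x \<in> K" for x
    using that by simp_all
  have "K \<subseteq> (\<Union>x\<in>K. ball x (r x))" using r(1) by force
  then obtain D where D: "D \<subseteq> K" "finite D" "K \<subseteq> (\<Union>x\<in>D. ball x (r x))"
    using compactE_image[OF assms(1), of K "\<lambda>x. ball x (r x)"] by (metis open_ball)
  have "{e \<in> arcs G. edge_set e \<inter> K \<noteq> {}} \<subseteq> (\<Union>x\<in>D. {e \<in> arcs G. edge_set e \<inter> ball x (r x) \<noteq> {}})"
    using D(3) by blast
  then show "finite {e \<in> arcs G. edge_set e \<inter> K \<noteq> {}}"
    using D r(2) by (auto elim!: finite_subset)
  have "{v \<in> verts G. \<iota> (Vertex v) \<in> K} \<subseteq> (\<Union>x\<in>D. {v \<in> verts G. \<iota> (Vertex v) \<in> ball x (r x)})"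
    using D(3) by blast
  then show "finite {v \<in> verts G. \<iota> (Vertex v) \<in> K}"
    using D r(3) by (auto elim!: finite_subset)
qed

lemma boundary_subset: "bd \<subseteq> X"
  by (auto simp: boundary_def)

lemma not_boundary_in_graph: "x \<in> X \<Longrightarrow> x \<notin> bd \<Longrightarrow> x \<in> \<iota> ` points G len"
  by (auto simp: boundary_def)

lemma leaf_in_boundary: "v \<in> leaves G \<Longrightarrow> \<iota> (Vertex v) \<in> bd"
proof -
  assume v: "v \<in> leaves G"
  then have p: "Vertex v \<in> points G len" by (simp add: leaves_def)
  have "\<iota> (Vertex v) \<noteq> \<iota> q" if "q \<in> points G len - Vertex ` leaves G" for q
    using inj_onD[OF inj_embedding _ p, of q] that v by auto
  then show ?thesis using p embedding_into by (auto simp: boundary_def)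
qed

lemma boundary_cases:
  assumes "x \<in> bd"
  obtains v where "v \<in> leaves G" "x = \<iota> (Vertex v)" | "x \<notin> \<iota> ` points G len"
  using assms by (auto simp: boundary_def)

text \<open>Around a graph point that is not a leaf, a small ball contains besides the centre only
  inner points of edges, none of which lies in the boundary.\<close>

lemma closedin_boundary: "closedin (top_of_set X) bd"
proof -
  have "openin (top_of_set X) (X - bd)"
    unfolding openin_contains_ball
  proof (intro conjI ballI)
    fix x assume "x \<in> X - bd"
    then obtain p where p: "p \<in> points G len" "p \<notin> Vertex ` leaves G" "x = \<iota> p" by (auto simp: boundary_def)
    obtain r where r: "0 < r" "finite {e \<in> arcs G. edge_set e \<inter> ball (\<iota> p) r \<noteq> {}}"
      "\<forall>y\<in>X. dist (\<iota> p) y < r \<longrightarrow>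
        y = \<iota> p \<or> (\<exists>e t. e \<in> arcs G \<and> 0 < t \<and> t < len e \<and> y = \<iota> (Inner e t))"
      using embedding_ball[OF p(1)] by (elim exE conjE) (rule that)
    have "y \<notin> bd" if y: "y \<in> X" "dist x y < r" for y
    proof -
      have "y = \<iota> p \<or> (\<exists>e t. e \<in> arcs G \<and> 0 < t \<and> t < len e \<and> y = \<iota> (Inner e t))"
        using r(3) y p(3) by blast
      moreover have "\<iota> q \<notin> bd" if "q \<in> points G len" "q \<notin> Vertex ` leaves G" for q
        using that by (simp add: boundary_def)
      moreover have "Inner e t \<in> points G len" if "e \<in> arcs G" "0 < t" "t < len e" for e t
        using that by (simp add: points_def)
      ultimately show ?thesis using p by blast
    qed
    then show "\<exists>e>0. ball x e \<inter> X \<subseteq> X - bd" using r(1) by (intro exI[of _ r]) auto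
  qed auto
  then show ?thesis by (simp add: closedin_def boundary_subset)
qed

end

locale compact_completion = metric_graph_completion G len X \<iota>
  for G :: "('v, 'e) pre_digraph" and len :: "'e \<Rightarrow> real"
    and X :: "'c::metric_space set" and \<iota> :: "('v, 'e) gpoint \<Rightarrow> 'c" +
  assumes compact_X: "compact X" and boundary_nonempty: "boundary G len X \<iota> \<noteq> {}"
begin

lemma compact_boundary: "compact bd"
  using closedin_boundary compact_X closedin_compact by blast

text \<open>A finite graph is compact and thus equal to its completion; without leaves its boundary
  would be empty. This guarantees that the Dirichlet problems have something to pin the solution
  down.\<close>

lemma infinite_or_leaf: "\<not> finite (verts G) \<or> leaves G \<noteq> {}"
proof (rule ccontr)
  assume "\<not> (\<not> finite (verts G) \<or> leaves G \<noteq> {})"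
  then have fin: "finite (verts G)" "leaves G = {}" by auto
  have "arcs G \<subseteq> (\<Union>v\<in>verts G. in_arcs G v)" by auto
  then have "finite (arcs G)" using fin locally_finite by (auto elim!: finite_subset)
  have "\<iota> ` points G len = \<iota> ` Vertex ` verts G \<union> (\<Union>e\<in>arcs G. edge_set e)"
  proof -
    have "points G len = Vertex ` verts G \<union> (\<Union>e\<in>arcs G. ep e ` {0..len e})"
    proof (intro equalityI subsetI)
      fix x assume "x \<in> points G len"
      then show "x \<in> Vertex ` verts G \<union> (\<Union>e\<in>arcs G. ep e ` {0..len e})"
      proof (cases rule: points_cases)
        case (Inner e t)
        then have "x \<in> ep e ` {0..len e}" by (intro image_eqI[of _ _ t]) auto
        with Inner show ?thesis by blast
      qed auto
    qed (auto intro: edge_pt_in_points)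
    then show ?thesis by (auto simp: edge_set_def image_Un image_UN image_image)
  qed
  moreover have "compact (\<iota> ` Vertex ` verts G \<union> (\<Union>e\<in>arcs G. edge_set e))"
    using fin \<open>finite (arcs G)\<close> by (intro compact_Un compact_UN compact_edge_set finite_imp_compact) auto
  ultimately have "closed (\<iota> ` points G len)" using compact_imp_closed by simp
  then have "X \<subseteq> \<iota> ` points G len" using embedding_dense by simp
  then have "bd = {}" using fin(2) by (auto simp: boundary_def)
  then show False using boundary_nonempty by simp
qed

lemma interior_not_everything:
  assumes "I \<subseteq> verts G - leaves G"
  shows "\<not> (I = verts G \<and> finite (verts G))"
  using infinite_or_leaf assms by (auto simp: leaves_def)

text \<open>Only a vertex without edges could fail. By connectedness it would be the whole graph,
  which is finite and has no leaf.\<close>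

lemma point_on_edge:
  assumes "p \<in> points G len"
  obtains e t where "e \<in> arcs G" "t \<in> {0..len e}" "p = ep e t"
  using assms
proof (cases rule: points_cases)
  case (Vertex v)
  have "\<not> verts G \<subseteq> {v}" if "infinite (verts G)"
    using that finite_subset[of "verts G" "{v}"] by auto
  moreover have "leaves G \<subseteq> verts G" by (auto simp: leaves_def)
  ultimately obtain w where w: "w \<in> verts G" "w \<noteq> v \<or> w \<in> leaves G"
    using infinite_or_leaf by blast
  have "\<exists>e\<in>arcs G. v = tail G e \<or> v = head G e"
  proof (cases "w = v")
    case False
    then show ?thesis using link_arcs_connected[OF Vertex(1) w(1)]
      by (auto simp: link_def elim: converse_rtranclE)
  next
    case True
    then have "in_degree G v + out_degree G v = 1" using w by (auto simp: leaves_def)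
    then have "in_arcs G v \<noteq> {} \<or> out_arcs G v \<noteq> {}" by (auto simp: in_degree_def out_degree_def)
    then show ?thesis by auto
  qed
  then obtain e where "e \<in> arcs G" "v = tail G e \<or> v = head G e" by blast
  then show thesis using that[of e 0] that[of e "len e"] len_pos[of e] Vertex by auto
next
  case (Inner e t)
  then show thesis using that[of e t] by auto
qed

lemma gdist_bounded:
  obtains R where "\<And>v w. v \<in> verts G \<Longrightarrow> w \<in> verts G \<Longrightarrow> gdist G len (Vertex v) (Vertex w) < R"
proof -
  obtain R where "\<And>x y. x \<in> X \<Longrightarrow> y \<in> X \<Longrightarrow> dist x y \<le> R"
    using compact_imp_bounded[OF compact_X] by (metis bounded_two_points)
  then show thesis using that[of "R + 1"] embedding_isometry embedding_into
    by (metis image_subset_iff less_add_one order.strict_trans1 vertex_in_points)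
qed

lemma compact_far: "0 < \<epsilon> \<Longrightarrow> compact {x \<in> X. \<epsilon> \<le> infdist x bd}"
  unfolding Collect_conj_eq Collect_mem_eq
  by (intro compact_Int_closed compact_X closed_Collect_le continuous_intros)

end

section \<open>Extending functions from the graph to its completion\<close>

text \<open>A continuous map on a compact set is closed, hence a quotient map onto its image.
  Continuity on an edge can thus be checked in the parameter, loops included.\<close>

lemma continuous_on_compact_image:
  fixes g :: "'a::metric_space \<Rightarrow> 'b::metric_space" and h :: "'b \<Rightarrow> real"
  assumes "compact S" "continuous_on S g" "continuous_on S (h \<circ> g)"
  shows "continuous_on (g ` S) h"
  unfolding continuous_on_closed_invariant
proof (intro allI impI)
  fix B :: "real set" assume "closed B"
  then have "compact (S \<inter> (h \<circ> g) -` B)"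
    using assms(1,3) by (meson closedin_compact continuous_closedin_preimage)
  then have "compact (g ` (S \<inter> (h \<circ> g) -` B))"
    using assms(2) by (meson compact_continuous_image continuous_on_subset inf_le1)
  moreover have "g ` (S \<inter> (h \<circ> g) -` B) = h -` B \<inter> g ` S" by auto
  ultimately show "\<exists>A. closed A \<and> A \<inter> g ` S = h -` B \<inter> g ` S"
    by (intro exI[of _ "h -` B \<inter> g ` S"]) (auto dest: compact_imp_closed)
qed

text \<open>The clopen partition is used through its metric consequence: distinct members are at
  distance at least \<open>2 * r0\<close>, so their \<open>r0\<close>-neighbourhoods are
  disjoint.\<close>

locale partitioned_completion = compact_completion G len X \<iota>
  for G :: "('v, 'e) pre_digraph" and len :: "'e \<Rightarrow> real"
    and X :: "'c::metric_space set" and \<iota> :: "('v, 'e) gpoint \<Rightarrow> 'c" +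
  fixes E :: "'n::finite \<Rightarrow> 'c set" and r0 :: real
  assumes E_Union: "(\<Union>n. E n) = boundary G len X \<iota>"
    and E_nonempty: "E n \<noteq> {}"
    and r0_pos: "0 < r0"
    and E_separated: "n \<noteq> m \<Longrightarrow> x \<in> E n \<Longrightarrow> y \<in> E m \<Longrightarrow> 2 * r0 \<le> dist x y"
begin

lemma E_disjoint: "x \<in> E n \<Longrightarrow> x \<in> E m \<Longrightarrow> n = m"
  using E_separated[of n m x x] r0_pos by fastforce

lemma E_boundary: "x \<in> E n \<Longrightarrow> x \<in> bd"
  using E_Union by auto

lemma step_fun_eq: "x \<in> E n \<Longrightarrow> step_fun E F x = F $ n"
proof -
  assume x: "x \<in> E n"
  have "step_fun E F x = (\<Sum>m\<in>{n}. F $ m * indicator (E m) x)"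
    unfolding step_fun_def using E_disjoint[OF x] by (intro sum.mono_neutral_right) (auto simp: indicator_def)
  then show ?thesis using x by simp
qed

definition nbhd :: "'n \<Rightarrow> 'c set" where
  "nbhd n = {x. infdist x (E n) < r0}"

lemma nbhd_iff: "x \<in> nbhd n \<longleftrightarrow> (\<exists>y\<in>E n. dist x y < r0)"
  unfolding nbhd_def using infdist_less_iff[OF E_nonempty] by simp

lemma nbhd_disjoint: "x \<in> nbhd n \<Longrightarrow> x \<in> nbhd m \<Longrightarrow> n = m"
proof (rule ccontr)
  assume "x \<in> nbhd n" "x \<in> nbhd m" "n \<noteq> m"
  then obtain y z where "y \<in> E n" "z \<in> E m" "dist x y < r0" "dist x z < r0" by (auto simp: nbhd_iff)
  then show False using E_separated[OF \<open>n \<noteq> m\<close>, of y z] dist_triangle[of y z x]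
    by (simp add: dist_commute)
qed

lemma E_subset_nbhd: "x \<in> E n \<Longrightarrow> x \<in> nbhd n"
  using r0_pos by (force simp: nbhd_iff)

lemma open_nbhd: "open (nbhd n)"
  unfolding nbhd_def by (intro open_Collect_less continuous_intros)

section \<open>Edges reaching away from the boundary\<close>

definition far_arcs :: "real \<Rightarrow> 'e set" where
  "far_arcs \<epsilon> = {e \<in> arcs G. \<exists>t\<in>{0..len e}. \<epsilon> \<le> infdist (\<iota> (ep e t)) bd}"

lemma far_arcs_subset: "far_arcs \<epsilon> \<subseteq> arcs G"
  by (auto simp: far_arcs_def)

lemma finite_far_arcs: "0 < \<epsilon> \<Longrightarrow> finite (far_arcs \<epsilon>)"
proof -
  assume \<epsilon>: "0 < \<epsilon>"
  have "{x \<in> X. \<epsilon> \<le> infdist x bd} \<subseteq> \<iota> ` points G len"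
    using not_boundary_in_graph \<epsilon> by fastforce
  from compact_meets_finitely_many(1)[OF compact_far[OF \<epsilon>] this]
  show ?thesis
  proof (rule finite_subset[rotated])
    show "far_arcs \<epsilon> \<subseteq> {e \<in> arcs G. edge_set e \<inter> {x \<in> X. \<epsilon> \<le> infdist x bd} \<noteq> {}}"
      using edge_set_subset unfolding far_arcs_def edge_set_def by blast
  qed
qed

lemma far_arcs_antimono: "\<epsilon> \<le> \<epsilon>' \<Longrightarrow> far_arcs \<epsilon>' \<subseteq> far_arcs \<epsilon>"
  by (force simp: far_arcs_def)

text \<open>All points of such an edge are closer than \<open>r0\<close> to the boundary, so the
  disjoint open neighbourhoods cover it; being connected, it lies in a single one. This confines the
  differences of indicators to the finite set \<open>far_arcs r0\<close>.\<close>

lemma near_edge: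
  assumes "e \<in> arcs G" "e \<notin> far_arcs r0" "s \<in> {0..len e}" "t \<in> {0..len e}" "\<iota> (ep e s) \<in> nbhd n"
  shows "\<iota> (ep e t) \<in> nbhd n"
proof (rule ccontr)
  assume t: "\<iota> (ep e t) \<notin> nbhd n"
  define U where "U = (\<Union>m\<in>UNIV - {n}. nbhd m)"
  have cover: "edge_set e \<subseteq> nbhd n \<union> U"
  proof
    fix x assume "x \<in> edge_set e"
    then have "infdist x bd < r0" using assms(1,2) by (force simp: far_arcs_def edge_set_def)
    then obtain y where y: "y \<in> bd" "dist x y < r0" using infdist_less_iff[OF boundary_nonempty] by auto
    then obtain m where "y \<in> E m" using E_Union by auto
    then have "x \<in> nbhd m" using y by (auto simp: nbhd_iff)
    then show "x \<in> nbhd n \<union> U" by (cases "m = n") (auto simp: U_def)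
  qed
  have "open U" by (auto simp: U_def open_nbhd)
  moreover have "nbhd n \<inter> U \<inter> edge_set e = {}" using nbhd_disjoint by (auto simp: U_def)
  ultimately have "nbhd n \<inter> edge_set e = {} \<or> U \<inter> edge_set e = {}"
    using connectedD[OF connected_edge_set[OF assms(1)] open_nbhd] cover by blast
  moreover have "\<iota> (ep e s) \<in> edge_set e" "\<iota> (ep e t) \<in> edge_set e"
    using assms by (auto simp: edge_set_def)
  ultimately show False using assms(5) t cover by blast
qed

text \<open>Every point of \<open>X\<close> off the graph is a boundary point, so the step function
  supplies the value there; on the graph the point is recovered from its image by
  injectivity.\<close>

definition extend :: "(('v, 'e) gpoint \<Rightarrow> real) \<Rightarrow> real ^ 'n \<Rightarrow> 'c \<Rightarrow> real" where
  "extend H F x = (if x \<in> \<iota> ` points G len then H (inv_into (points G len) \<iota> x) else step_fun E F x)"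

lemma extend_point [simp]: "p \<in> points G len \<Longrightarrow> extend H F (\<iota> p) = H p"
  by (simp add: extend_def inv_into_f_f[OF inj_embedding])

lemma extend_off_graph: "x \<notin> \<iota> ` points G len \<Longrightarrow> extend H F x = step_fun E F x"
  by (simp add: extend_def)

lemma edge_fun_extend: "e \<in> arcs G \<Longrightarrow> edge_fun G len \<iota> (extend H F) e t = H (ep e t)"
  by (simp add: edge_fun_def edge_pt_in_points)

text \<open>At a graph point only finitely many closed edges are involved, and continuity is glued
  from them. A point off the graph has positive distance from the closed union of the edges in
  \<open>S\<close>, so near it the function is the constant \<open>F $ n\<close>.\<close>

lemma continuous_extend:
  assumes H: "\<And>e. e \<in> arcs G \<Longrightarrow> continuous_on {0..len e} (\<lambda>t. H (ep e t))"
    and S: "finite S" "S \<subseteq> arcs G"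
    and const: "\<And>e t n. e \<in> arcs G \<Longrightarrow> e \<notin> S \<Longrightarrow> t \<in> {0..len e} \<Longrightarrow> \<iota> (ep e t) \<in> nbhd n \<Longrightarrow> H (ep e t) = F $ n"
  shows "continuous_on X (extend H F)"
  unfolding continuous_on_eq_continuous_within
proof
  fix x assume x: "x \<in> X"
  show "continuous (at x within X) (extend H F)"
  proof (cases "x \<in> \<iota> ` points G len")
    case True
    then obtain p where p: "p \<in> points G len" "x = \<iota> p" by blast
    obtain r where r: "0 < r" "finite {e \<in> arcs G. edge_set e \<inter> ball (\<iota> p) r \<noteq> {}}"
      "\<forall>y\<in>X. dist (\<iota> p) y < r \<longrightarrow>
        y = \<iota> p \<or> (\<exists>e t. e \<in> arcs G \<and> 0 < t \<and> t < len e \<and> y = \<iota> (Inner e t))"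
      using embedding_ball[OF p(1)] by (elim exE conjE) (rule that)
    define S' where "S' = {e \<in> arcs G. edge_set e \<inter> ball x r \<noteq> {}}"
    define Z where "Z = {x} \<union> (\<Union>e\<in>S'. edge_set e)"
    have "finite S'" using r p by (simp add: S'_def)
    have "continuous_on (edge_set e) (extend H F)" if "e \<in> S'" for e
      unfolding edge_set_def
    proof (rule continuous_on_compact_image)
      show "continuous_on {0..len e} (extend H F \<circ> (\<lambda>t. \<iota> (ep e t)))"
        using H[of e] that edge_pt_in_points by (simp add: S'_def o_def)
    qed (use that in \<open>auto simp: S'_def intro: embedding_edge_continuous\<close>)
    then have "continuous_on (\<Union>e\<in>S'. edge_set e) (extend H F)"
      using \<open>finite S'\<close> by (intro continuous_on_closed_Union)
        (auto simp: S'_def intro: compact_imp_closed compact_edge_set)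
    moreover have "closed (\<Union>e\<in>S'. edge_set e)"
      using \<open>finite S'\<close> by (auto simp: S'_def intro!: closed_UN compact_imp_closed compact_edge_set)
    ultimately have "continuous_on Z (extend H F)"
      unfolding Z_def by (intro continuous_on_closed_Un) auto
    moreover have "X \<inter> ball x r \<subseteq> Z"
    proof
      fix y assume y: "y \<in> X \<inter> ball x r"
      then consider "y = x" | e t where "e \<in> arcs G" "0 < t" "t < len e" "y = \<iota> (Inner e t)"
        using r(3) p by auto
      then show "y \<in> Z"
      proof cases
        case 2
        then have "y \<in> edge_set e" unfolding edge_set_def using edge_pt_Inner[of t e]
          by (intro image_eqI[of _ _ t]) auto
        moreover from this have "e \<in> S'" using 2(1) y unfolding S'_def by blast
        ultimately show ?thesis by (auto simp: Z_def)
      qed (simp add: Z_def)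
    qed
    ultimately have "continuous_on (X \<inter> ball x r) (extend H F)" by (rule continuous_on_subset)
    then have "continuous (at x within X \<inter> ball x r) (extend H F)"
      using x r(1) by (simp add: continuous_on_eq_continuous_within)
    moreover have "at x within X = at x within X \<inter> ball x r"
      using r(1) by (intro at_within_nhd[of x "ball x r"]) auto
    ultimately show ?thesis by simp
  next
    case False
    then have "x \<in> bd" using x not_boundary_in_graph by blast
    then obtain n where n: "x \<in> E n" using E_Union by auto
    define K where "K = (\<Union>e\<in>S. edge_set e)"
    have "K \<subseteq> \<iota> ` points G len"
      using S edge_pt_in_points unfolding K_def edge_set_def by blast
    then have "x \<notin> K" using False by blast
    moreover have "closed K"
      unfolding K_def using S by (auto intro!: closed_UN compact_imp_closed compact_edge_set)
    ultimately obtain d where d: "0 < d" "ball x d \<inter> K = {}"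
      by (meson open_Compl ComplI open_contains_ball disjoint_eq_subset_Compl)
    define r where "r = min d r0"
    have same: "extend H F y = extend H F x" if y: "y \<in> X" "dist x y < r" for y
    proof -
      have yn: "y \<in> nbhd n" using n y by (auto simp: nbhd_iff r_def dist_commute)
      have "extend H F x = F $ n" using False n by (simp add: extend_off_graph step_fun_eq)
      moreover have "extend H F y = F $ n"
      proof (cases "y \<in> \<iota> ` points G len")
        case True
        then obtain q where q: "q \<in> points G len" "y = \<iota> q" by blast
        then obtain e t where e: "e \<in> arcs G" "t \<in> {0..len e}" "q = ep e t"
          using point_on_edge by blast
        have "e \<notin> S"
        proof
          assume "e \<in> S"
          moreover have "y \<in> edge_set e" using e q unfolding edge_set_def by blast
          ultimately have "y \<in> K" by (auto simp: K_def)
          then show False using y d by (auto simp: r_def)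
        qed
        then show ?thesis using const[of e t n] e q yn by simp
      next
        case f: False
        then have "y \<in> bd" using y not_boundary_in_graph by blast
        then obtain m where m: "y \<in> E m" using E_Union by auto
        then have "m = n" using nbhd_disjoint yn E_subset_nbhd by blast
        then show ?thesis using f m by (simp add: extend_off_graph step_fun_eq)
      qed
      ultimately show ?thesis by simp
    qed
    have "0 < r" using d r0_pos by (simp add: r_def)
    then show ?thesis
      unfolding continuous_within_eps_delta
      using same by (intro allI impI exI[of _ r]) (auto simp: dist_commute)
  qed
qed

section \<open>Vertex indicators and discrete boundary data\<close>

definition cell :: "'n \<Rightarrow> 'v \<Rightarrow> real" where
  "cell n v = (if v \<in> verts G \<and> \<iota> (Vertex v) \<in> nbhd n then 1 else 0)"

lemma grad_cell: "e \<in> arcs G \<Longrightarrow> e \<notin> far_arcs r0 \<Longrightarrow> grad (cell n) e = 0"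
  using near_edge[of e 0 "len e" n] near_edge[of e "len e" 0 n] len_pos[of e]
  by (auto simp: grad_def cell_def)

lemma fin_grad_cell: "fin_grad (cell n)"
  unfolding fin_grad_def using grad_cell finite_far_arcs[OF r0_pos]
  by (auto intro: finite_subset[of _ "far_arcs r0"])

lemma cell_eq: "v \<in> verts G \<Longrightarrow> \<iota> (Vertex v) \<in> nbhd n \<Longrightarrow> cell m v = (if m = n then 1 else 0)"
  using nbhd_disjoint by (auto simp: cell_def)

text \<open>A model of the boundary values on vertices: \<open>F $ n\<close> close to E(n), zero at
  vertices close to no member. It has finite gradient support and serves both as Dirichlet data and
  as start of the minimisation.\<close>

definition data :: "real ^ 'n \<Rightarrow> 'v \<Rightarrow> real" where
  "data F v = (\<Sum>n\<in>UNIV. F $ n * cell n v)"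

lemma data_eq: "v \<in> verts G \<Longrightarrow> \<iota> (Vertex v) \<in> nbhd n \<Longrightarrow> data F v = F $ n"
  by (simp add: data_def cell_eq if_distrib cong: if_cong)

lemma grad_data: "e \<in> arcs G \<Longrightarrow> e \<notin> far_arcs r0 \<Longrightarrow> grad (data F) e = 0"
  using grad_cell by (simp add: grad_def data_def)

lemma fin_grad_data: "fin_grad (data F)"
  unfolding fin_grad_def using grad_data finite_far_arcs[OF r0_pos]
  by (auto intro: finite_subset[of _ "far_arcs r0"])

definition linear_interp :: "('v \<Rightarrow> real) \<Rightarrow> ('v, 'e) gpoint \<Rightarrow> real" where
  "linear_interp g x = (case x of Vertex v \<Rightarrow> g v | Inner e t \<Rightarrow> g (tail G e) + grad g e * (t / len e))"

lemma linear_interp_edge: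
  "e \<in> arcs G \<Longrightarrow> t \<in> {0..len e} \<Longrightarrow> linear_interp g (ep e t) = g (tail G e) + grad g e * (t / len e)"
  using len_pos[of e] by (auto simp: linear_interp_def edge_pt_def grad_def)

text \<open>By local finiteness the altered vertices disturb finitely many edges. Off these and off
  \<open>far_arcs r0\<close>, an edge close to E(n) has the value \<open>F $ n\<close> at both ends,
  so the interpolant is constant on it.\<close>

lemma continuous_linear_interp:
  assumes "finite {v. g v \<noteq> data F v}"
  shows "continuous_on X (extend (linear_interp g) F)"
proof (rule continuous_extend)
  fix e assume e: "e \<in> arcs G"
  have "continuous_on {0..len e} (\<lambda>t. g (tail G e) + grad g e * (t / len e))"
    using len_pos[OF e] by (intro continuous_intros) auto
  then show "continuous_on {0..len e} (\<lambda>t. linear_interp g (ep e t))"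
    by (rule continuous_on_eq) (simp add: linear_interp_edge[OF e])
next
  define S where "S = far_arcs r0 \<union> (\<Union>v\<in>{v. g v \<noteq> data F v} \<inter> verts G. in_arcs G v \<union> out_arcs G v)"
  show "finite S" "S \<subseteq> arcs G"
    using assms locally_finite finite_far_arcs[OF r0_pos] far_arcs_subset by (auto simp: S_def)
  fix e t n assume e: "e \<in> arcs G" "e \<notin> S" "t \<in> {0..len e}" "\<iota> (ep e t) \<in> nbhd n"
  have "\<iota> (ep e 0) \<in> nbhd n" "\<iota> (ep e (len e)) \<in> nbhd n"
    using e len_pos[OF e(1)] by (auto intro!: near_edge[OF e(1) _ e(3) _ e(4)] simp: S_def simp del: edge_pt_0 edge_pt_len)
  then have "data F (tail G e) = F $ n" "data F (head G e) = F $ n" using e(1) data_eq by auto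
  moreover have "g (tail G e) = data F (tail G e)" "g (head G e) = data F (head G e)"
    using e(1,2) by (force simp: S_def)+
  ultimately show "linear_interp g (ep e t) = F $ n"
    using linear_interp_edge[OF e(1,3)] by (simp add: grad_def)
qed

end

section \<open>Harmonic extensions\<close>

lemma vector_derivative_affine:
  fixes h :: "real \<Rightarrow> real"
  assumes "\<And>t. t \<in> {0..l} \<Longrightarrow> h t = a + b * t" "0 < l" "s \<in> {0..l}"
  shows "vector_derivative h (at s within {0..l}) = b"
proof (rule vector_derivative_within_closed_interval)
  have "((\<lambda>t. a + b * t) has_vector_derivative b) (at s within {0..l})"
    by (auto intro!: derivative_eq_intros simp: has_real_derivative_iff_has_vector_derivative[symmetric])
  then show "(h has_vector_derivative b) (at s within {0..l})"
    by (rule has_vector_derivative_transform[rotated 2]) (use assms in auto)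
qed (use assms in auto)

context partitioned_completion
begin

definition vval :: "('c \<Rightarrow> real) \<Rightarrow> 'v \<Rightarrow> real" where
  "vval f v = f (\<iota> (Vertex v))"

definition edge_linear :: "('c \<Rightarrow> real) \<Rightarrow> 'e \<Rightarrow> bool" where
  "edge_linear f e \<longleftrightarrow> (\<exists>a b. \<forall>t\<in>{0..len e}. edge_fun G len \<iota> f e t = a + b * t)"

lemma edge_linear_eq:
  assumes "e \<in> arcs G" "edge_linear f e" "t \<in> {0..len e}"
  shows "edge_fun G len \<iota> f e t = vval f (tail G e) + grad (vval f) e / len e * t"
proof -
  obtain a b where ab: "\<forall>t\<in>{0..len e}. edge_fun G len \<iota> f e t = a + b * t"
    using assms(2) unfolding edge_linear_def by blast
  have l: "0 < len e" by (rule len_pos[OF assms(1)])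
  have "vval f (tail G e) = a" using ab[rule_format, of 0] l by (simp add: edge_fun_def vval_def)
  moreover have "vval f (head G e) = a + b * len e"
    using ab[rule_format, of "len e"] l assms(1) by (simp add: edge_fun_def vval_def)
  ultimately show ?thesis using ab assms(3) l by (simp add: grad_def)
qed

text \<open>The graph \<open>H\<close> shares \<open>tail\<close> and \<open>head\<close> with
  \<open>G\<close>, so that one computation covers the whole graph and its subgraphs.\<close>

lemma outward_flux_eq:
  assumes "arcs H \<subseteq> arcs G" "tail H = tail G" "head H = head G"
    and "\<And>e. e \<in> arcs H \<Longrightarrow> edge_linear f e"
  shows "outward_flux H len \<iota> f v =
    (\<Sum>e\<in>in_arcs H v. grad (vval f) e / len e) - (\<Sum>e\<in>out_arcs H v. grad (vval f) e / len e)"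
proof -
  have ef: "edge_fun H len \<iota> f = edge_fun G len \<iota> f"
    using assms(2,3) by (simp add: fun_eq_iff edge_fun_def edge_pt_def)
  have "vector_derivative (edge_fun G len \<iota> f e) (at s within {0..len e}) = grad (vval f) e / len e"
    if "e \<in> arcs H" "s \<in> {0..len e}" for e s
    using edge_linear_eq[of e f] assms(1,4) that len_pos[of e]
    by (intro vector_derivative_affine[where a = "vval f (tail G e)"]) auto
  moreover have "0 \<in> {0..len e}" "len e \<in> {0..len e}" if "e \<in> arcs H" for e
    using len_pos[of e] that assms(1) by auto
  ultimately show ?thesis
    unfolding outward_flux_def ef diff_conv_add_uminus sum_negf[symmetric]
    by (intro arg_cong2[of _ _ _ _ plus] sum.cong refl) auto
qed

lemma outward_flux_dform:
  assumes "v \<in> verts G" "\<And>e. e \<in> arcs G \<Longrightarrow> edge_linear f e"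
  shows "outward_flux G len \<iota> f v = dform (vval f) (\<delta> v)"
  using outward_flux_eq[of G f v] assms by (simp add: dform_delta)

lemma linear_interp_diff_le:
  assumes "\<And>v. \<bar>g v - h v\<bar> \<le> k" "p \<in> points G len"
  shows "\<bar>linear_interp g p - linear_interp h p\<bar> \<le> k"
  using assms(2)
proof (cases rule: points_cases)
  case (Inner e t)
  define s where "s = t / len e"
  have s: "0 \<le> s" "s \<le> 1" using Inner by (auto simp: s_def)
  define x y where "x = g (tail G e) - h (tail G e)" and "y = g (head G e) - h (head G e)"
  have "linear_interp g p - linear_interp h p = (1 - s) * x + s * y"
    using Inner by (simp add: linear_interp_def grad_def x_def y_def s_def algebra_simps)
  also have "\<bar>\<dots>\<bar> \<le> (1 - s) * \<bar>x\<bar> + s * \<bar>y\<bar>"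
    using s abs_triangle_ineq[of "(1 - s) * x" "s * y"] by (simp add: abs_mult)
  also have "\<dots> \<le> (1 - s) * k + s * k"
    using s assms(1) unfolding x_def y_def by (intro add_mono mult_left_mono) auto
  finally show ?thesis by (simp add: algebra_simps)
qed (use assms in \<open>simp add: linear_interp_def\<close>)

text \<open>With \<open>I\<close> all non-leaf vertices this gives the harmonic extension, with
  \<open>I\<close> the interior of a subgraph the approximating one. Interpolants of the
  approximants are continuous, differ from the limit on the graph by no more than their vertex
  values do, and coincide with it off the graph; hence the convergence is uniform on
  \<open>X\<close>.\<close>

lemma dirichlet_extension:
  assumes "I \<subseteq> verts G - leaves G"
  shows "\<exists>f. continuous_on X f \<and> (\<forall>x\<in>bd. f x = step_fun E F x) \<and> (\<forall>e\<in>arcs G. edge_linear f e) \<and>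
    (\<forall>v\<in>verts G - I. vval f v = data F v) \<and> (\<forall>v\<in>I. dform (vval f) (\<delta> v) = 0)"
proof -
  obtain R where R: "\<And>v w. v \<in> verts G \<Longrightarrow> w \<in> verts G \<Longrightarrow> gdist G len (Vertex v) (Vertex w) < R"
    using gdist_bounded by blast
  show ?thesis
  proof (rule dirichlet_problem[of "data F" I R])
    show "I \<subseteq> verts G" using assms by blast
  next
    fix u g
    assume g: "\<And>k. finite {v. g k v \<noteq> data F v}"
      and u: "\<And>v. v \<notin> I \<Longrightarrow> u v = data F v" "uniform_limit UNIV g u sequentially"
        "\<And>v. v \<in> I \<Longrightarrow> dform u (\<delta> v) = 0"
  define f where "f = extend (linear_interp u) F"
  have vval: "vval f v = u v" if "v \<in> verts G" for v
    using that by (simp add: vval_def f_def linear_interp_def)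
  have "uniform_limit X (\<lambda>k. extend (linear_interp (g k)) F) f sequentially"
    unfolding uniform_limit_iff
  proof (intro allI impI)
    fix e :: real assume e: "0 < e"
    have "\<forall>\<^sub>F k in sequentially. \<forall>v. dist (g k v) (u v) < e / 2"
      using u(2)[unfolded uniform_limit_iff, rule_format, of "e / 2"] e by simp
    then show "\<forall>\<^sub>F k in sequentially. \<forall>x\<in>X. dist (extend (linear_interp (g k)) F x) (f x) < e"
    proof eventually_elim
      case (elim k)
      show ?case
      proof
        fix x assume "x \<in> X"
        show "dist (extend (linear_interp (g k)) F x) (f x) < e"
        proof (cases "x \<in> \<iota> ` points G len")
          case True
          then obtain p where p: "p \<in> points G len" "x = \<iota> p" by blast
          have "\<bar>linear_interp (g k) p - linear_interp u p\<bar> \<le> e / 2"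
            using elim by (intro linear_interp_diff_le p) (simp add: dist_real_def less_imp_le)
          then show ?thesis using p e by (simp add: f_def dist_real_def)
        qed (use e in \<open>simp add: f_def extend_off_graph\<close>)
      qed
    qed
  qed
  moreover have "continuous_on X (extend (linear_interp (g k)) F)" for k
    by (rule continuous_linear_interp[OF g])
  ultimately have cont: "continuous_on X f"
    by (intro uniform_limit_theorem[where F = sequentially and f = "\<lambda>k. extend (linear_interp (g k)) F"]) auto
  have bdry: "f x = step_fun E F x" if xb: "x \<in> bd" for x
    using xb
  proof (cases rule: boundary_cases)
    case (1 v)
    obtain n where n: "x \<in> E n" using xb E_Union by auto
    have v: "v \<in> verts G" using 1 by (simp add: leaves_def)
    have "f x = data F v" using vval[OF v] u(1)[of v] 1 assms by (auto simp: vval_def)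
    also have "\<dots> = F $ n" using v E_subset_nbhd[OF n] 1 by (intro data_eq) auto
    finally show ?thesis using step_fun_eq[OF n] by simp
  qed (simp add: f_def extend_off_graph)
  have lin: "edge_linear f e" if "e \<in> arcs G" for e
    unfolding edge_linear_def
    using that linear_interp_edge[OF that]
    by (intro exI[of _ "u (tail G e)"] exI[of _ "grad u e / len e"])
      (simp add: f_def edge_fun_extend)
  have "grad (vval f) e = grad u e" if "e \<in> arcs G" for e
    using that by (simp add: grad_def vval)
  then have "dform (vval f) h = dform u h" for h
    unfolding dform_def by (intro sum.cong) auto
  then show ?thesis
    using cont bdry lin vval u assms by (intro exI[of _ f]) auto
  qed (use R fin_grad_data interior_not_everything[OF assms] in auto)
qed

lemma harmonic_extension_iff:
  "harmonic_extension G len X \<iota> (step_fun E F) f \<longleftrightarrow>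
     continuous_on X f \<and> (\<forall>x\<in>bd. f x = step_fun E F x) \<and> (\<forall>e\<in>arcs G. edge_linear f e) \<and>
     (\<forall>v\<in>verts G - leaves G. dform (vval f) (\<delta> v) = 0)"
  unfolding harmonic_extension_def harmonic_at_def edge_linear_def[symmetric]
  using outward_flux_dform by auto

lemma harmonic_extension_exists:
  "\<exists>f. harmonic_extension G len X \<iota> (step_fun E F) f"
  unfolding harmonic_extension_iff using dirichlet_extension[OF order_refl, of F] by blast

lemma near_boundary_value:
  assumes "continuous_on X h" "\<And>x. x \<in> bd \<Longrightarrow> h x = step_fun E F x" "0 < k"
  obtains \<eta> where "0 < \<eta>" "\<eta> \<le> r0"
    "\<And>x y n. x \<in> X \<Longrightarrow> y \<in> E n \<Longrightarrow> dist x y < \<eta> \<Longrightarrow> \<bar>h x - F $ n\<bar> < k"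
proof -
  have "uniformly_continuous_on X h" using assms(1) compact_X compact_uniformly_continuous by blast
  then obtain d where d: "0 < d" "\<forall>y\<in>X. \<forall>x\<in>X. dist x y < d \<longrightarrow> dist (h x) (h y) < k"
    unfolding uniformly_continuous_on_def using assms(3) by blast
  have "\<bar>h x - F $ n\<bar> < k" if x: "x \<in> X" "y \<in> E n" "dist x y < min d r0" for x y n
  proof -
    have "y \<in> bd" using x E_boundary by blast
    then have "dist (h x) (h y) < k"
      using d(2) x boundary_subset by auto
    moreover have "h y = F $ n" using assms(2)[OF \<open>y \<in> bd\<close>] step_fun_eq[OF x(2)] by simp
    ultimately show ?thesis by (simp add: dist_real_def)
  qed
  then show thesis using that[of "min d r0"] d(1) r0_pos by simp
qed

end

section \<open>Cutoff functions\<close>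

lemma deriv_affine_iterated:
  fixes s :: "real \<Rightarrow> real"
  assumes "\<And>k t. (deriv ^^ k) s field_differentiable at t"
  shows "(deriv ^^ k) (\<lambda>t. \<alpha> + \<beta> * s t) = (\<lambda>t. (if k = 0 then \<alpha> else 0) + \<beta> * (deriv ^^ k) s t)"
proof (induction k)
  case (Suc k)
  have "deriv (\<lambda>t. c + \<beta> * (deriv ^^ k) s t) t = \<beta> * deriv ((deriv ^^ k) s) t" for c t
    using DERIV_deriv_iff_field_differentiable[THEN iffD2, OF assms[of k t]]
    by (intro DERIV_imp_deriv) (auto intro!: derivative_eq_intros)
  then show ?case by (simp add: Suc)
qed simp

text \<open>An antiderivative of \<open>(a + b * t) * \<phi>''\<close> is
  \<open>(a + b * t) * \<phi>' - b * \<phi>\<close>; the first term drops out at both ends because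
  \<phi> is flat there.\<close>

lemma integral_affine_second_derivative:
  fixes \<phi> :: "real \<Rightarrow> real"
  assumes l: "0 < l" and cont: "continuous_on {0..l} \<phi>"
    and d1: "\<And>t. t \<in> {0<..<l} \<Longrightarrow> \<phi> field_differentiable (at t)"
    and d2: "\<And>t. t \<in> {0<..<l} \<Longrightarrow> deriv \<phi> field_differentiable (at t)"
    and flat: "0 < \<eta>" "\<And>t. t \<in> {0<..<l} \<Longrightarrow> t < \<eta> \<or> l - \<eta> < t \<Longrightarrow> deriv \<phi> t = 0"
    and f: "\<And>t. t \<in> {0..l} \<Longrightarrow> f t = a + b * t"
  shows "integral {0..l} (\<lambda>t. f t * (deriv ^^ 2) \<phi> t) = - b * (\<phi> l - \<phi> 0)"
proof -
  \<comment> \<open>Nothing is assumed about \<open>deriv \<phi>\<close> at the end points; the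
    value 0 there extends it continuously, by flatness.\<close>
  define p where "p t = (if t \<in> {0<..<l} then deriv \<phi> t else 0)" for t
  define \<Phi> where "\<Phi> t = (a + b * t) * p t - b * \<phi> t" for t
  have ev: "\<forall>\<^sub>F x in nhds t. p x = deriv \<phi> x" if "t \<in> {0<..<l}" for t
    by (rule eventually_mono[OF eventually_nhds_in_open[of "{0<..<l}" t]]) (use that in \<open>auto simp: p_def\<close>)
  have dp: "(p has_real_derivative deriv (deriv \<phi>) t) (at t)" if "t \<in> {0<..<l}" for t
    using DERIV_cong_ev[OF refl ev[OF that] refl, THEN iffD2]
      DERIV_deriv_iff_field_differentiable[THEN iffD2, OF d2[OF that]] by blast
  have contp: "continuous_on {0..l} p"
    unfolding continuous_on_eq_continuous_within
  proof
    fix t assume t: "t \<in> {0..l}"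
    show "continuous (at t within {0..l}) p"
    proof (cases "t \<in> {0<..<l}")
      case True
      then show ?thesis using DERIV_isCont[OF dp] continuous_at_imp_continuous_at_within by blast
    next
      case False
      then have t0: "t = 0 \<or> t = l" using t by auto
      have "p x = 0" if "x \<in> {0..l}" "dist x t < \<eta>" for x
        using that flat(2)[of x] t0 by (auto simp: p_def dist_real_def)
      moreover have "p t = 0" using False unfolding p_def by (rule if_not_P)
      ultimately show ?thesis
        unfolding continuous_within_eps_delta using flat(1) by (metis dist_self)
    qed
  qed
  have "((\<lambda>t. (a + b * t) * deriv (deriv \<phi>) t) has_integral (\<Phi> l - \<Phi> 0)) {0..l}"
  proof (rule fundamental_theorem_of_calculus_interior)
    show "continuous_on {0..l} \<Phi>"
      unfolding \<Phi>_def by (intro continuous_intros contp cont)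
    fix t assume t: "t \<in> {0<..<l}"
    have "(\<phi> has_real_derivative p t) (at t)"
      using DERIV_deriv_iff_field_differentiable[THEN iffD2, OF d1[OF t]] t by (simp add: p_def)
    then have "(\<Phi> has_real_derivative (a + b * t) * deriv (deriv \<phi>) t) (at t)"
      unfolding \<Phi>_def using dp[OF t] by (auto intro!: derivative_eq_intros)
    then show "(\<Phi> has_vector_derivative (a + b * t) * deriv (deriv \<phi>) t) (at t)"
      by (simp add: has_real_derivative_iff_has_vector_derivative)
  qed (use l in simp)
  then have "integral {0..l} (\<lambda>t. (a + b * t) * deriv (deriv \<phi>) t) = - b * (\<phi> l - \<phi> 0)"
    by (simp add: integral_unique \<Phi>_def p_def algebra_simps)
  moreover have "integral {0..l} (\<lambda>t. f t * (deriv ^^ 2) \<phi> t) = integral {0..l} (\<lambda>t. (a + b * t) * deriv (deriv \<phi>) t)"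
    by (intro integral_cong) (simp add: f numeral_2_eq_2)
  ultimately show ?thesis by simp
qed

context partitioned_completion
begin

text \<open>The indicator \<open>cell n\<close> is interpolated along each edge by a smooth step.
  Its differences vanish off the finite set \<open>far_arcs r0\<close>, and the flat outer thirds
  give the vanishing derivative near every vertex.\<close>

lemma cutoff_exists: "\<exists>\<phi>. cutoff G len X \<iota> (E n) \<phi>"
proof -
  have "\<forall>e\<in>arcs G. \<exists>s. (\<forall>t. t \<le> len e / 3 \<longrightarrow> s t = 0) \<and> (\<forall>t. 2 * len e / 3 \<le> t \<longrightarrow> s t = 1) \<and>
      (\<forall>k t. (deriv ^^ k) s field_differentiable at (t :: real))"
  proof
    fix e assume "e \<in> arcs G"
    from len_pos[OF this] show "\<exists>s. (\<forall>t. t \<le> len e / 3 \<longrightarrow> s t = 0) \<and> (\<forall>t. 2 * len e / 3 \<le> t \<longrightarrow> s t = 1) \<and>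
      (\<forall>k t. (deriv ^^ k) s field_differentiable at (t :: real))"
      by (rule smooth_step) blast
  qed
  from bchoice[OF this] obtain s where "\<forall>e\<in>arcs G. (\<forall>t. t \<le> len e / 3 \<longrightarrow> s e t = 0) \<and>
      (\<forall>t. 2 * len e / 3 \<le> t \<longrightarrow> s e t = 1) \<and>
      (\<forall>k t. (deriv ^^ k) (s e) field_differentiable at (t :: real))" by (elim exE) (rule that)
  then have s0: "t \<le> len e / 3 \<Longrightarrow> s e t = 0" and s1: "2 * len e / 3 \<le> t \<Longrightarrow> s e t = 1"
    and sd: "(deriv ^^ k) (s e) field_differentiable at t" if "e \<in> arcs G" for e k t
    using that by auto
  define g where "g = cell n"
  define H where "H x = (case x of Vertex v \<Rightarrow> g v | Inner e t \<Rightarrow> g (tail G e) + grad g e * s e t)" for x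
  have H: "H (ep e t) = g (tail G e) + grad g e * s e t" if e: "e \<in> arcs G" for e t
    using len_pos[OF e] s0[OF e, of t] s1[OF e, of t]
    by (auto simp: H_def edge_pt_def grad_def)
  \<comment> \<open>\<open>axis n 1\<close> selects the characteristic function of E(n) for the
    points off the graph.\<close>
  define \<phi> where "\<phi> = extend H (axis n 1)"
  have ef: "edge_fun G len \<iota> \<phi> e = (\<lambda>t. g (tail G e) + grad g e * s e t)" if "e \<in> arcs G" for e
    using that by (simp add: fun_eq_iff \<phi>_def edge_fun_extend H)
  have d: "deriv (edge_fun G len \<iota> \<phi> e) t = grad g e * deriv (s e) t" if "e \<in> arcs G" for e t
    using fun_cong[OF deriv_affine_iterated[OF sd[OF that], where k = 1], of "g (tail G e)" "grad g e" t] that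
    by (simp add: ef)
  have ds: "deriv (s e) t = 0" if e: "e \<in> arcs G" "t < len e / 3 \<or> 2 * len e / 3 < t" for e t
  proof -
    have "\<exists>c. \<forall>\<^sub>F x in nhds t. s e x = c"
      using e(2)
    proof
      assume "t < len e / 3"
      then show ?thesis using s0[OF e(1)]
        by (intro exI[of _ 0] eventually_mono[OF eventually_nhds_in_open[of "{..<len e / 3}" t]]) auto
    next
      assume "2 * len e / 3 < t"
      then show ?thesis using s1[OF e(1)]
        by (intro exI[of _ 1] eventually_mono[OF eventually_nhds_in_open[of "{2 * len e / 3<..}" t]]) auto
    qed
    then obtain c where "\<forall>\<^sub>F x in nhds t. s e x = c" by blast
    then have "(s e has_real_derivative 0) (at t)"
      using DERIV_cong_ev[of t t "s e" "\<lambda>_. c" 0 0] by simp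
    then show ?thesis by (rule DERIV_imp_deriv)
  qed
  have cont: "continuous_on X \<phi>"
    unfolding \<phi>_def
  proof (rule continuous_extend[OF _ finite_far_arcs[OF r0_pos] far_arcs_subset])
    fix e assume e: "e \<in> arcs G"
    have "continuous_on {0..len e} (s e)"
      using sd[OF e, of 0] field_differentiable_imp_continuous_at continuous_at_imp_continuous_on
      by (metis funpow_0)
    then show "continuous_on {0..len e} (\<lambda>t. H (ep e t))"
      unfolding H[OF e] by (intro continuous_intros)
  next
    fix e t m assume e: "e \<in> arcs G" "e \<notin> far_arcs r0" "t \<in> {0..len e}" "\<iota> (ep e t) \<in> nbhd m"
    then have "\<iota> (ep e 0) \<in> nbhd m" using near_edge[of e t 0 m] len_pos[of e] by auto
    then have "g (tail G e) = axis n 1 $ m" using e(1) by (simp add: g_def cell_eq axis_def)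
    then show "H (ep e t) = axis n 1 $ m" using H[OF e(1)] grad_cell[OF e(1,2)] by (simp add: g_def)
  qed
  have smooth: "(deriv ^^ k) (edge_fun G len \<iota> \<phi> e) field_differentiable (at t)" if "e \<in> arcs G" for e k t
    unfolding ef[OF that] deriv_affine_iterated[OF sd[OF that]]
    using sd[OF that, of k t] unfolding field_differentiable_def
    by (auto intro!: derivative_eq_intros)
  have flat: "deriv (edge_fun G len \<iota> \<phi> e) t = 0" if "e \<in> arcs G - far_arcs r0" for e t
    using that d grad_cell by (simp add: g_def)
  have vertex_flat: "\<exists>U. openin (top_of_set X) U \<and> \<iota> (Vertex v) \<in> U \<and>
      (\<forall>e\<in>arcs G. \<forall>t\<in>{0<..<len e}. \<iota> (Inner e t) \<in> U \<longrightarrow> deriv (edge_fun G len \<iota> \<phi> e) t = 0)"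
    if v: "v \<in> verts G" for v
  proof -
    obtain r where r: "0 < r" "\<And>e. e \<in> in_arcs G v \<union> out_arcs G v \<Longrightarrow> 3 * r \<le> len e"
      using star_radius[OF v] by blast
    have "deriv (edge_fun G len \<iota> \<phi> e) t = 0"
      if e: "e \<in> arcs G" "t \<in> {0<..<len e}" "\<iota> (Inner e t) \<in> ball (\<iota> (Vertex v)) r" for e t
    proof -
      have p: "Inner e t \<in> points G len" using e by (auto simp: points_def)
      have "r \<le> len e" if "e \<in> in_arcs G v \<union> out_arcs G v" for e using r(2)[OF that] r(1) by simp
      moreover have "gdist G len (Vertex v) (Inner e t) < r"
        using e(3) embedding_isometry[OF vertex_in_points[OF v] p] by simp
      ultimately have "tail G e = v \<and> t < r \<or> head G e = v \<and> len e - t < r"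
        using gdist_Vertex_less[OF v r(1) _ p] by auto
      then have "t < len e / 3 \<or> 2 * len e / 3 < t"
        using r(2)[of e] e(1) by auto
      then show ?thesis using d ds e(1) by simp
    qed
    moreover have "\<iota> (Vertex v) \<in> X" using embedding_into vertex_in_points[OF v] by blast
    ultimately show ?thesis using r(1) by (intro exI[of _ "X \<inter> ball (\<iota> (Vertex v)) r"]) auto
  qed
  have "\<phi> \<in> test_algebra G len X \<iota>"
    unfolding test_algebra_def mem_Collect_eq
    using finite_far_arcs[OF r0_pos] far_arcs_subset[of r0] smooth flat vertex_flat
    by (intro conjI cont exI[of _ "far_arcs r0"]) simp_all
  moreover have val: "\<phi> x = (if m = n then 1 else 0)" if x: "x \<in> E m" for x m
  proof (cases rule: boundary_cases[OF E_boundary[OF x]])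
    case (1 v)
    then have "v \<in> verts G" by (simp add: leaves_def)
    then show ?thesis using 1 E_subset_nbhd[OF x] cell_eq[of v m n]
      by (auto simp: \<phi>_def H_def g_def)
  next
    case 2
    then show ?thesis using step_fun_eq[OF x] by (simp add: \<phi>_def extend_off_graph axis_def)
  qed
  have "\<phi> x = 0" if x: "x \<in> bd - E n" for x
  proof -
    obtain m where "x \<in> E m" "m \<noteq> n" using x E_Union by blast
    then show ?thesis using val by simp
  qed
  ultimately show ?thesis unfolding cutoff_def using val by (intro exI[of _ \<phi>]) simp
qed

end

section \<open>The Dirichlet to Neumann map as a Dirichlet form\<close>

context partitioned_completion
begin

text \<open>\<open>u\<close> tends to zero at the boundary but need not have finite support, so
  Green's identity is applied to truncations. Their gradients all live on the finite gradient
  support of \<open>u\<close>, so pointwise convergence suffices in the limit.\<close>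

lemma dform_vanishing_test:
  assumes harm: "\<And>v. v \<in> verts G - leaves G \<Longrightarrow> dform f (\<delta> v) = 0"
    and u: "fin_grad u" "\<And>v. v \<in> leaves G \<Longrightarrow> u v = 0"
    and fin: "\<And>k. 0 < k \<Longrightarrow> finite {v \<in> verts G. k \<le> \<bar>u v\<bar>}"
  shows "dform f u = 0"
proof -
  \<comment> \<open>Soft thresholding makes \<open>u\<close> finitely supported without creating new edges of nonzero gradient.\<close>
  define c where "c j v = u v - max (- inverse (real (Suc j))) (min (inverse (real (Suc j))) (u v))" for j v
  have lim: "(\<lambda>j. c j v) \<longlonglongrightarrow> u v" for v
  proof (rule Lim_transform_bound[where g = "\<lambda>j. inverse (real (Suc j))" and f = "\<lambda>j. c j v - u v", THEN LIM_zero_cancel])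
    show "\<forall>\<^sub>F j in sequentially. norm (c j v - u v) \<le> norm (inverse (real (Suc j)))"
      by (rule always_eventually) (auto simp: c_def max_def min_def)
  qed (rule LIMSEQ_inverse_real_of_nat)
  define S where "S = {e \<in> arcs G. grad u e \<noteq> 0}"
  have S: "finite S" "S \<subseteq> arcs G" using u(1) by (auto simp: S_def fin_grad_def)
  have zero: "dform f (c j) = 0" for j
  proof -
    define I where "I = {v \<in> verts G. c j v \<noteq> 0}"
    have "I \<subseteq> {v \<in> verts G. inverse (real (Suc j)) \<le> \<bar>u v\<bar>}"
      by (auto simp: I_def c_def max_def min_def split: if_splits)
    then have "finite I" using fin[of "inverse (real (Suc j))"] finite_subset by auto
    then have "dform f (c j) = (\<Sum>v\<in>I. c j v * dform f (\<delta> v))"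
      by (rule dform_green) (auto simp: I_def)
    also have "\<dots> = 0"
    proof (rule sum.neutral, rule ballI)
      fix v assume v: "v \<in> I"
      have "v \<notin> leaves G"
      proof
        assume "v \<in> leaves G"
        then have "c j v = 0" using u(2) by (simp add: c_def)
        then show False using v by (simp add: I_def)
      qed
      then show "c j v * dform f (\<delta> v) = 0" using harm v by (simp add: I_def)
    qed
    finally show ?thesis .
  qed
  have "dform f (c j) = (\<Sum>e\<in>S. grad f e * grad (c j) e / len e)" for j
    using S by (rule dform_eq_sum) (auto simp: S_def grad_def c_def)
  then have "(\<Sum>e\<in>S. grad f e * grad (c j) e / len e) = 0" for j using zero by simp
  moreover have "(\<lambda>j. \<Sum>e\<in>S. grad f e * grad (c j) e / len e) \<longlonglongrightarrow> (\<Sum>e\<in>S. grad f e * grad u e / len e)"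
    unfolding grad_def divide_inverse by (intro tendsto_intros lim)
  ultimately have "(\<Sum>e\<in>S. grad f e * grad u e / len e) = 0" by (simp add: LIMSEQ_const_iff)
  moreover have "dform f u = (\<Sum>e\<in>S. grad f e * grad u e / len e)"
    using S by (rule dform_eq_sum) (auto simp: S_def)
  ultimately show ?thesis by simp
qed

text \<open>Flatness is required on a neighbourhood in the completion; parameters close to an end
  lie in it because distances are at most parameter differences.\<close>

lemma test_algebra_flat_ends:
  assumes "\<phi> \<in> test_algebra G len X \<iota>" "e \<in> arcs G"
  obtains \<eta> where "0 < \<eta>"
    "\<And>t. t \<in> {0<..<len e} \<Longrightarrow> t < \<eta> \<or> len e - \<eta> < t \<Longrightarrow> deriv (edge_fun G len \<iota> \<phi> e) t = 0"
proof -
  have end_flat: "\<exists>\<eta>>0. \<forall>t\<in>{0<..<len e}. \<bar>t - s\<bar> < \<eta> \<longrightarrow> deriv (edge_fun G len \<iota> \<phi> e) t = 0"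
    if s: "s \<in> {0..len e}" "ep e s = Vertex v" "v \<in> verts G" for s v
  proof -
    from assms(1) s(3) obtain U where U: "openin (top_of_set X) U" "\<iota> (Vertex v) \<in> U"
      "\<forall>e\<in>arcs G. \<forall>t\<in>{0<..<len e}. \<iota> (Inner e t) \<in> U \<longrightarrow> deriv (edge_fun G len \<iota> \<phi> e) t = 0"
      unfolding test_algebra_def mem_Collect_eq by meson
    obtain \<eta> where \<eta>: "0 < \<eta>" "ball (\<iota> (Vertex v)) \<eta> \<inter> X \<subseteq> U"
      using U(1,2) unfolding openin_contains_ball by meson
    have "deriv (edge_fun G len \<iota> \<phi> e) t = 0" if t: "t \<in> {0<..<len e}" "\<bar>t - s\<bar> < \<eta>" for t
    proof -
      have p: "ep e t = Inner e t" using t by (simp add: edge_pt_Inner)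
      have "gdist G len (ep e s) (ep e t) \<le> \<bar>t - s\<bar>" using gdist_edge_le[OF assms(2) s(1)] t by auto
      then have "dist (\<iota> (Vertex v)) (\<iota> (Inner e t)) < \<eta>"
        using embedding_isometry[OF edge_pt_in_points[OF assms(2), of s] edge_pt_in_points[OF assms(2), of t]]
          t(2) s(2) p by simp
      moreover have "\<iota> (Inner e t) \<in> X"
        using edge_pt_in_points[OF assms(2), of t] p embedding_into by auto
      ultimately have "\<iota> (Inner e t) \<in> U" using \<eta>(2) by auto
      then show ?thesis using U(3) assms(2) t(1) by blast
    qed
    then show ?thesis using \<eta>(1) by blast
  qed
  have l: "0 < len e" by (rule len_pos[OF assms(2)])
  obtain \<eta>1 where 1: "0 < \<eta>1" "\<forall>t\<in>{0<..<len e}. \<bar>t - 0\<bar> < \<eta>1 \<longrightarrow> deriv (edge_fun G len \<iota> \<phi> e) t = 0"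
    using end_flat[of 0 "tail G e"] l assms(2) by auto
  obtain \<eta>2 where 2: "0 < \<eta>2" "\<forall>t\<in>{0<..<len e}. \<bar>t - len e\<bar> < \<eta>2 \<longrightarrow> deriv (edge_fun G len \<iota> \<phi> e) t = 0"
    using end_flat[of "len e" "head G e"] l assms(2) by auto
  have "deriv (edge_fun G len \<iota> \<phi> e) t = 0"
    if "t \<in> {0<..<len e}" "t < min \<eta>1 \<eta>2 \<or> len e - min \<eta>1 \<eta>2 < t" for t
  proof -
    have "\<bar>t - 0\<bar> < \<eta>1 \<or> \<bar>t - len e\<bar> < \<eta>2" using that by auto
    then show ?thesis using 1 2 that(1) by blast
  qed
  then show thesis using 1 2 that[of "min \<eta>1 \<eta>2"] by simp
qed

lemma
  assumes \<phi>: "\<phi> \<in> test_algebra G len X \<iota>"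
  shows fin_grad_test: "fin_grad (vval \<phi>)"
    and graph_integral_test: "(\<And>e. e \<in> arcs G \<Longrightarrow> edge_linear f e) \<Longrightarrow>
      graph_integral G len (\<lambda>e t. edge_fun G len \<iota> f e t * (deriv ^^ 2) (edge_fun G len \<iota> \<phi> e) t) =
      - dform (vval f) (vval \<phi>)"
proof -
  let ?\<phi> = "edge_fun G len \<iota> \<phi>"
  have cont: "continuous_on {0..len e} (?\<phi> e)" if e: "e \<in> arcs G" for e
  proof -
    have "continuous_on X \<phi>" using \<phi> by (simp add: test_algebra_def)
    then have "continuous_on {0..len e} (\<lambda>t. \<phi> (\<iota> (ep e t)))"
      using embedding_edge_continuous[OF e] edge_set_subset[OF e] unfolding edge_set_def
      by (rule continuous_on_compose2)
    then show ?thesis by (simp add: edge_fun_def[abs_def])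
  qed
  have diff: "(deriv ^^ k) (?\<phi> e) field_differentiable (at t)" if "e \<in> arcs G" "t \<in> {0<..<len e}" for e t k
    using \<phi> that unfolding test_algebra_def by blast
  have ends: "?\<phi> e 0 = vval \<phi> (tail G e)" "?\<phi> e (len e) = vval \<phi> (head G e)" if "e \<in> arcs G" for e
    using that by (simp_all add: edge_fun_def vval_def)
  obtain S where S: "finite S" "S \<subseteq> arcs G" "\<forall>e\<in>arcs G - S. \<forall>t\<in>{0<..<len e}. deriv (?\<phi> e) t = 0"
    using \<phi> unfolding test_algebra_def mem_Collect_eq by meson
  have "grad (vval \<phi>) e = 0" if e: "e \<in> arcs G" "e \<notin> S" for e
  proof -
    have "?\<phi> e (len e) = ?\<phi> e 0"
    proof (rule DERIV_isconst_end[OF len_pos[OF e(1)] cont[OF e(1)]])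
      fix t assume "0 < t" "t < len e"
      then show "(?\<phi> e has_real_derivative 0) (at t)"
        using diff[OF e(1), of t 0] S(3) e DERIV_deriv_iff_field_differentiable[of "?\<phi> e" t] by auto
    qed
    then show ?thesis using ends[OF e(1)] by (simp add: grad_def)
  qed
  then have "{e \<in> arcs G. grad (vval \<phi>) e \<noteq> 0} \<subseteq> S" by blast
  then show fg: "fin_grad (vval \<phi>)" unfolding fin_grad_def using S(1) finite_subset by blast
  assume lin: "\<And>e. e \<in> arcs G \<Longrightarrow> edge_linear f e"
  have int: "integral {0..len e} (\<lambda>t. edge_fun G len \<iota> f e t * (deriv ^^ 2) (?\<phi> e) t) =
      - (grad (vval f) e * grad (vval \<phi>) e / len e)" if e: "e \<in> arcs G" for e
  proof -
    obtain \<eta> where \<eta>: "0 < \<eta>" "\<And>t. t \<in> {0<..<len e} \<Longrightarrow> t < \<eta> \<or> len e - \<eta> < t \<Longrightarrow> deriv (?\<phi> e) t = 0"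
      using test_algebra_flat_ends[OF \<phi> e] by blast
    have "integral {0..len e} (\<lambda>t. edge_fun G len \<iota> f e t * (deriv ^^ 2) (?\<phi> e) t) =
        - (grad (vval f) e / len e) * (?\<phi> e (len e) - ?\<phi> e 0)"
    proof (rule integral_affine_second_derivative[OF len_pos[OF e] cont[OF e] _ _ \<eta>])
      show "?\<phi> e field_differentiable (at t)" if "t \<in> {0<..<len e}" for t
        using diff[OF e that, of 0] by simp
      show "deriv (?\<phi> e) field_differentiable (at t)" if "t \<in> {0<..<len e}" for t
        using diff[OF e that, of 1] by simp
      show "edge_fun G len \<iota> f e t = vval f (tail G e) + grad (vval f) e / len e * t" if "t \<in> {0..len e}" for t
        by (rule edge_linear_eq[OF e lin[OF e] that])
    qed
    then show ?thesis using ends[OF e] by (simp add: grad_def[of "vval \<phi>"])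
  qed
  \<comment> \<open>An edge on which \<phi> varies but has equal end values contributes 0, as
    \<open>f\<close> is affine there; only the support of the gradient remains.\<close>
  have "graph_integral G len (\<lambda>e t. edge_fun G len \<iota> f e t * (deriv ^^ 2) (?\<phi> e) t) =
      (\<Sum>\<^sub>\<infinity>e\<in>{e \<in> arcs G. grad (vval \<phi>) e \<noteq> 0}. - (grad (vval f) e * grad (vval \<phi>) e / len e))"
    unfolding graph_integral_def by (rule infsum_cong_neutral) (auto simp: int)
  also have "\<dots> = (\<Sum>e | e \<in> arcs G \<and> grad (vval \<phi>) e \<noteq> 0. - (grad (vval f) e * grad (vval \<phi>) e / len e))"
    using fg by (intro infsum_finite) (simp add: fin_grad_def)
  finally show "graph_integral G len (\<lambda>e t. edge_fun G len \<iota> f e t * (deriv ^^ 2) (?\<phi> e) t) =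
      - dform (vval f) (vval \<phi>)" by (simp add: dform_def sum_negf)
qed

lemma finite_vertices_far: "0 < \<eta> \<Longrightarrow> finite {v \<in> verts G. \<eta> \<le> infdist (\<iota> (Vertex v)) bd}"
proof -
  assume \<eta>: "0 < \<eta>"
  have "{x \<in> X. \<eta> \<le> infdist x bd} \<subseteq> \<iota> ` points G len"
    using not_boundary_in_graph \<eta> by fastforce
  from compact_meets_finitely_many(2)[OF compact_far[OF \<eta>] this]
  show ?thesis
    by (rule finite_subset[rotated]) (use embedding_into in \<open>auto simp: image_subset_iff\<close>)
qed

text \<open>On vertices, a cutoff function differs from \<^term>\<open>cell n\<close> by a function that tends to zero
  at the boundary; harmonic functions are orthogonal to such differences.\<close>

lemma dform_cutoff:
  assumes f: "harmonic_extension G len X \<iota> (step_fun E F) f" and \<phi>: "cutoff G len X \<iota> (E n) \<phi>"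
  shows "dform (vval f) (vval \<phi>) = dform (vval f) (cell n)"
proof -
  have \<phi>A: "\<phi> \<in> test_algebra G len X \<iota>" using \<phi> by (simp add: cutoff_def)
  have val: "\<phi> y = axis n 1 $ m" if "y \<in> E m" for y m
    using \<phi> E_boundary[OF that] E_disjoint[OF that, of n] that by (auto simp: cutoff_def axis_def)
  have step: "\<phi> x = step_fun E (axis n 1) x" if x: "x \<in> bd" for x
  proof -
    obtain m where "x \<in> E m" using x E_Union by blast
    then show ?thesis using val step_fun_eq by simp
  qed
  have cont: "continuous_on X \<phi>" using \<phi>A by (simp add: test_algebra_def)
  define u where "u v = 1 * vval \<phi> v + (- 1) * cell n v" for v
  have "dform (vval f) u = 0"
  proof (rule dform_vanishing_test)
    show "dform (vval f) (\<delta> v) = 0" if "v \<in> verts G - leaves G" for v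
      using f that unfolding harmonic_extension_iff by blast
    show "fin_grad u" unfolding u_def by (intro fin_grad_lincomb fin_grad_test[OF \<phi>A] fin_grad_cell)
    show "u v = 0" if v: "v \<in> leaves G" for v
    proof -
      obtain m where m: "\<iota> (Vertex v) \<in> E m" using leaf_in_boundary[OF v] E_Union by blast
      have "v \<in> verts G" using v by (simp add: leaves_def)
      then show ?thesis using val[OF m] cell_eq[OF _ E_subset_nbhd[OF m], of n]
        by (auto simp: u_def vval_def axis_def)
    qed
    fix k :: real assume k: "0 < k"
    obtain \<eta> where \<eta>: "0 < \<eta>" "\<eta> \<le> r0"
      "\<And>x y m. x \<in> X \<Longrightarrow> y \<in> E m \<Longrightarrow> dist x y < \<eta> \<Longrightarrow> \<bar>\<phi> x - axis n 1 $ m\<bar> < k"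
      using near_boundary_value[OF cont step k] by blast
    have "\<bar>u v\<bar> < k" if v: "v \<in> verts G" "infdist (\<iota> (Vertex v)) bd < \<eta>" for v
    proof -
      obtain y where y: "y \<in> bd" "dist (\<iota> (Vertex v)) y < \<eta>"
        using v(2) infdist_less_iff[OF boundary_nonempty] by blast
      obtain m where m: "y \<in> E m" using y(1) E_Union by blast
      have "\<iota> (Vertex v) \<in> nbhd m" using order.strict_trans2[OF y(2) \<eta>(2)] m by (auto simp: nbhd_iff)
      then have "cell n v = axis n 1 $ m" using cell_eq[OF v(1)] by (simp add: axis_def)
      moreover have "\<iota> (Vertex v) \<in> X" using embedding_into vertex_in_points[OF v(1)] by blast
      ultimately show ?thesis using \<eta>(3)[OF _ m y(2)] by (simp add: u_def vval_def)
    qed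
    then have "{v \<in> verts G. k \<le> \<bar>u v\<bar>} \<subseteq> {v \<in> verts G. \<eta> \<le> infdist (\<iota> (Vertex v)) bd}"
      by (auto simp: not_less[symmetric])
    then show "finite {v \<in> verts G. k \<le> \<bar>u v\<bar>}"
      using finite_vertices_far[OF \<eta>(1)] finite_subset by blast
  qed
  then show ?thesis
    unfolding u_def dform_lincomb_right[OF fin_grad_test[OF \<phi>A] fin_grad_cell] by simp
qed

text \<open>Whichever extension and cutoff function \<open>SOME\<close> selects, the coordinates are
  forms against the fixed function \<open>cell n\<close>.\<close>

lemma dn_map_eq:
  "\<exists>f. harmonic_extension G len X \<iota> (step_fun E F) f \<and>
     (\<forall>n. dn_map G len X \<iota> \<mu> E F $ n = inverse (measure \<mu> (E n)) * dform (vval f) (cell n))"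
proof -
  define f where "f = (SOME f. harmonic_extension G len X \<iota> (step_fun E F) f)"
  have f: "harmonic_extension G len X \<iota> (step_fun E F) f"
    unfolding f_def using harmonic_extension_exists by (rule someI_ex)
  have "dn_map G len X \<iota> \<mu> E F $ n = inverse (measure \<mu> (E n)) * dform (vval f) (cell n)" for n
  proof -
    define \<phi> where "\<phi> = (SOME \<phi>. cutoff G len X \<iota> (E n) \<phi>)"
    have \<phi>: "cutoff G len X \<iota> (E n) \<phi>"
      unfolding \<phi>_def using cutoff_exists by (rule someI_ex)
    have "graph_integral G len (\<lambda>e t. edge_fun G len \<iota> f e t * (deriv ^^ 2) (edge_fun G len \<iota> \<phi> e) t) =
        - dform (vval f) (vval \<phi>)"
      using f \<phi> unfolding harmonic_extension_iff by (intro graph_integral_test) (auto simp: cutoff_def)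
    then show ?thesis
      using dform_cutoff[OF f \<phi>] by (simp add: dn_map_def f_def[symmetric] \<phi>_def[symmetric])
  qed
  with f show ?thesis by blast
qed

end

section \<open>The approximating maps\<close>

context metric_graph
begin

lemma maximum_principle_abs:
  assumes "finite I" "I \<subset> verts G" "\<And>v. v \<in> I \<Longrightarrow> dform g (\<delta> v) = 0"
    and bound: "\<And>e. e \<in> arcs G \<Longrightarrow> head G e \<in> I \<Longrightarrow> tail G e \<notin> I \<Longrightarrow> \<bar>g (tail G e)\<bar> \<le> k"
      "\<And>e. e \<in> arcs G \<Longrightarrow> tail G e \<in> I \<Longrightarrow> head G e \<notin> I \<Longrightarrow> \<bar>g (head G e)\<bar> \<le> k"
    and "v \<in> I"
  shows "\<bar>g v\<bar> \<le> k"
proof -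
  have "g v \<le> k"
    using assms(1-3) _ _ assms(6)
    by (rule maximum_principle) (use bound in \<open>force simp: abs_le_iff\<close>)+
  moreover have "- g v \<le> k"
    using assms(1,2) _ _ _ assms(6)
  proof (rule maximum_principle)
    show "dform (\<lambda>v. - g v) (\<delta> v) = 0" if "v \<in> I" for v
      using dform_lincomb_left[of "- 1" g 0 g "\<delta> v"] assms(3)[OF that] by simp
  qed (use bound in \<open>force simp: abs_le_iff\<close>)+
  ultimately show ?thesis by simp
qed

end

context partitioned_completion
begin

definition eps_interior :: "real \<Rightarrow> 'v set" where
  "eps_interior \<epsilon> = verts (eps_graph G len X \<iota> \<epsilon>) - eps_boundary G len X \<iota> \<epsilon>"

lemma eps_graph_simps:
  "arcs (eps_graph G len X \<iota> \<epsilon>) = far_arcs \<epsilon>"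
  "verts (eps_graph G len X \<iota> \<epsilon>) = tail G ` far_arcs \<epsilon> \<union> head G ` far_arcs \<epsilon>"
  "tail (eps_graph G len X \<iota> \<epsilon>) = tail G" "head (eps_graph G len X \<iota> \<epsilon>) = head G"
  by (simp_all add: eps_graph_def far_arcs_def Let_def)

lemma eps_verts_subset: "verts (eps_graph G len X \<iota> \<epsilon>) \<subseteq> verts G"
  unfolding eps_graph_simps using far_arcs_subset[of \<epsilon>] tail_in_verts head_in_verts by blast

lemma eps_boundary_subset: "eps_boundary G len X \<iota> \<epsilon> \<subseteq> verts (eps_graph G len X \<iota> \<epsilon>)"
  by (auto simp: eps_boundary_def)

lemma eps_interiorD:
  assumes "v \<in> eps_interior \<epsilon>"
  shows "v \<in> verts G" "v \<notin> leaves G" "in_arcs G v \<union> out_arcs G v \<subseteq> far_arcs \<epsilon>"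
  using assms eps_verts_subset by (auto simp: eps_interior_def eps_boundary_def eps_graph_simps)

text \<open>An interior vertex keeps all its edges, so harmonicity there in the subgraph is the
  equation \<open>dform g (\<delta> v) = 0\<close> of the whole graph.\<close>

lemma eps_interior_arcs:
  assumes "v \<in> eps_interior \<epsilon>"
  shows "in_arcs (eps_graph G len X \<iota> \<epsilon>) v = in_arcs G v" "out_arcs (eps_graph G len X \<iota> \<epsilon>) v = out_arcs G v"
  using eps_interiorD(3)[OF assms] far_arcs_subset
  by (auto simp: in_arcs_def out_arcs_def eps_graph_simps)

lemma finite_eps_verts: "0 < \<epsilon> \<Longrightarrow> finite (verts (eps_graph G len X \<iota> \<epsilon>))"
  using finite_far_arcs by (simp add: eps_graph_simps)

lemma eps_interior_proper:
  assumes "0 < \<epsilon>"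
  shows "finite (eps_interior \<epsilon>)" "eps_interior \<epsilon> \<subset> verts G"
proof -
  show fin: "finite (eps_interior \<epsilon>)" using finite_eps_verts[OF assms] by (simp add: eps_interior_def)
  have sub: "eps_interior \<epsilon> \<subseteq> verts G - leaves G" using eps_interiorD by blast
  from interior_not_everything[OF sub] fin have "eps_interior \<epsilon> \<noteq> verts G" by auto
  with sub show "eps_interior \<epsilon> \<subset> verts G" by (simp add: psubset_eq subset_iff)
qed

lemma eps_cell_nbhd:
  assumes "\<epsilon> \<le> r0" "v \<in> eps_cell G len X \<iota> \<epsilon> (E n)"
  shows "v \<in> verts G" "v \<in> eps_boundary G len X \<iota> \<epsilon>" "\<iota> (Vertex v) \<in> nbhd n"
proof -
  from assms(2) obtain y where y: "y \<in> E n" "dist (\<iota> (Vertex v)) y < \<epsilon>"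
    and v: "v \<in> eps_boundary G len X \<iota> \<epsilon>" by (auto simp: eps_cell_def)
  then show "v \<in> verts G" "v \<in> eps_boundary G len X \<iota> \<epsilon>"
    using eps_boundary_subset eps_verts_subset by blast+
  show "\<iota> (Vertex v) \<in> nbhd n" using order.strict_trans2[OF y(2) assms(1)] y(1) by (auto simp: nbhd_iff)
qed

text \<open>A leaf lies in the boundary itself. Any other vertex here has an incident edge missing
  from the subgraph, all of whose points, the vertex included, are closer than \<epsilon> to the
  boundary.\<close>

lemma eps_boundary_cell:
  assumes "0 < \<epsilon>" "v \<in> eps_boundary G len X \<iota> \<epsilon>"
  obtains n where "v \<in> eps_cell G len X \<iota> \<epsilon> (E n)"
proof -
  have "\<exists>y\<in>bd. dist (\<iota> (Vertex v)) y < \<epsilon>"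
  proof (cases "v \<in> leaves G")
    case True
    then show ?thesis using leaf_in_boundary assms(1) by (intro bexI[of _ "\<iota> (Vertex v)"]) auto
  next
    case False
    then obtain e where e: "e \<in> in_arcs G v \<union> out_arcs G v" "e \<notin> far_arcs \<epsilon>"
      using assms(2) unfolding eps_boundary_def eps_graph_simps by blast
    then have "e \<in> arcs G" by auto
    then have "\<exists>t\<in>{0..len e}. ep e t = Vertex v"
      using e(1) len_pos[of e] by (auto intro: bexI[of _ 0] bexI[of _ "len e"])
    then have "infdist (\<iota> (Vertex v)) bd < \<epsilon>"
      using e(2) \<open>e \<in> arcs G\<close> by (force simp: far_arcs_def)
    then show ?thesis using infdist_less_iff[OF boundary_nonempty] by blast
  qed
  then obtain y n where "y \<in> E n" "dist (\<iota> (Vertex v)) y < \<epsilon>" using E_Union by blast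
  then show thesis using that[of n] assms(2) by (auto simp: eps_cell_def)
qed

text \<open>Values at vertices outside the subgraph are left free: the equations at interior
  vertices only involve edges of the subgraph.\<close>

definition eps_solution :: "real \<Rightarrow> real ^ 'n \<Rightarrow> ('v \<Rightarrow> real) \<Rightarrow> bool" where
  "eps_solution \<epsilon> F g \<longleftrightarrow>
     (\<forall>v\<in>eps_boundary G len X \<iota> \<epsilon>. g v = data F v) \<and> (\<forall>v\<in>eps_interior \<epsilon>. dform g (\<delta> v) = 0)"

lemma eps_outward_flux:
  assumes "\<And>e. e \<in> far_arcs \<epsilon> \<Longrightarrow> edge_linear f e"
  shows "outward_flux (eps_graph G len X \<iota> \<epsilon>) len \<iota> f v =
    (\<Sum>e\<in>in_arcs (eps_graph G len X \<iota> \<epsilon>) v. grad (vval f) e / len e) -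
    (\<Sum>e\<in>out_arcs (eps_graph G len X \<iota> \<epsilon>) v. grad (vval f) e / len e)"
  using assms far_arcs_subset by (intro outward_flux_eq) (simp_all add: eps_graph_simps)

lemma eps_harmonic_extension_solution:
  assumes \<epsilon>: "0 < \<epsilon>" "\<epsilon> \<le> r0" and f: "eps_harmonic_extension G len X \<iota> E \<epsilon> F f"
  shows "\<And>e. e \<in> far_arcs \<epsilon> \<Longrightarrow> edge_linear f e" "eps_solution \<epsilon> F (vval f)"
proof -
  have ef: "edge_fun (eps_graph G len X \<iota> \<epsilon>) len \<iota> f = edge_fun G len \<iota> f"
    by (simp add: fun_eq_iff edge_fun_def edge_pt_def eps_graph_simps)
  show lin: "edge_linear f e" if "e \<in> far_arcs \<epsilon>" for e
    using f that unfolding eps_harmonic_extension_def harmonic_at_def ef edge_linear_def eps_graph_simps by blast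
  have "vval f v = data F v" if v: "v \<in> eps_boundary G len X \<iota> \<epsilon>" for v
  proof -
    obtain n where n: "v \<in> eps_cell G len X \<iota> \<epsilon> (E n)" using eps_boundary_cell[OF \<epsilon>(1) v] by blast
    then have "vval f v = F $ n" using f by (simp add: eps_harmonic_extension_def vval_def)
    then show ?thesis using data_eq eps_cell_nbhd[OF \<epsilon>(2) n] by simp
  qed
  moreover have "dform (vval f) (\<delta> v) = 0" if v: "v \<in> eps_interior \<epsilon>" for v
  proof -
    have "outward_flux (eps_graph G len X \<iota> \<epsilon>) len \<iota> f v = 0"
      using f v by (simp add: eps_harmonic_extension_def harmonic_at_def eps_interior_def)
    then show ?thesis
      using eps_outward_flux[of \<epsilon> f v, OF lin] eps_interior_arcs[OF v] dform_delta[OF eps_interiorD(1)[OF v]] by simp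
  qed
  ultimately show "eps_solution \<epsilon> F (vval f)" by (simp add: eps_solution_def)
qed

text \<open>The subgraph need not be connected, so the problem is solved on the whole graph with the
  values prescribed at every vertex outside the interior, and then restricted.\<close>

lemma eps_harmonic_extension_exists:
  assumes \<epsilon>: "0 < \<epsilon>" "\<epsilon> \<le> r0"
  shows "\<exists>f. eps_harmonic_extension G len X \<iota> E \<epsilon> F f"
proof -
  have "eps_interior \<epsilon> \<subseteq> verts G - leaves G" using eps_interiorD by blast
  from dirichlet_extension[OF this] obtain f where f: "continuous_on X f"
    "\<forall>e\<in>arcs G. edge_linear f e" "\<forall>v\<in>verts G - eps_interior \<epsilon>. vval f v = data F v"
    "\<forall>v\<in>eps_interior \<epsilon>. dform (vval f) (\<delta> v) = 0" by blast
  have lin: "edge_linear f e" if "e \<in> far_arcs \<epsilon>" for e using f(2) that far_arcs_subset by blast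
  have ef: "edge_fun (eps_graph G len X \<iota> \<epsilon>) len \<iota> f = edge_fun G len \<iota> f"
    by (simp add: fun_eq_iff edge_fun_def edge_pt_def eps_graph_simps)
  have "points (eps_graph G len X \<iota> \<epsilon>) len \<subseteq> points G len"
    using eps_verts_subset[of \<epsilon>] far_arcs_subset[of \<epsilon>] by (auto simp: points_def eps_graph_simps(1))
  then have "\<iota> ` points (eps_graph G len X \<iota> \<epsilon>) len \<subseteq> X" using embedding_into by blast
  then have "continuous_on (\<iota> ` points (eps_graph G len X \<iota> \<epsilon>) len) f"
    using f(1) continuous_on_subset by blast
  moreover have "f (\<iota> (Vertex v)) = F $ n" if v: "v \<in> eps_cell G len X \<iota> \<epsilon> (E n)" for v n
  proof -
    note c = eps_cell_nbhd[OF \<epsilon>(2) v]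
    have "vval f v = data F v" using f(3) c by (simp add: eps_interior_def)
    then show ?thesis using data_eq[OF c(1,3)] by (simp add: vval_def)
  qed
  moreover have "outward_flux (eps_graph G len X \<iota> \<epsilon>) len \<iota> f v = 0" if v: "v \<in> eps_interior \<epsilon>" for v
  proof -
    have "dform (vval f) (\<delta> v) = 0" using f(4) v by blast
    then show ?thesis
      using eps_outward_flux[of \<epsilon> f v, OF lin] eps_interior_arcs[OF v]
      by (simp add: dform_delta[OF eps_interiorD(1)[OF v]])
  qed
  ultimately show ?thesis
    using lin unfolding eps_harmonic_extension_def harmonic_at_def edge_linear_def
      eps_graph_simps(1) eps_interior_def[symmetric] by (intro exI[of _ f]) (simp add: ef)
qed

text \<open>Boundary vertices are included here: each edge contributes at its head with a plus and
  at its tail with a minus sign.\<close>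

lemma eps_green:
  assumes \<epsilon>: "0 < \<epsilon>" and lin: "\<And>e. e \<in> far_arcs \<epsilon> \<Longrightarrow> edge_linear f e"
  shows "(\<Sum>v\<in>verts (eps_graph G len X \<iota> \<epsilon>). w v * outward_flux (eps_graph G len X \<iota> \<epsilon>) len \<iota> f v) =
    (\<Sum>e\<in>far_arcs \<epsilon>. grad (vval f) e * grad w e / len e)"
proof -
  let ?V = "verts (eps_graph G len X \<iota> \<epsilon>)" and ?c = "\<lambda>e. grad (vval f) e / len e"
  have fin: "finite (far_arcs \<epsilon>)" "finite ?V" using finite_far_arcs finite_eps_verts \<epsilon> by auto
  have flux: "w v * outward_flux (eps_graph G len X \<iota> \<epsilon>) len \<iota> f v =
      (\<Sum>e\<in>far_arcs \<epsilon>. (if v = head G e then w v * ?c e else 0) - (if v = tail G e then w v * ?c e else 0))"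
    for v
  proof -
    have ends: "(\<Sum>e\<in>in_arcs (eps_graph G len X \<iota> \<epsilon>) v. ?c e) = (\<Sum>e\<in>far_arcs \<epsilon>. if v = head G e then ?c e else 0)"
      "(\<Sum>e\<in>out_arcs (eps_graph G len X \<iota> \<epsilon>) v. ?c e) = (\<Sum>e\<in>far_arcs \<epsilon>. if v = tail G e then ?c e else 0)"
      using fin(1) by (intro sum.mono_neutral_cong_left; auto simp: in_arcs_def out_arcs_def eps_graph_simps)+
    then show ?thesis
      unfolding eps_outward_flux[of \<epsilon> f v, OF lin, simplified] ends sum_subtractf[symmetric] sum_distrib_left
      by (intro sum.cong refl) (simp add: right_diff_distrib)
  qed
  have "(\<Sum>v\<in>?V. w v * outward_flux (eps_graph G len X \<iota> \<epsilon>) len \<iota> f v) =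
      (\<Sum>e\<in>far_arcs \<epsilon>. \<Sum>v\<in>?V. (if v = head G e then w v * ?c e else 0) - (if v = tail G e then w v * ?c e else 0))"
    unfolding flux by (rule sum.swap)
  also have "\<dots> = (\<Sum>e\<in>far_arcs \<epsilon>. grad (vval f) e * grad w e / len e)"
  proof (intro sum.cong refl)
    fix e assume e: "e \<in> far_arcs \<epsilon>"
    then have "head G e \<in> ?V" "tail G e \<in> ?V" by (auto simp: eps_graph_simps)
    then show "(\<Sum>v\<in>?V. (if v = head G e then w v * ?c e else 0) - (if v = tail G e then w v * ?c e else 0)) =
        grad (vval f) e * grad w e / len e"
      using fin(2) by (simp add: sum_subtractf sum.delta grad_def[of w] diff_divide_distrib right_diff_distrib mult.commute)
  qed
  finally show ?thesis .
qed

text \<open>The flux over one cell is the sum over all vertices weighted by \<open>cell n\<close>,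
  since the flux vanishes in the interior and \<open>cell n\<close> vanishes on the other cells;
  Green's identity then gives the form.\<close>

lemma eps_dn_map_eq:
  assumes \<epsilon>: "0 < \<epsilon>" "\<epsilon> \<le> r0"
  shows "\<exists>f. (\<forall>e\<in>far_arcs \<epsilon>. edge_linear f e) \<and> eps_solution \<epsilon> F (vval f) \<and>
    (\<forall>n. eps_dn_map G len X \<iota> \<mu> E \<epsilon> F $ n = inverse (measure \<mu> (E n)) * dform (vval f) (cell n))"
proof -
  define f where "f = (SOME f. eps_harmonic_extension G len X \<iota> E \<epsilon> F f)"
  have f: "eps_harmonic_extension G len X \<iota> E \<epsilon> F f"
    unfolding f_def using eps_harmonic_extension_exists[OF \<epsilon>] by (rule someI_ex)
  note lin = eps_harmonic_extension_solution(1)[OF \<epsilon> f]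
  have flux0: "outward_flux (eps_graph G len X \<iota> \<epsilon>) len \<iota> f v = 0" if "v \<in> eps_interior \<epsilon>" for v
    using f that by (simp add: eps_harmonic_extension_def harmonic_at_def eps_interior_def)
  let ?flux = "outward_flux (eps_graph G len X \<iota> \<epsilon>) len \<iota> f"
  have "(\<Sum>v\<in>eps_cell G len X \<iota> \<epsilon> (E n). ?flux v) = dform (vval f) (cell n)" for n
  proof -
    have "(\<Sum>v\<in>eps_cell G len X \<iota> \<epsilon> (E n). ?flux v) =
        (\<Sum>v\<in>verts (eps_graph G len X \<iota> \<epsilon>). cell n v * ?flux v)"
    proof (rule sum.mono_neutral_cong_left[OF finite_eps_verts[OF \<epsilon>(1)]])
      show "eps_cell G len X \<iota> \<epsilon> (E n) \<subseteq> verts (eps_graph G len X \<iota> \<epsilon>)"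
        by (auto simp: eps_cell_def eps_boundary_def)
      show "\<forall>v\<in>verts (eps_graph G len X \<iota> \<epsilon>) - eps_cell G len X \<iota> \<epsilon> (E n). cell n v * ?flux v = 0"
      proof
        fix v assume v: "v \<in> verts (eps_graph G len X \<iota> \<epsilon>) - eps_cell G len X \<iota> \<epsilon> (E n)"
        show "cell n v * ?flux v = 0"
        proof (cases "v \<in> eps_interior \<epsilon>")
          case False
          then have "v \<in> eps_boundary G len X \<iota> \<epsilon>" using v by (simp add: eps_interior_def)
          then obtain m where m: "v \<in> eps_cell G len X \<iota> \<epsilon> (E m)" using eps_boundary_cell[OF \<epsilon>(1)] by blast
          then have "m \<noteq> n" using v by blast
          then show ?thesis using eps_cell_nbhd[OF \<epsilon>(2) m] by (simp add: cell_eq)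
        qed (simp add: flux0)
      qed
      show "?flux v = cell n v * ?flux v" if "v \<in> eps_cell G len X \<iota> \<epsilon> (E n)" for v
        using eps_cell_nbhd[OF \<epsilon>(2) that] by (simp add: cell_eq)
    qed
    also have "\<dots> = (\<Sum>e\<in>far_arcs \<epsilon>. grad (vval f) e * grad (cell n) e / len e)"
      by (rule eps_green[OF \<epsilon>(1) lin])
    also have "\<dots> = dform (vval f) (cell n)"
    proof (rule dform_eq_sum[OF finite_far_arcs[OF \<epsilon>(1)] far_arcs_subset, symmetric])
      show "grad (cell n) e = 0" if "e \<in> arcs G" "e \<notin> far_arcs \<epsilon>" for e
        using that far_arcs_antimono[OF \<epsilon>(2)] by (intro grad_cell) auto
    qed
    finally show ?thesis .
  qed
  then have "eps_dn_map G len X \<iota> \<mu> E \<epsilon> F $ n = inverse (measure \<mu> (E n)) * dform (vval f) (cell n)" for n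
    by (simp add: eps_dn_map_def f_def[symmetric])
  then show ?thesis using lin eps_harmonic_extension_solution(2)[OF \<epsilon> f] by blast
qed

section \<open>Uniqueness and linearity on the subgraphs\<close>

lemma dform_cell_cong:
  assumes "\<epsilon> \<le> r0" "\<And>v. v \<in> verts (eps_graph G len X \<iota> \<epsilon>) \<Longrightarrow> g v = h v"
  shows "dform g (cell n) = dform h (cell n)"
  unfolding dform_def
proof (rule sum.cong[OF refl])
  fix e assume "e \<in> {e \<in> arcs G. grad (cell n) e \<noteq> 0}"
  then have "e \<in> far_arcs \<epsilon>" using grad_cell far_arcs_antimono[OF assms(1)] by blast
  then have "g (head G e) = h (head G e)" "g (tail G e) = h (tail G e)"
    by (intro assms(2); simp add: eps_graph_simps)+
  then show "grad g e * grad (cell n) e / len e = grad h e * grad (cell n) e / len e" by (simp add: grad_def)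
qed

lemma eps_maximum_principle:
  assumes "0 < \<epsilon>" "\<And>v. v \<in> eps_interior \<epsilon> \<Longrightarrow> dform g (\<delta> v) = 0"
    and "\<And>v. v \<in> eps_boundary G len X \<iota> \<epsilon> \<Longrightarrow> \<bar>g v\<bar> \<le> k" "v \<in> verts (eps_graph G len X \<iota> \<epsilon>)"
  shows "\<bar>g v\<bar> \<le> k"
proof (cases "v \<in> eps_interior \<epsilon>")
  case True
  have bdry: "w \<in> eps_boundary G len X \<iota> \<epsilon>"
    if "e \<in> far_arcs \<epsilon>" "w \<in> {head G e, tail G e}" "w \<notin> eps_interior \<epsilon>" for e w
    using that by (auto simp: eps_interior_def eps_graph_simps)
  show ?thesis
  proof (rule maximum_principle_abs[OF eps_interior_proper[OF assms(1)] assms(2) _ _ True])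
    show "\<bar>g (tail G e)\<bar> \<le> k" if "e \<in> arcs G" "head G e \<in> eps_interior \<epsilon>" "tail G e \<notin> eps_interior \<epsilon>" for e
      using eps_interiorD(3)[OF that(2)] that by (intro assms(3) bdry[of e]) auto
    show "\<bar>g (head G e)\<bar> \<le> k" if "e \<in> arcs G" "tail G e \<in> eps_interior \<epsilon>" "head G e \<notin> eps_interior \<epsilon>" for e
      using eps_interiorD(3)[OF that(2)] that by (intro assms(3) bdry[of e]) auto
  qed
next
  case False
  then show ?thesis using assms(3,4) by (simp add: eps_interior_def)
qed

lemma eps_solution_unique:
  assumes "0 < \<epsilon>" "eps_solution \<epsilon> F g" "eps_solution \<epsilon> F h" "v \<in> verts (eps_graph G len X \<iota> \<epsilon>)"
  shows "g v = h v"
proof -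
  have "\<bar>1 * g v + (- 1) * h v\<bar> \<le> 0"
  proof (rule eps_maximum_principle[where g = "\<lambda>v. 1 * g v + (- 1) * h v", OF assms(1) _ _ assms(4)])
    show "dform (\<lambda>v. 1 * g v + (- 1) * h v) (\<delta> w) = 0" if "w \<in> eps_interior \<epsilon>" for w
      unfolding dform_lincomb_left using assms(2,3) that by (simp add: eps_solution_def)
    show "\<bar>1 * g w + (- 1) * h w\<bar> \<le> 0" if "w \<in> eps_boundary G len X \<iota> \<epsilon>" for w
      using assms(2,3) that by (simp add: eps_solution_def)
  qed
  then show ?thesis by simp
qed

lemma data_lincomb: "data (s *\<^sub>R F + t *\<^sub>R H) v = s * data F v + t * data H v"
  by (simp add: data_def sum_distrib_left sum.distrib algebra_simps)

lemma eps_solution_lincomb: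
  "eps_solution \<epsilon> F g \<Longrightarrow> eps_solution \<epsilon> H h \<Longrightarrow>
    eps_solution \<epsilon> (s *\<^sub>R F + t *\<^sub>R H) (\<lambda>v. s * g v + t * h v)"
  by (simp add: eps_solution_def data_lincomb dform_lincomb_left)

text \<open>The three extensions are chosen independently of each other. Linearity comes from
  uniqueness on the vertices of the subgraph, the only ones that the form against
  \<open>cell n\<close> sees.\<close>

lemma eps_dn_map_lincomb:
  assumes \<epsilon>: "0 < \<epsilon>" "\<epsilon> \<le> r0"
  shows "eps_dn_map G len X \<iota> \<mu> E \<epsilon> (s *\<^sub>R F + t *\<^sub>R H) =
    s *\<^sub>R eps_dn_map G len X \<iota> \<mu> E \<epsilon> F + t *\<^sub>R eps_dn_map G len X \<iota> \<mu> E \<epsilon> H"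
proof -
  obtain f where f: "eps_solution \<epsilon> F (vval f)"
    "\<forall>n. eps_dn_map G len X \<iota> \<mu> E \<epsilon> F $ n = inverse (measure \<mu> (E n)) * dform (vval f) (cell n)"
    using eps_dn_map_eq[OF \<epsilon>, of F \<mu>] by (elim exE conjE) (rule that)
  obtain h where h: "eps_solution \<epsilon> H (vval h)"
    "\<forall>n. eps_dn_map G len X \<iota> \<mu> E \<epsilon> H $ n = inverse (measure \<mu> (E n)) * dform (vval h) (cell n)"
    using eps_dn_map_eq[OF \<epsilon>, of H \<mu>] by (elim exE conjE) (rule that)
  obtain k where k: "eps_solution \<epsilon> (s *\<^sub>R F + t *\<^sub>R H) (vval k)"
    "\<forall>n. eps_dn_map G len X \<iota> \<mu> E \<epsilon> (s *\<^sub>R F + t *\<^sub>R H) $ n = inverse (measure \<mu> (E n)) * dform (vval k) (cell n)"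
    using eps_dn_map_eq[OF \<epsilon>, of "s *\<^sub>R F + t *\<^sub>R H" \<mu>] by (elim exE conjE) (rule that)
  have "dform (vval k) (cell n) = dform (\<lambda>v. s * vval f v + t * vval h v) (cell n)" for n
    using eps_solution_unique[OF \<epsilon>(1) k(1) eps_solution_lincomb[OF f(1) h(1)]]
    by (rule dform_cell_cong[OF \<epsilon>(2)])
  then show ?thesis
    by (simp add: vec_eq_iff f(2) h(2) k(2) dform_lincomb_left algebra_simps)
qed

lemma linear_eps_dn_map:
  assumes "0 < \<epsilon>" "\<epsilon> \<le> r0"
  shows "linear (eps_dn_map G len X \<iota> \<mu> E \<epsilon>)"
  using eps_dn_map_lincomb[OF assms, of \<mu> 1 _ 1] eps_dn_map_lincomb[OF assms, of \<mu> _ _ 0]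
  by (intro linearI) simp_all

end

section \<open>Convergence\<close>

lemma onorm_le_sum_Basis:
  fixes T :: "'a::euclidean_space \<Rightarrow> 'b::real_normed_vector"
  assumes "linear T"
  shows "onorm T \<le> (\<Sum>b\<in>Basis. norm (T b))"
proof (rule onorm_bound)
  fix x
  have "T x = T (\<Sum>b\<in>Basis. (x \<bullet> b) *\<^sub>R b)" by (simp add: euclidean_representation)
  also have "\<dots> = (\<Sum>b\<in>Basis. (x \<bullet> b) *\<^sub>R T b)"
    using assms by (simp add: linear_sum linear_scale)
  also have "norm \<dots> \<le> (\<Sum>b\<in>Basis. norm x * norm (T b))"
    by (rule sum_norm_le) (simp add: mult_right_mono Basis_le_norm)
  finally show "norm (T x) \<le> (\<Sum>b\<in>Basis. norm (T b)) * norm x"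
    by (simp add: sum_distrib_left mult.commute)
qed (simp add: sum_nonneg)

text \<open>The operator norm is controlled by the values on a finite basis, so pointwise
  convergence is enough.\<close>

lemma onorm_tendsto_zero:
  fixes T :: "'i \<Rightarrow> 'a::euclidean_space \<Rightarrow> 'b::real_normed_vector"
  assumes "\<forall>\<^sub>F i in A. linear (T i)" "\<And>x. ((\<lambda>i. T i x) \<longlongrightarrow> 0) A"
  shows "((\<lambda>i. onorm (T i)) \<longlongrightarrow> 0) A"
proof (rule tendsto_sandwich)
  show "\<forall>\<^sub>F i in A. 0 \<le> onorm (T i)"
    using assms(1) by eventually_elim (simp add: onorm_pos_le linear_conv_bounded_linear)
  show "\<forall>\<^sub>F i in A. onorm (T i) \<le> (\<Sum>b\<in>Basis. norm (T i b))"
    using assms(1) by eventually_elim (rule onorm_le_sum_Basis)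
  show "((\<lambda>i. \<Sum>b\<in>Basis. norm (T i b)) \<longlongrightarrow> 0) A"
    by (intro tendsto_null_sum tendsto_norm_zero assms(2))
qed simp

context partitioned_completion
begin

lemma dform_cell: "dform g (cell n) = (\<Sum>e\<in>far_arcs r0. grad g e * grad (cell n) e / len e)"
  by (rule dform_eq_sum[OF finite_far_arcs[OF r0_pos] far_arcs_subset]) (rule grad_cell)

lemma dform_data: "dform g (data F) = (\<Sum>n\<in>UNIV. F $ n * dform g (cell n))"
proof -
  have "dform g (data F) = (\<Sum>e\<in>far_arcs r0. grad g e * grad (data F) e / len e)"
    by (rule dform_eq_sum[OF finite_far_arcs[OF r0_pos] far_arcs_subset]) (rule grad_data)
  also have "\<dots> = (\<Sum>e\<in>far_arcs r0. \<Sum>n\<in>UNIV. F $ n * (grad g e * grad (cell n) e / len e))"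
  proof (rule sum.cong[OF refl])
    fix e
    have "grad (data F) e = (\<Sum>n\<in>UNIV. F $ n * grad (cell n) e)"
      by (simp add: grad_def data_def sum_subtractf right_diff_distrib)
    then show "grad g e * grad (data F) e / len e = (\<Sum>n\<in>UNIV. F $ n * (grad g e * grad (cell n) e / len e))"
      by (simp add: sum_distrib_left sum_divide_distrib mult.left_commute)
  qed
  also have "\<dots> = (\<Sum>n\<in>UNIV. F $ n * dform g (cell n))"
    unfolding dform_cell by (subst sum.swap) (simp add: sum_distrib_left)
  finally show ?thesis .
qed

text \<open>\<open>data H\<close> may be exchanged for the solution \<open>h\<close>: they agree on
  the boundary of the subgraph, and the flux of \<open>f\<close> vanishes elsewhere. The result is
  visibly symmetric.\<close>

lemma eps_form:
  assumes \<epsilon>: "0 < \<epsilon>" "\<epsilon> \<le> r0" and lin: "\<And>e. e \<in> far_arcs \<epsilon> \<Longrightarrow> edge_linear f e"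
    and f: "eps_solution \<epsilon> F (vval f)" and h: "eps_solution \<epsilon> H h"
  shows "dform (vval f) (data H) = (\<Sum>e\<in>far_arcs \<epsilon>. grad (vval f) e * grad h e / len e)"
proof -
  let ?flux = "outward_flux (eps_graph G len X \<iota> \<epsilon>) len \<iota> f"
  have flux: "?flux v = 0" if v: "v \<in> eps_interior \<epsilon>" for v
  proof -
    have "dform (vval f) (\<delta> v) = 0" using f v by (simp add: eps_solution_def)
    then show ?thesis
      using eps_outward_flux[of \<epsilon> f v, OF lin] eps_interior_arcs[OF v]
      by (simp add: dform_delta[OF eps_interiorD(1)[OF v]])
  qed
  have "dform (vval f) (data H) = (\<Sum>e\<in>far_arcs \<epsilon>. grad (vval f) e * grad (data H) e / len e)"
  proof (rule dform_eq_sum[OF finite_far_arcs[OF \<epsilon>(1)] far_arcs_subset])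
    show "grad (data H) e = 0" if "e \<in> arcs G" "e \<notin> far_arcs \<epsilon>" for e
      using that far_arcs_antimono[OF \<epsilon>(2)] by (intro grad_data) auto
  qed
  also have "\<dots> = (\<Sum>v\<in>verts (eps_graph G len X \<iota> \<epsilon>). data H v * ?flux v)"
    by (rule eps_green[OF \<epsilon>(1) lin, symmetric])
  also have "\<dots> = (\<Sum>v\<in>verts (eps_graph G len X \<iota> \<epsilon>). h v * ?flux v)"
  proof (rule sum.cong[OF refl])
    fix v assume "v \<in> verts (eps_graph G len X \<iota> \<epsilon>)"
    then have "v \<in> eps_interior \<epsilon> \<or> v \<in> eps_boundary G len X \<iota> \<epsilon>" by (auto simp: eps_interior_def)
    then show "data H v * ?flux v = h v * ?flux v"
      using flux h by (auto simp: eps_solution_def)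
  qed
  also have "\<dots> = (\<Sum>e\<in>far_arcs \<epsilon>. grad (vval f) e * grad h e / len e)"
    by (rule eps_green[OF \<epsilon>(1) lin])
  finally show ?thesis .
qed

text \<open>The weights of the inner product cancel the inverse measures in the map. A single
  \<open>g\<close> for all arguments lets symmetry and positivity be read off.\<close>

lemma eps_dn_map_form:
  assumes \<epsilon>: "0 < \<epsilon>" "\<epsilon> \<le> r0" and \<mu>: "\<And>n. measure \<mu> (E n) > 0"
  shows "\<exists>g. \<forall>F H. inner_E \<mu> E (eps_dn_map G len X \<iota> \<mu> E \<epsilon> F) H =
    1 / measure \<mu> (space \<mu>) * (\<Sum>e\<in>far_arcs \<epsilon>. grad (g F) e * grad (g H) e / len e)"
proof -
  have "\<forall>F. \<exists>f. (\<forall>e\<in>far_arcs \<epsilon>. edge_linear f e) \<and> eps_solution \<epsilon> F (vval f) \<and>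
    (\<forall>n. eps_dn_map G len X \<iota> \<mu> E \<epsilon> F $ n = inverse (measure \<mu> (E n)) * dform (vval f) (cell n))"
    using eps_dn_map_eq[OF \<epsilon>] by blast
  from choice[OF this] obtain f where f: "\<And>F e. e \<in> far_arcs \<epsilon> \<Longrightarrow> edge_linear (f F) e"
    "\<And>F. eps_solution \<epsilon> F (vval (f F))"
    "\<And>F n. eps_dn_map G len X \<iota> \<mu> E \<epsilon> F $ n = inverse (measure \<mu> (E n)) * dform (vval (f F)) (cell n)"
    by auto
  have "inner_E \<mu> E (eps_dn_map G len X \<iota> \<mu> E \<epsilon> F) H =
      1 / measure \<mu> (space \<mu>) * (\<Sum>e\<in>far_arcs \<epsilon>. grad (vval (f F)) e * grad (vval (f H)) e / len e)" for F H
  proof -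
    have "(\<Sum>n\<in>UNIV. eps_dn_map G len X \<iota> \<mu> E \<epsilon> F $ n * H $ n * measure \<mu> (E n)) =
        (\<Sum>n\<in>UNIV. H $ n * dform (vval (f F)) (cell n))"
      unfolding f(3) by (intro sum.cong refl) (use \<mu> in \<open>simp add: field_simps less_imp_neq[symmetric]\<close>)
    also have "\<dots> = (\<Sum>e\<in>far_arcs \<epsilon>. grad (vval (f F)) e * grad (vval (f H)) e / len e)"
      unfolding dform_data[symmetric] by (rule eps_form[OF \<epsilon> f(1) f(2) f(2)])
    finally show ?thesis by (simp add: inner_E_def)
  qed
  then show ?thesis by (intro exI[of _ "\<lambda>F. vval (f F)"]) blast
qed

lemma eps_solution_close:
  assumes f0: "harmonic_extension G len X \<iota> (step_fun E F) f0" and "0 < k"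
  obtains \<eta> where "0 < \<eta>" "\<eta> \<le> r0"
    "\<And>\<epsilon> g v. 0 < \<epsilon> \<Longrightarrow> \<epsilon> < \<eta> \<Longrightarrow> eps_solution \<epsilon> F g \<Longrightarrow> v \<in> verts (eps_graph G len X \<iota> \<epsilon>) \<Longrightarrow>
      \<bar>g v - vval f0 v\<bar> \<le> k"
proof -
  have f0': "continuous_on X f0" "\<And>x. x \<in> bd \<Longrightarrow> f0 x = step_fun E F x"
    "\<And>v. v \<in> verts G - leaves G \<Longrightarrow> dform (vval f0) (\<delta> v) = 0"
    using f0 unfolding harmonic_extension_iff by blast+
  obtain \<eta> where \<eta>: "0 < \<eta>" "\<eta> \<le> r0"
    "\<And>x y n. x \<in> X \<Longrightarrow> y \<in> E n \<Longrightarrow> dist x y < \<eta> \<Longrightarrow> \<bar>f0 x - F $ n\<bar> < k"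
    using near_boundary_value[OF f0'(1,2) \<open>0 < k\<close>] by blast
  have "\<bar>g v - vval f0 v\<bar> \<le> k"
    if \<epsilon>: "0 < \<epsilon>" "\<epsilon> < \<eta>" and g: "eps_solution \<epsilon> F g" and v: "v \<in> verts (eps_graph G len X \<iota> \<epsilon>)" for \<epsilon> g v
  proof -
    have "\<bar>1 * g v + (- 1) * vval f0 v\<bar> \<le> k"
    proof (rule eps_maximum_principle[where g = "\<lambda>v. 1 * g v + (- 1) * vval f0 v", OF \<epsilon>(1) _ _ v])
      show "dform (\<lambda>v. 1 * g v + (- 1) * vval f0 v) (\<delta> w) = 0" if "w \<in> eps_interior \<epsilon>" for w
        unfolding dform_lincomb_left using g f0'(3) that eps_interiorD[OF that] by (simp add: eps_solution_def)
      show "\<bar>1 * g w + (- 1) * vval f0 w\<bar> \<le> k" if w: "w \<in> eps_boundary G len X \<iota> \<epsilon>" for w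
      proof -
        obtain n where n: "w \<in> eps_cell G len X \<iota> \<epsilon> (E n)" using eps_boundary_cell[OF \<epsilon>(1) w] by blast
        then obtain y where y: "y \<in> E n" "dist (\<iota> (Vertex w)) y < \<epsilon>" by (auto simp: eps_cell_def)
        have "\<epsilon> \<le> r0" using \<epsilon> \<eta> by simp
        note c = eps_cell_nbhd[OF this n]
        have "g w = F $ n" using g w data_eq[OF c(1,3)] by (simp add: eps_solution_def)
        moreover have "\<iota> (Vertex w) \<in> X" using embedding_into vertex_in_points[OF c(1)] by blast
        ultimately show ?thesis using \<eta>(3)[OF _ y(1)] y(2) \<epsilon>(2) by (fastforce simp: vval_def abs_minus_commute)
      qed
    qed
    then show ?thesis by simp
  qed
  then show thesis using that \<eta>(1,2) by blast
qed

lemma eps_dn_map_tendsto: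
  "((\<lambda>\<epsilon>. eps_dn_map G len X \<iota> \<mu> E \<epsilon> F) \<longlongrightarrow> dn_map G len X \<iota> \<mu> E F) (at_right 0)"
proof (rule vec_tendstoI, rule tendstoI)
  fix n and d :: real assume d: "0 < d"
  obtain f0 where f0: "harmonic_extension G len X \<iota> (step_fun E F) f0"
    "\<forall>n. dn_map G len X \<iota> \<mu> E F $ n = inverse (measure \<mu> (E n)) * dform (vval f0) (cell n)"
    using dn_map_eq[of F \<mu>] by (elim exE conjE) (rule that)
  \<comment> \<open>The factor 2 accounts for the two ends of an edge, each contributing an error of
    at most \<open>k\<close>.\<close>
  define C where "C = (\<Sum>e\<in>far_arcs r0. 2 * \<bar>grad (cell n) e\<bar> / len e)"
  define M where "M = \<bar>inverse (measure \<mu> (E n))\<bar> * C"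
  have len0: "0 < len e" if "e \<in> far_arcs r0" for e using that far_arcs_subset len_pos by blast
  have C0: "0 \<le> C" unfolding C_def using len0 by (intro sum_nonneg) (auto simp: less_imp_le)
  have M0: "0 \<le> M" using C0 by (simp add: M_def)
  \<comment> \<open>The added 1 covers \<open>M = 0\<close> and makes \<open>k * M < d\<close>
    strict.\<close>
  define k where "k = d / (M + 1)"
  have k: "0 < k" "k * M < d" using d M0 by (auto simp: k_def field_simps)
  obtain \<eta> where \<eta>: "0 < \<eta>" "\<eta> \<le> r0"
    "\<And>\<epsilon> g v. 0 < \<epsilon> \<Longrightarrow> \<epsilon> < \<eta> \<Longrightarrow> eps_solution \<epsilon> F g \<Longrightarrow> v \<in> verts (eps_graph G len X \<iota> \<epsilon>) \<Longrightarrow>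
      \<bar>g v - vval f0 v\<bar> \<le> k"
    using eps_solution_close[OF f0(1) k(1)] by blast
  show "\<forall>\<^sub>F \<epsilon> in at_right 0. dist (eps_dn_map G len X \<iota> \<mu> E \<epsilon> F $ n) (dn_map G len X \<iota> \<mu> E F $ n) < d"
  proof (rule eventually_at_rightI[OF _ \<eta>(1)])
    fix \<epsilon> assume "\<epsilon> \<in> {0<..<\<eta>}"
    then have \<epsilon>: "0 < \<epsilon>" "\<epsilon> < \<eta>" "\<epsilon> \<le> r0" using \<eta> by auto
    obtain f where f: "eps_solution \<epsilon> F (vval f)"
      "\<forall>n. eps_dn_map G len X \<iota> \<mu> E \<epsilon> F $ n = inverse (measure \<mu> (E n)) * dform (vval f) (cell n)"
      using eps_dn_map_eq[OF \<epsilon>(1,3), of F \<mu>] by (elim exE conjE) (rule that)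
    have "\<bar>dform (vval f) (cell n) - dform (vval f0) (cell n)\<bar> \<le> k * C"
    proof -
      have "dform (vval f) (cell n) - dform (vval f0) (cell n) =
          (\<Sum>e\<in>far_arcs r0. (grad (vval f) e - grad (vval f0) e) * grad (cell n) e / len e)"
        unfolding dform_cell by (simp add: sum_subtractf[symmetric] left_diff_distrib diff_divide_distrib)
      also have "\<bar>\<dots>\<bar> \<le> (\<Sum>e\<in>far_arcs r0. 2 * k * (\<bar>grad (cell n) e\<bar> / len e))"
      proof (rule order.trans[OF sum_abs], rule sum_mono)
        fix e assume e: "e \<in> far_arcs r0"
        then have "e \<in> far_arcs \<epsilon>" using far_arcs_antimono[OF \<epsilon>(3)] by blast
        then have "head G e \<in> verts (eps_graph G len X \<iota> \<epsilon>)" "tail G e \<in> verts (eps_graph G len X \<iota> \<epsilon>)"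
          by (auto simp: eps_graph_simps)
        from this[THEN \<eta>(3)[OF \<epsilon>(1,2) f(1)]]
        have "\<bar>grad (vval f) e - grad (vval f0) e\<bar> \<le> 2 * k" by (simp add: grad_def abs_le_iff)
        then have "\<bar>grad (vval f) e - grad (vval f0) e\<bar> * (\<bar>grad (cell n) e\<bar> / len e) \<le>
            2 * k * (\<bar>grad (cell n) e\<bar> / len e)"
          using len0[OF e] by (intro mult_right_mono) auto
        then show "\<bar>(grad (vval f) e - grad (vval f0) e) * grad (cell n) e / len e\<bar> \<le>
            2 * k * (\<bar>grad (cell n) e\<bar> / len e)"
          using len0[OF e] by (simp add: abs_mult)
      qed
      also have "\<dots> = k * C" by (simp add: C_def sum_distrib_left mult_ac)
      finally show ?thesis .
    qed
    then have "\<bar>inverse (measure \<mu> (E n))\<bar> * \<bar>dform (vval f) (cell n) - dform (vval f0) (cell n)\<bar> \<le> k * M"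
      unfolding M_def using mult_left_mono[of _ "k * C" "\<bar>inverse (measure \<mu> (E n))\<bar>"]
      by (simp add: mult.left_commute)
    then have "\<bar>inverse (measure \<mu> (E n)) * dform (vval f) (cell n) -
        inverse (measure \<mu> (E n)) * dform (vval f0) (cell n)\<bar> \<le> k * M"
      by (simp add: right_diff_distrib[symmetric] abs_mult)
    then show "dist (eps_dn_map G len X \<iota> \<mu> E \<epsilon> F $ n) (dn_map G len X \<iota> \<mu> E F $ n) < d"
      using k(2) f(2) f0(2) by (simp add: dist_real_def)
  qed
qed

section \<open>Passing linearity, symmetry and positivity to the limit\<close>

lemma eventually_small: "\<forall>\<^sub>F \<epsilon> in at_right 0. 0 < \<epsilon> \<and> \<epsilon> \<le> r0"
  by (rule eventually_at_rightI[OF _ r0_pos]) auto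

text \<open>The extensions chosen for different data are not compared with each other; linearity is
  inherited from the approximating maps by uniqueness of limits.\<close>

lemma linear_dn_map: "linear (dn_map G len X \<iota> \<mu> E)"
proof -
  have lincomb: "dn_map G len X \<iota> \<mu> E (s *\<^sub>R F + t *\<^sub>R H) =
      s *\<^sub>R dn_map G len X \<iota> \<mu> E F + t *\<^sub>R dn_map G len X \<iota> \<mu> E H" for s t F H
  proof (rule tendsto_unique[OF _ eps_dn_map_tendsto])
    have "((\<lambda>\<epsilon>. s *\<^sub>R eps_dn_map G len X \<iota> \<mu> E \<epsilon> F + t *\<^sub>R eps_dn_map G len X \<iota> \<mu> E \<epsilon> H) \<longlongrightarrow>
        s *\<^sub>R dn_map G len X \<iota> \<mu> E F + t *\<^sub>R dn_map G len X \<iota> \<mu> E H) (at_right 0)"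
      by (intro tendsto_intros eps_dn_map_tendsto)
    moreover have "\<forall>\<^sub>F \<epsilon> in at_right 0. s *\<^sub>R eps_dn_map G len X \<iota> \<mu> E \<epsilon> F + t *\<^sub>R eps_dn_map G len X \<iota> \<mu> E \<epsilon> H =
        eps_dn_map G len X \<iota> \<mu> E \<epsilon> (s *\<^sub>R F + t *\<^sub>R H)"
      using eventually_small by eventually_elim (simp add: eps_dn_map_lincomb)
    ultimately show "((\<lambda>\<epsilon>. eps_dn_map G len X \<iota> \<mu> E \<epsilon> (s *\<^sub>R F + t *\<^sub>R H)) \<longlongrightarrow>
        s *\<^sub>R dn_map G len X \<iota> \<mu> E F + t *\<^sub>R dn_map G len X \<iota> \<mu> E H) (at_right 0)"
      by (rule Lim_transform_eventually)
  qed simp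
  show ?thesis
    using lincomb[of 1 _ 1] lincomb[of _ _ 0] by (intro linearI) simp_all
qed

lemma inner_E_tendsto:
  "((\<lambda>\<epsilon>. inner_E \<mu> E (eps_dn_map G len X \<iota> \<mu> E \<epsilon> F) H) \<longlongrightarrow> inner_E \<mu> E (dn_map G len X \<iota> \<mu> E F) H) (at_right 0)"
  unfolding inner_E_def by (intro tendsto_intros eps_dn_map_tendsto)

lemma inner_E_commute: "inner_E \<mu> E F H = inner_E \<mu> E H F"
  by (simp add: inner_E_def mult.commute)

lemma dn_map_selfadjoint:
  assumes "\<And>n. measure \<mu> (E n) > 0"
  shows "inner_E \<mu> E (dn_map G len X \<iota> \<mu> E F) H = inner_E \<mu> E F (dn_map G len X \<iota> \<mu> E H)"
proof -
  have "\<forall>\<^sub>F \<epsilon> in at_right 0. inner_E \<mu> E (eps_dn_map G len X \<iota> \<mu> E \<epsilon> F) H =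
      inner_E \<mu> E (eps_dn_map G len X \<iota> \<mu> E \<epsilon> H) F"
    using eventually_small
  proof eventually_elim
    case (elim \<epsilon>)
    then obtain g where g: "\<forall>F H. inner_E \<mu> E (eps_dn_map G len X \<iota> \<mu> E \<epsilon> F) H =
        1 / measure \<mu> (space \<mu>) * (\<Sum>e\<in>far_arcs \<epsilon>. grad (g F) e * grad (g H) e / len e)"
      using eps_dn_map_form[of \<epsilon> \<mu>, OF _ _ assms] by blast
    show ?case unfolding g[rule_format] by (simp add: mult.commute)
  qed
  from Lim_transform_eventually[OF inner_E_tendsto this]
  have "inner_E \<mu> E (dn_map G len X \<iota> \<mu> E H) F = inner_E \<mu> E (dn_map G len X \<iota> \<mu> E F) H"
    using tendsto_unique[OF _ inner_E_tendsto] by (metis trivial_limit_at_right_real)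
  then show ?thesis using inner_E_commute by metis
qed

lemma dn_map_nonneg:
  assumes "\<And>n. measure \<mu> (E n) > 0"
  shows "0 \<le> inner_E \<mu> E (dn_map G len X \<iota> \<mu> E F) F"
proof (rule tendsto_lowerbound[OF inner_E_tendsto[of \<mu> F F]])
  show "\<forall>\<^sub>F \<epsilon> in at_right 0. 0 \<le> inner_E \<mu> E (eps_dn_map G len X \<iota> \<mu> E \<epsilon> F) F"
    using eventually_small
  proof eventually_elim
    case (elim \<epsilon>)
    then obtain g where g: "\<forall>F H. inner_E \<mu> E (eps_dn_map G len X \<iota> \<mu> E \<epsilon> F) H =
        1 / measure \<mu> (space \<mu>) * (\<Sum>e\<in>far_arcs \<epsilon>. grad (g F) e * grad (g H) e / len e)"
      using eps_dn_map_form[of \<epsilon> \<mu>, OF _ _ assms] by blast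
    have "0 \<le> (\<Sum>e\<in>far_arcs \<epsilon>. grad (g F) e * grad (g F) e / len e)"
      using far_arcs_subset len_pos by (intro sum_nonneg) (auto simp: less_imp_le subset_iff)
    then show ?case unfolding g[rule_format] by simp
  qed
qed simp

end

lemma finite_separation:
  fixes E :: "'n::finite \<Rightarrow> 'c::metric_space set"
  assumes "\<And>n. compact (E n)" "disjoint_family E" "\<And>n. E n \<noteq> {}"
  obtains r where "0 < r" "\<And>n m x y. n \<noteq> m \<Longrightarrow> x \<in> E n \<Longrightarrow> y \<in> E m \<Longrightarrow> 2 * r \<le> dist x y"
proof -
  have "\<forall>p. \<exists>d>0. fst p \<noteq> snd p \<longrightarrow> (\<forall>x\<in>E (fst p). \<forall>y\<in>E (snd p). d \<le> dist x y)"
  proof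
    fix p :: "'n \<times> 'n"
    show "\<exists>d>0. fst p \<noteq> snd p \<longrightarrow> (\<forall>x\<in>E (fst p). \<forall>y\<in>E (snd p). d \<le> dist x y)"
    proof (cases "fst p = snd p")
      case True
      \<comment> \<open>A dummy value on the diagonal, so that the minimum can be taken over all
        pairs of indices.\<close>
      then show ?thesis by (intro exI[of _ 1]) simp
    next
      case False
      then have "E (fst p) \<inter> E (snd p) = {}" using assms(2) by (auto simp: disjoint_family_on_def)
      obtain x where x: "x \<in> E (fst p)" "\<forall>x'\<in>E (fst p). infdist x (E (snd p)) \<le> infdist x' (E (snd p))"
        using continuous_attains_inf[OF assms(1,3), OF continuous_on_infdist[OF continuous_on_id],
            of "fst p" "E (snd p)"] by auto
      have "0 < infdist x (E (snd p))"
        using x(1) \<open>E (fst p) \<inter> E (snd p) = {}\<close> assms(3)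
        by (intro infdist_pos_not_in_closed compact_imp_closed assms(1)) auto
      moreover have "infdist x (E (snd p)) \<le> dist x' y" if "x' \<in> E (fst p)" "y \<in> E (snd p)" for x' y
        using x(2) that infdist_le[OF that(2), of x'] by fastforce
      ultimately show ?thesis by blast
    qed
  qed
  from choice[OF this] obtain d where d: "\<forall>p. 0 < d p \<and>
      (fst p \<noteq> snd p \<longrightarrow> (\<forall>x\<in>E (fst p). \<forall>y\<in>E (snd p). d p \<le> dist x y))" by auto
  have pos: "0 < Min (range d)" using d by (subst Min_gr_iff) auto
  moreover have "2 * (Min (range d) / 2) \<le> dist x y" if "n \<noteq> m" "x \<in> E n" "y \<in> E m" for n m x y
  proof -
    have "Min (range d) \<le> d (n, m)" by (intro Min_le) auto
    also have "\<dots> \<le> dist x y" using d[rule_format, of "(n, m)"] that by simp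
    finally show ?thesis by simp
  qed
  ultimately show thesis using that[of "Min (range d) / 2"] by simp
qed

theorem theorem4p7:
  fixes G :: "('v, 'e) pre_digraph" and len :: "'e \<Rightarrow> real"
    and X :: "'c::metric_space set" and \<iota> :: "('v, 'e) gpoint \<Rightarrow> 'c"
    and E :: "'n::finite \<Rightarrow> 'c set" and \<mu> :: "'c measure"
  assumes "metric_graph_completion G len X \<iota>"
    and "compact X"
    and "weakly_connected G len X \<iota>"
    and "(\<Union>n. E n) = boundary G len X \<iota>"
    and "disjoint_family E"
    and "\<And>n. E n \<noteq> {}"
    and "\<And>n. openin (top_of_set (boundary G len X \<iota>)) (E n)"
    and "\<And>n. closedin (top_of_set (boundary G len X \<iota>)) (E n)"
    and "finite_measure \<mu>"
    and "sets \<mu> = sets (restrict_space borel (boundary G len X \<iota>))"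
    and "\<And>n. measure \<mu> (E n) > 0"
  shows "linear (dn_map G len X \<iota> \<mu> E) \<and>
    (\<forall>\<^sub>F \<epsilon> in at_right 0. linear (eps_dn_map G len X \<iota> \<mu> E \<epsilon>)) \<and>
    ((\<lambda>\<epsilon>. onorm (\<lambda>F. eps_dn_map G len X \<iota> \<mu> E \<epsilon> F - dn_map G len X \<iota> \<mu> E F))
       \<longlongrightarrow> 0) (at_right 0) \<and>
    (\<forall>F H. inner_E \<mu> E (dn_map G len X \<iota> \<mu> E F) H = inner_E \<mu> E F (dn_map G len X \<iota> \<mu> E H)) \<and>
    (\<forall>F. inner_E \<mu> E (dn_map G len X \<iota> \<mu> E F) F \<ge> 0)"
proof -
  interpret metric_graph_completion G len X \<iota> by fact
  interpret compact_completion G len X \<iota>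
  proof
    \<comment> \<open>The index type is inhabited, so some member exists, and members are
      nonempty.\<close>
    show "boundary G len X \<iota> \<noteq> {}" using assms(4) assms(6)[of undefined] by auto
  qed fact
  have "compact (E n)" for n
    using assms(8) compact_boundary closedin_compact by blast
  \<comment> \<open>Relatively closed members of the compact boundary are compact, and disjoint
    compact sets have positive distance.\<close>
  then obtain r0 where r0: "0 < r0" "\<And>n m x y. n \<noteq> m \<Longrightarrow> x \<in> E n \<Longrightarrow> y \<in> E m \<Longrightarrow> 2 * r0 \<le> dist x y"
    using finite_separation[OF _ assms(5,6)] by blast
  interpret partitioned_completion G len X \<iota> E r0
    by unfold_locales (use assms(4,6) r0 in auto)
  have lin: "\<forall>\<^sub>F \<epsilon> in at_right 0. linear (eps_dn_map G len X \<iota> \<mu> E \<epsilon>)"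
    using eventually_small by eventually_elim (simp add: linear_eps_dn_map)
  have "((\<lambda>\<epsilon>. onorm (\<lambda>F. eps_dn_map G len X \<iota> \<mu> E \<epsilon> F - dn_map G len X \<iota> \<mu> E F)) \<longlongrightarrow> 0) (at_right 0)"
  proof (rule onorm_tendsto_zero)
    show "\<forall>\<^sub>F \<epsilon> in at_right 0. linear (\<lambda>F. eps_dn_map G len X \<iota> \<mu> E \<epsilon> F - dn_map G len X \<iota> \<mu> E F)"
      using lin by eventually_elim (intro linear_compose_sub linear_dn_map)
    show "((\<lambda>\<epsilon>. eps_dn_map G len X \<iota> \<mu> E \<epsilon> F - dn_map G len X \<iota> \<mu> E F) \<longlongrightarrow> 0) (at_right 0)" for F
      using eps_dn_map_tendsto by (rule LIM_zero)
  qed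
  then show ?thesis
    using linear_dn_map lin dn_map_selfadjoint[OF assms(11)] dn_map_nonneg[OF assms(11)] by blast
qed

end
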